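(* Let $k$ be a field, and let $c, a$ be two positive integers with $c \ge 1$ and $a \ge 2$. Furthermore, let $q \in k$ be an element with $q^a = 1$, and consider the quantum complete intersection $A = A_{c,q}^a = k\langle x_1, \dots, x_c \rangle / (x_i^a, \{x_i x_j - q x_j x_i\}_{i<j})$. Then, given two finitely generated left $A$-modules $M$ and $N$, either $\operatorname{Ext}_A^n(M,N) = 0$ for all $n > 0$, or there exists a non-negative integer $m_0$ such that $\operatorname{Ext}_A^n(M,N) \neq 0$ for all even integers $n \ge m_0$, or $\operatorname{Ext}_A^n(M,N) \neq 0$ for all odd integers $n \ge m_0$.
   Context: $k\langle x_1, \dots, x_c\rangle$ denotes the free associative $k$-algebra on $x_1, \dots, x_c$; the algebra $A_{c,q}^a$ is its quotient by the two-sided ideal generated by $x_i^a$ for $1 \le i \le c$ and $x_i x_j - q x_j x_i$ for $1 \le i < j \le c$. It is a finite-dimensional $k$-algebra. When $c = 1$ it is $k[x]/(x^a)$ and $q$ plays no role. *)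

theory Defs
  imports "HOL-Algebra.Module" "HOL-Algebra.QuotRing" "HOL-Algebra.Elementary_Groups"
begin

section \<open>Quantum complete intersections\<close>

text \<open>An element of the free algebra on the set \<open>X\<close> is given by its coefficient function on
  words, i.e. on lists over \<open>X\<close>; multiplication of words is concatenation.\<close>

definition free_algebra :: "'i set \<Rightarrow> ('i list \<Rightarrow> 'k::field) ring" where
  "free_algebra X =
    \<lparr>carrier = {f. finite {w. f w \<noteq> 0} \<and> {w. f w \<noteq> 0} \<subseteq> lists X},
     mult = (\<lambda>f g w. \<Sum>(u, v)\<in>{(u, v). u @ v = w}. f u * g v),
     one = (\<lambda>w. if w = [] then 1 else 0),
     zero = (\<lambda>w. 0),
     add = (\<lambda>f g w. f w + g w)\<rparr>"

definition fa_const :: "'k::field \<Rightarrow> 'i list \<Rightarrow> 'k" where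
  "fa_const r = (\<lambda>w. if w = [] then r else 0)"

definition fa_var :: "'i \<Rightarrow> 'i list \<Rightarrow> 'k::field" where
  "fa_var i = (\<lambda>w. if w = [i] then 1 else 0)"

definition quantum_ci_rels :: "nat \<Rightarrow> nat \<Rightarrow> 'k::field \<Rightarrow> (nat list \<Rightarrow> 'k) set" where
  "quantum_ci_rels c a q =
    (let F = free_algebra {1..c} in
      {fa_var i [^]\<^bsub>F\<^esub> a | i. i \<in> {1..c}} \<union>
      {(fa_var i \<otimes>\<^bsub>F\<^esub> fa_var j) \<ominus>\<^bsub>F\<^esub> (fa_const q \<otimes>\<^bsub>F\<^esub> (fa_var j \<otimes>\<^bsub>F\<^esub> fa_var i))
        | i j. i \<in> {1..c} \<and> j \<in> {1..c} \<and> i < j})"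

text \<open>The ideals of \<^locale>\<open>ideal\<close>, and hence the ideal \<open>Idl S\<close> generated by \<open>S\<close>, are two-sided.\<close>

definition quantum_ci :: "nat \<Rightarrow> nat \<Rightarrow> 'k::field \<Rightarrow> (nat list \<Rightarrow> 'k) set ring" where
  "quantum_ci c a q =
    free_algebra {1..c} Quot (Idl\<^bsub>free_algebra {1..c}\<^esub> (quantum_ci_rels c a q))"


section \<open>Left modules\<close>

text \<open>The library locale \<^locale>\<open>module\<close> requires a commutative ring of scalars.  Its record type is
  reused; the fields \<open>mult\<close> and \<open>one\<close> of a module are irrelevant.\<close>

locale left_module = R?: ring R + M?: abelian_group M for R (structure) and M (structure) +
  assumes smult_closed:
      "\<lbrakk>a \<in> carrier R; x \<in> carrier M\<rbrakk> \<Longrightarrow> a \<odot>\<^bsub>M\<^esub> x \<in> carrier M"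
    and smult_l_distr:
      "\<lbrakk>a \<in> carrier R; b \<in> carrier R; x \<in> carrier M\<rbrakk> \<Longrightarrow>
        (a \<oplus> b) \<odot>\<^bsub>M\<^esub> x = a \<odot>\<^bsub>M\<^esub> x \<oplus>\<^bsub>M\<^esub> b \<odot>\<^bsub>M\<^esub> x"
    and smult_r_distr:
      "\<lbrakk>a \<in> carrier R; x \<in> carrier M; y \<in> carrier M\<rbrakk> \<Longrightarrow>
        a \<odot>\<^bsub>M\<^esub> (x \<oplus>\<^bsub>M\<^esub> y) = a \<odot>\<^bsub>M\<^esub> x \<oplus>\<^bsub>M\<^esub> a \<odot>\<^bsub>M\<^esub> y"
    and smult_assoc:
      "\<lbrakk>a \<in> carrier R; b \<in> carrier R; x \<in> carrier M\<rbrakk> \<Longrightarrow>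
        (a \<otimes> b) \<odot>\<^bsub>M\<^esub> x = a \<odot>\<^bsub>M\<^esub> (b \<odot>\<^bsub>M\<^esub> x)"
    and smult_one: "x \<in> carrier M \<Longrightarrow> \<one> \<odot>\<^bsub>M\<^esub> x = x"

definition finitely_generated :: "'r ring \<Rightarrow> ('r, 'm) module \<Rightarrow> bool" where
  "finitely_generated R M \<longleftrightarrow>
    (\<exists>S. finite S \<and> S \<subseteq> carrier M \<and>
      (\<forall>x\<in>carrier M. \<exists>r\<in>S \<rightarrow> carrier R. x = (\<Oplus>\<^bsub>M\<^esub>s\<in>S. r s \<odot>\<^bsub>M\<^esub> s)))"

text \<open>Module homomorphisms are extensional (\<^const>\<open>undefined\<close> outside the carrier), so that they
  are equal iff they agree on the carrier.\<close>

definition mod_hom :: "'r ring \<Rightarrow> ('r, 'm) module \<Rightarrow> ('r, 'n) module \<Rightarrow> ('m \<Rightarrow> 'n) set" where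
  "mod_hom R M N = {f \<in> carrier M \<rightarrow>\<^sub>E carrier N.
    (\<forall>x\<in>carrier M. \<forall>y\<in>carrier M. f (x \<oplus>\<^bsub>M\<^esub> y) = f x \<oplus>\<^bsub>N\<^esub> f y) \<and>
    (\<forall>r\<in>carrier R. \<forall>x\<in>carrier M. f (r \<odot>\<^bsub>M\<^esub> x) = r \<odot>\<^bsub>N\<^esub> f x)}"

definition hom_group :: "'r ring \<Rightarrow> ('r, 'm) module \<Rightarrow> ('r, 'n) module \<Rightarrow> ('m \<Rightarrow> 'n) monoid" where
  "hom_group R M N =
    \<lparr>carrier = mod_hom R M N,
     mult = (\<lambda>f g. \<lambda>x\<in>carrier M. f x \<oplus>\<^bsub>N\<^esub> g x),
     one = (\<lambda>x\<in>carrier M. \<zero>\<^bsub>N\<^esub>)\<rparr>"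

text \<open>The free left module with basis \<open>B\<close>: finitely supported functions from \<open>B\<close> to \<open>R\<close>.\<close>

definition free_module :: "'r ring \<Rightarrow> 'b set \<Rightarrow> ('r, 'b \<Rightarrow> 'r) module" where
  "free_module R B =
    \<lparr>carrier = {f. (\<forall>b\<in>B. f b \<in> carrier R) \<and> (\<forall>b. b \<notin> B \<longrightarrow> f b = \<zero>\<^bsub>R\<^esub>) \<and>
        finite {b. f b \<noteq> \<zero>\<^bsub>R\<^esub>}},
     mult = undefined, one = undefined,
     zero = (\<lambda>b. \<zero>\<^bsub>R\<^esub>),
     add = (\<lambda>f g b. f b \<oplus>\<^bsub>R\<^esub> g b),
     smult = (\<lambda>r f b. r \<otimes>\<^bsub>R\<^esub> f b)\<rparr>"


section \<open>Ext\<close>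

text \<open>\<open>\<cdots> \<rightarrow> R\<^bsup>(B 2)\<^esup> \<rightarrow> R\<^bsup>(B 1)\<^esup> \<rightarrow> R\<^bsup>(B 0)\<^esup> \<rightarrow> M \<rightarrow> 0\<close> is exact, where the last map
  is \<open>e\<close> and \<open>d n\<close> goes from \<open>R\<^bsup>(B (n + 1))\<^esup>\<close> to \<open>R\<^bsup>(B n)\<^esup>\<close>.\<close>

definition free_resolution ::
  "'r ring \<Rightarrow> ('r, 'm) module \<Rightarrow> (nat \<Rightarrow> 'b set) \<Rightarrow> (nat \<Rightarrow> ('b \<Rightarrow> 'r) \<Rightarrow> 'b \<Rightarrow> 'r) \<Rightarrow>
    (('b \<Rightarrow> 'r) \<Rightarrow> 'm) \<Rightarrow> bool" where
  "free_resolution R M B d e \<longleftrightarrow>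
    (let F = (\<lambda>n. free_module R (B n)) in
      e \<in> mod_hom R (F 0) M \<and> e ` carrier (F 0) = carrier M \<and>
      (\<forall>n. d n \<in> mod_hom R (F (Suc n)) (F n)) \<and>
      d 0 ` carrier (F (Suc 0)) = a_kernel (F 0) M e \<and>
      (\<forall>n. d (Suc n) ` carrier (F (Suc (Suc n))) = a_kernel (F (Suc n)) (F n) (d n)))"

text \<open>Cohomology of the complex \<open>Hom(R\<^bsup>(B 0)\<^esup>, N) \<rightarrow> Hom(R\<^bsup>(B 1)\<^esup>, N) \<rightarrow> \<cdots>\<close>\<close>

definition codiff ::
  "'r ring \<Rightarrow> (nat \<Rightarrow> 'b set) \<Rightarrow> (nat \<Rightarrow> ('b \<Rightarrow> 'r) \<Rightarrow> 'b \<Rightarrow> 'r) \<Rightarrow> nat \<Rightarrow>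
    (('b \<Rightarrow> 'r) \<Rightarrow> 'n) \<Rightarrow> ('b \<Rightarrow> 'r) \<Rightarrow> 'n" where
  "codiff R B d n f = compose (carrier (free_module R (B (Suc n)))) f (d n)"

definition cocycles ::
  "'r ring \<Rightarrow> (nat \<Rightarrow> 'b set) \<Rightarrow> (nat \<Rightarrow> ('b \<Rightarrow> 'r) \<Rightarrow> 'b \<Rightarrow> 'r) \<Rightarrow> ('r, 'n) module \<Rightarrow> nat \<Rightarrow>
    (('b \<Rightarrow> 'r) \<Rightarrow> 'n) set" where
  "cocycles R B d N n =
    kernel (hom_group R (free_module R (B n)) N) (hom_group R (free_module R (B (Suc n))) N)
      (codiff R B d n)"

primrec coboundaries ::
  "'r ring \<Rightarrow> (nat \<Rightarrow> 'b set) \<Rightarrow> (nat \<Rightarrow> ('b \<Rightarrow> 'r) \<Rightarrow> 'b \<Rightarrow> 'r) \<Rightarrow> ('r, 'n) module \<Rightarrow> nat \<Rightarrow>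
    (('b \<Rightarrow> 'r) \<Rightarrow> 'n) set" where
  "coboundaries R B d N 0 = {\<one>\<^bsub>hom_group R (free_module R (B 0)) N\<^esub>}"
| "coboundaries R B d N (Suc n) =
    codiff R B d n ` carrier (hom_group R (free_module R (B n)) N)"

definition cohomology ::
  "'r ring \<Rightarrow> (nat \<Rightarrow> 'b set) \<Rightarrow> (nat \<Rightarrow> ('b \<Rightarrow> 'r) \<Rightarrow> 'b \<Rightarrow> 'r) \<Rightarrow> ('r, 'n) module \<Rightarrow> nat \<Rightarrow>
    (('b \<Rightarrow> 'r) \<Rightarrow> 'n) set monoid" where
  "cohomology R B d N n =
    (hom_group R (free_module R (B n)) N)\<lparr>carrier := cocycles R B d N n\<rparr>
      Mod coboundaries R B d N n"

text \<open>A type large enough to hold the bases of a free resolution of any module, see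
  \<open>free_resolution_exists\<close> below: generators \<open>Base x\<close> in degree 0 for the elements \<open>x\<close> of the
  module, and in degree \<open>n + 1\<close> generators \<open>Syz xs\<close> for the elements of the kernel in degree
  \<open>n\<close>, each given by a list of its non-zero coefficients.\<close>

datatype ('r, 'm) gen = Base 'm | Syz "(('r, 'm) gen \<times> 'r) list"

definition Ext ::
  "'r ring \<Rightarrow> ('r, 'm) module \<Rightarrow> ('r, 'n) module \<Rightarrow> nat \<Rightarrow>
    ((('r, 'm) gen \<Rightarrow> 'r) \<Rightarrow> 'n) set monoid" where
  "Ext R M N n =
    (let (B, d) = (SOME (B, d). \<exists>e. free_resolution R M B d e) in cohomology R B d N n)"


section \<open>Well-definedness\<close>

text \<open>The notions above are not vacuous: \<^const>\<open>quantum_ci\<close> is a ring, the free resolution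
  chosen in \<^const>\<open>Ext\<close> exists for every left module over every ring, and \<^const>\<open>Ext\<close> is a
  commutative group.\<close>

lemma finite_splits: "finite {(u, v). u @ v = (w :: 'i list)}"
proof -
  have "{(u, v). u @ v = w} \<subseteq> (\<lambda>n. (take n w, drop n w)) ` {..length w}"
  proof clarify
    fix u v assume "w = u @ v"
    then show "(u, v) \<in> (\<lambda>n. (take n (u @ v), drop n (u @ v))) ` {..length (u @ v)}"
      by (intro image_eqI[of _ _ "length u"]) auto
  qed
  then show ?thesis by (rule finite_subset) simp
qed

lemma fa_mult_assoc:
  "(\<Sum>(s, t)\<in>{(s, t). s @ t = w}. (\<Sum>(u, v)\<in>{(u, v). u @ v = s}. f u * g v) * h t) =
   (\<Sum>(u, s)\<in>{(u, s). u @ s = w}. f u * (\<Sum>(v, t)\<in>{(v, t). v @ t = s}. g v * (h t :: 'k::field)))"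
proof -
  let ?S = "\<lambda>w. {(u, v). u @ v = w}"
  have "(\<Sum>(s, t)\<in>?S w. (\<Sum>(u, v)\<in>?S s. f u * g v) * h t) =
      (\<Sum>x\<in>?S w. \<Sum>y\<in>?S (fst x). f (fst y) * g (snd y) * h (snd x))"
    by (simp add: case_prod_beta sum_distrib_right)
  also have "\<dots> = (\<Sum>(x, y)\<in>Sigma (?S w) (\<lambda>x. ?S (fst x)). f (fst y) * g (snd y) * h (snd x))"
    by (rule sum.Sigma) (simp_all add: finite_splits)
  also have "\<dots> = (\<Sum>(x, y)\<in>Sigma (?S w) (\<lambda>x. ?S (snd x)). f (fst x) * (g (fst y) * h (snd y)))"
    by (rule sum.reindex_bij_witness[where
          i = "\<lambda>(x, y). ((fst x @ fst y, snd y), (fst x, fst y))" and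
          j = "\<lambda>(x, y). ((fst y, snd y @ snd x), (snd y, snd x))"])
       (auto simp: mult.assoc)
  also have "\<dots> = (\<Sum>x\<in>?S w. \<Sum>y\<in>?S (snd x). f (fst x) * (g (fst y) * h (snd y)))"
    by (rule sum.Sigma[symmetric]) (simp_all add: finite_splits)
  also have "\<dots> = (\<Sum>(u, s)\<in>?S w. f u * (\<Sum>(v, t)\<in>?S s. g v * h t))"
    by (simp add: case_prod_beta sum_distrib_left)
  finally show ?thesis .
qed

lemma fa_mult_closed:
  assumes "f \<in> carrier (free_algebra X)" "g \<in> carrier (free_algebra X)"
  shows "(\<lambda>w. \<Sum>(u, v)\<in>{(u, v). u @ v = w}. f u * g v) \<in> carrier (free_algebra X)"
proof -
  let ?S = "(\<lambda>(u, v). u @ v) ` ({w. f w \<noteq> 0} \<times> {w. g w \<noteq> 0})"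
  have *: "{w. (\<Sum>(u, v)\<in>{(u, v). u @ v = w}. f u * g v) \<noteq> 0} \<subseteq> ?S"
  proof
    fix w assume "w \<in> {w. (\<Sum>(u, v)\<in>{(u, v). u @ v = w}. f u * g v) \<noteq> 0}"
    then obtain x where "x \<in> {(u, v). u @ v = w}" "(case x of (u, v) \<Rightarrow> f u * g v) \<noteq> 0"
      by (auto elim: sum.not_neutral_contains_not_neutral)
    then show "w \<in> ?S" by (force simp: image_iff)
  qed
  have "finite ?S" "?S \<subseteq> lists X"
    using assms by (force simp: free_algebra_def)+
  with * show ?thesis
    by (simp add: free_algebra_def) (meson finite_subset order_trans)
qed

lemma fa_add_closed:
  assumes "f \<in> carrier (free_algebra X)" "g \<in> carrier (free_algebra X)"
  shows "(\<lambda>w. f w + g w) \<in> carrier (free_algebra X)"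
proof -
  have "{w. f w + g w \<noteq> 0} \<subseteq> {w. f w \<noteq> 0} \<union> {w. g w \<noteq> 0}" by auto
  then show ?thesis using assms
    by (simp add: free_algebra_def) (meson finite_UnI finite_subset order_trans sup_least)
qed

lemma free_algebra_ring: "ring (free_algebra X)"
proof (rule ringI)
  let ?F = "free_algebra X :: ('a list \<Rightarrow> 'b) ring"
  show "abelian_group ?F"
  proof (rule abelian_groupI)
    fix f g assume "f \<in> carrier ?F" "g \<in> carrier ?F"
    then show "f \<oplus>\<^bsub>?F\<^esub> g \<in> carrier ?F"
      using fa_add_closed[of f X g] by (simp add: free_algebra_def)
  next
    fix f assume "f \<in> carrier ?F"
    then show "\<exists>g\<in>carrier ?F. g \<oplus>\<^bsub>?F\<^esub> f = \<zero>\<^bsub>?F\<^esub>"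
      by (intro bexI[of _ "\<lambda>w. - f w"]) (auto simp: free_algebra_def)
  qed (auto simp: free_algebra_def add_ac)
  show "Group.monoid ?F"
  proof (rule monoidI)
    fix f g assume "f \<in> carrier ?F" "g \<in> carrier ?F"
    then show "f \<otimes>\<^bsub>?F\<^esub> g \<in> carrier ?F"
      using fa_mult_closed[of f X g] by (simp add: free_algebra_def)
  next
    have "{w. (if w = [] then 1 else 0) \<noteq> (0::'b)} = {[] :: 'a list}" by auto
    then show "\<one>\<^bsub>?F\<^esub> \<in> carrier ?F" by (simp add: free_algebra_def)
  next
    fix f g h assume "f \<in> carrier ?F" "g \<in> carrier ?F" "h \<in> carrier ?F"
    show "f \<otimes>\<^bsub>?F\<^esub> g \<otimes>\<^bsub>?F\<^esub> h = f \<otimes>\<^bsub>?F\<^esub> (g \<otimes>\<^bsub>?F\<^esub> h)"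
      using fa_mult_assoc[of f g h] by (simp add: free_algebra_def)
  next
    fix f assume "f \<in> carrier ?F"
    have "(\<Sum>(u, v)\<in>{(u, v). u @ v = w}. (if u = [] then 1 else 0) * f v) = f w" for w :: "'a list"
    proof -
      have "(\<Sum>(u, v)\<in>{(u, v). u @ v = w}. (if u = [] then 1 else 0) * f v) =
          (\<Sum>(u, v)\<in>{([] :: 'a list, w)}. (if u = [] then 1 else 0) * f v)"
        by (rule sum.mono_neutral_right) (auto simp: finite_splits split: if_splits)
      then show ?thesis by simp
    qed
    then show "\<one>\<^bsub>?F\<^esub> \<otimes>\<^bsub>?F\<^esub> f = f" by (simp add: free_algebra_def)
    have "(\<Sum>(u, v)\<in>{(u, v). u @ v = w}. f u * (if v = [] then 1 else 0)) = f w" for w :: "'a list"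
    proof -
      have "(\<Sum>(u, v)\<in>{(u, v). u @ v = w}. f u * (if v = [] then 1 else 0)) =
          (\<Sum>(u, v)\<in>{(w, [] :: 'a list)}. f u * (if v = [] then 1 else 0))"
        by (rule sum.mono_neutral_right) (auto simp: finite_splits split: if_splits)
      then show ?thesis by simp
    qed
    then show "f \<otimes>\<^bsub>?F\<^esub> \<one>\<^bsub>?F\<^esub> = f" by (simp add: free_algebra_def)
  qed
qed (auto simp: free_algebra_def case_prod_beta distrib_left distrib_right sum.distrib)

lemma fa_const_closed: "fa_const r \<in> carrier (free_algebra X)"
proof -
  have "{w. fa_const r w \<noteq> 0} \<subseteq> {[]}" by (auto simp: fa_const_def)
  then have "finite {w. fa_const r w \<noteq> 0}" by (rule finite_subset) simp
  then show ?thesis by (auto simp: free_algebra_def fa_const_def split: if_splits)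
qed

lemma fa_var_closed: "i \<in> X \<Longrightarrow> fa_var i \<in> carrier (free_algebra X)"
  by (auto simp: free_algebra_def fa_var_def)

lemma quantum_ci_ring: "ring (quantum_ci c a (q::'k::field))"
proof -
  let ?F = "free_algebra {1..c} :: (nat list \<Rightarrow> 'k) ring"
  interpret F: ring ?F by (rule free_algebra_ring)
  have v: "fa_var i \<in> carrier ?F" if "i \<in> {1..c}" for i
    using that by (rule fa_var_closed)
  have "quantum_ci_rels c a q \<subseteq> carrier ?F"
    unfolding quantum_ci_rels_def Let_def
    by (safe intro!: F.nat_pow_closed F.minus_closed F.m_closed fa_const_closed v)
  then show ?thesis
    unfolding quantum_ci_def by (intro ideal.quotient_is_ring F.genideal_ideal)
qed

lemma free_module_left_module:
  fixes R :: "'r ring" (structure)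
  assumes "ring R" shows "left_module R (free_module R B)"
proof -
  interpret ring R by fact
  let ?F = "free_module R B"
  have add: "(\<lambda>b. f b \<oplus> g b) \<in> carrier ?F" if "f \<in> carrier ?F" "g \<in> carrier ?F" for f g
  proof -
    have "{b. f b \<oplus> g b \<noteq> \<zero>} \<subseteq> {b. f b \<noteq> \<zero>} \<union> {b. g b \<noteq> \<zero>}" by auto
    with that show ?thesis by (auto simp: free_module_def intro: finite_subset)
  qed
  have c: "f b \<in> carrier R" if "f \<in> carrier ?F" for f b
    using that by (cases "b \<in> B") (auto simp: free_module_def)
  have smult: "(\<lambda>b. r \<otimes> f b) \<in> carrier ?F" if "f \<in> carrier ?F" "r \<in> carrier R" for r f
  proof -
    have "{b. r \<otimes> f b \<noteq> \<zero>} \<subseteq> {b. f b \<noteq> \<zero>}" using that by auto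
    with that show ?thesis by (auto simp: free_module_def intro: finite_subset)
  qed
  have ag: "abelian_group ?F"
  proof (rule abelian_groupI)
    fix f g assume "f \<in> carrier ?F" "g \<in> carrier ?F"
    then show "f \<oplus>\<^bsub>?F\<^esub> g \<in> carrier ?F"
      using add[of f g] by (simp add: free_module_def)
  next
    fix f assume f: "f \<in> carrier ?F"
    show "\<exists>g\<in>carrier ?F. g \<oplus>\<^bsub>?F\<^esub> f = \<zero>\<^bsub>?F\<^esub>"
      using smult[OF f, of "\<ominus> \<one>"] c[OF f]
      by (intro bexI[of _ "\<lambda>b. \<ominus> \<one> \<otimes> f b"]) (auto simp: free_module_def l_minus l_neg)
  next
    fix f g h assume "f \<in> carrier ?F" "g \<in> carrier ?F" "h \<in> carrier ?F"
    then show "f \<oplus>\<^bsub>?F\<^esub> g \<oplus>\<^bsub>?F\<^esub> h = f \<oplus>\<^bsub>?F\<^esub> (g \<oplus>\<^bsub>?F\<^esub> h)"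
      using c[of f] c[of g] c[of h] by (auto simp: free_module_def a_assoc)
  next
    fix f g assume "f \<in> carrier ?F" "g \<in> carrier ?F"
    then show "f \<oplus>\<^bsub>?F\<^esub> g = g \<oplus>\<^bsub>?F\<^esub> f"
      using c[of f] c[of g] by (auto simp: free_module_def a_comm)
  next
    fix f assume "f \<in> carrier ?F"
    then show "\<zero>\<^bsub>?F\<^esub> \<oplus>\<^bsub>?F\<^esub> f = f" using c[of f] by (auto simp: free_module_def)
  qed (simp add: free_module_def)
  show ?thesis
  proof (intro left_module.intro left_module_axioms.intro ag)
    fix r f assume "r \<in> carrier R" "f \<in> carrier ?F"
    then show "r \<odot>\<^bsub>?F\<^esub> f \<in> carrier ?F"
      using smult[of f r] by (simp add: free_module_def)
  next
    fix r s f assume "r \<in> carrier R" "s \<in> carrier R" "f \<in> carrier ?F"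
    then show "(r \<oplus> s) \<odot>\<^bsub>?F\<^esub> f = r \<odot>\<^bsub>?F\<^esub> f \<oplus>\<^bsub>?F\<^esub> s \<odot>\<^bsub>?F\<^esub> f"
      "(r \<otimes> s) \<odot>\<^bsub>?F\<^esub> f = r \<odot>\<^bsub>?F\<^esub> (s \<odot>\<^bsub>?F\<^esub> f)"
      using c[of f] by (auto simp: free_module_def l_distr m_assoc)
  next
    fix r f g assume "r \<in> carrier R" "f \<in> carrier ?F" "g \<in> carrier ?F"
    then show "r \<odot>\<^bsub>?F\<^esub> (f \<oplus>\<^bsub>?F\<^esub> g) = r \<odot>\<^bsub>?F\<^esub> f \<oplus>\<^bsub>?F\<^esub> r \<odot>\<^bsub>?F\<^esub> g"
      using c[of f] c[of g] by (auto simp: free_module_def r_distr)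
  next
    fix f assume "f \<in> carrier ?F"
    then show "\<one> \<odot>\<^bsub>?F\<^esub> f = f" using c[of f] by (auto simp: free_module_def)
  qed fact
qed

context left_module
begin

lemma smult_zero_r: "r \<in> carrier R \<Longrightarrow> r \<odot>\<^bsub>M\<^esub> \<zero>\<^bsub>M\<^esub> = \<zero>\<^bsub>M\<^esub>"
  by (metis M.add.l_cancel_one' M.zero_closed smult_closed smult_r_distr M.r_zero)

lemma smult_zero_l: "x \<in> carrier M \<Longrightarrow> \<zero> \<odot>\<^bsub>M\<^esub> x = \<zero>\<^bsub>M\<^esub>"
  by (metis M.add.l_cancel_one' R.zero_closed smult_closed smult_l_distr R.r_zero)

lemma smult_finsum:
  assumes "finite A" "r \<in> carrier R" "g \<in> A \<rightarrow> carrier M"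
  shows "r \<odot>\<^bsub>M\<^esub> (\<Oplus>\<^bsub>M\<^esub>b\<in>A. g b) = (\<Oplus>\<^bsub>M\<^esub>b\<in>A. r \<odot>\<^bsub>M\<^esub> g b)"
  using assms
proof (induction A rule: finite_induct)
  case (insert x A)
  then have "g x \<in> carrier M" "g \<in> A \<rightarrow> carrier M" by auto
  with insert show ?case
    by (simp add: smult_r_distr smult_closed Pi_def)
qed (simp add: smult_zero_r)

end

lemma free_module_onto:
  fixes R :: "'r ring" (structure) and M :: "('r, 'm) module" and g :: "'b \<Rightarrow> 'm"
  assumes "left_module R M"
  assumes K: "K \<subseteq> carrier M" "\<zero>\<^bsub>M\<^esub> \<in> K" "\<And>x y. x \<in> K \<Longrightarrow> y \<in> K \<Longrightarrow> x \<oplus>\<^bsub>M\<^esub> y \<in> K"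
    "\<And>r x. r \<in> carrier R \<Longrightarrow> x \<in> K \<Longrightarrow> r \<odot>\<^bsub>M\<^esub> x \<in> K"
    and g: "g ` B = K"
  shows "\<exists>h. h \<in> mod_hom R (free_module R B) M \<and> h ` carrier (free_module R B) = K"
proof -
  interpret left_module R M by fact
  let ?F = "free_module R B"
  define s where "s f = {b. f b \<noteq> \<zero>}" for f :: "'b \<Rightarrow> 'r"
  define h where "h = (\<lambda>f\<in>carrier ?F. \<Oplus>\<^bsub>M\<^esub>b\<in>s f. f b \<odot>\<^bsub>M\<^esub> g b)"
  interpret F: left_module R ?F by (rule free_module_left_module) (rule R.ring_axioms)
  have gM: "g b \<in> carrier M" if "b \<in> B" for b using that K g by auto
  have sB: "s f \<subseteq> B" "finite (s f)" if "f \<in> carrier ?F" for f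
    using that by (auto simp: free_module_def s_def)
  have fR: "f b \<in> carrier R" if "f \<in> carrier ?F" for f b
    using that by (cases "b \<in> B") (auto simp: free_module_def)
  have hA: "h f = (\<Oplus>\<^bsub>M\<^esub>b\<in>A. f b \<odot>\<^bsub>M\<^esub> g b)"
    if "f \<in> carrier ?F" "finite A" "s f \<subseteq> A" "A \<subseteq> B" for f A
  proof -
    have "(\<Oplus>\<^bsub>M\<^esub>b\<in>s f. f b \<odot>\<^bsub>M\<^esub> g b) = (\<Oplus>\<^bsub>M\<^esub>b\<in>A. f b \<odot>\<^bsub>M\<^esub> g b)"
      using that fR[OF that(1)] gM
      by (intro M.add.finprod_mono_neutral_cong_left)
         (auto simp: s_def intro!: smult_closed smult_zero_l)
    with that show ?thesis by (simp add: h_def)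
  qed
  have sumK: "(\<Oplus>\<^bsub>M\<^esub>b\<in>A. f b \<odot>\<^bsub>M\<^esub> g b) \<in> K"
    if "finite A" "A \<subseteq> B" "f \<in> carrier ?F" for f A
    using that(1,2)
  proof (induction A rule: finite_induct)
    case (insert x A)
    have "(\<lambda>b. f b \<odot>\<^bsub>M\<^esub> g b) \<in> insert x A \<rightarrow> carrier M"
      using insert gM fR[OF that(3)] by (auto intro!: smult_closed)
    with insert show ?case using K g fR[OF that(3)]
      by (auto simp: Pi_def)
  qed (simp add: K)
  have hK: "h f \<in> K" if "f \<in> carrier ?F" for f
    using sumK[OF sB(2,1)] that by (simp add: h_def)
  have "h \<in> mod_hom R ?F M"
    unfolding mod_hom_def
  proof (safe intro!: PiE_I)
    fix f assume "f \<in> carrier ?F" then show "h f \<in> carrier M" using hK K by auto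
  next
    fix f assume "f \<notin> carrier ?F" then show "h f = undefined" by (simp add: h_def)
  next
    fix f f' assume f: "f \<in> carrier ?F" "f' \<in> carrier ?F"
    let ?A = "s f \<union> s f'"
    have A: "finite ?A" "?A \<subseteq> B" using sB f by auto
    have sA: "s (f \<oplus>\<^bsub>?F\<^esub> f') \<subseteq> ?A" by (auto simp: s_def free_module_def)
    have "h (f \<oplus>\<^bsub>?F\<^esub> f') = (\<Oplus>\<^bsub>M\<^esub>b\<in>?A. (f \<oplus>\<^bsub>?F\<^esub> f') b \<odot>\<^bsub>M\<^esub> g b)"
      using f by (intro hA A sA) auto
    also have "\<dots> = (\<Oplus>\<^bsub>M\<^esub>b\<in>?A. f b \<odot>\<^bsub>M\<^esub> g b \<oplus>\<^bsub>M\<^esub> f' b \<odot>\<^bsub>M\<^esub> g b)"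
      using A fR f gM by (intro M.finsum_cong')
        (auto simp: free_module_def smult_l_distr intro!: smult_closed M.a_closed)
    also have "\<dots> = h f \<oplus>\<^bsub>M\<^esub> h f'"
    proof -
      have "(\<lambda>b. f b \<odot>\<^bsub>M\<^esub> g b) \<in> ?A \<rightarrow> carrier M" "(\<lambda>b. f' b \<odot>\<^bsub>M\<^esub> g b) \<in> ?A \<rightarrow> carrier M"
        using A fR f gM by (blast intro: smult_closed)+
      then show ?thesis using hA[OF f(1) A(1) _ A(2)] hA[OF f(2) A(1) _ A(2)]
        by (simp add: M.finsum_addf)
    qed
    finally show "h (f \<oplus>\<^bsub>?F\<^esub> f') = h f \<oplus>\<^bsub>M\<^esub> h f'" .
  next
    fix r f assume r: "r \<in> carrier R" and f: "f \<in> carrier ?F"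
    have "h (r \<odot>\<^bsub>?F\<^esub> f) = (\<Oplus>\<^bsub>M\<^esub>b\<in>s f. (r \<odot>\<^bsub>?F\<^esub> f) b \<odot>\<^bsub>M\<^esub> g b)"
    proof (rule hA)
      show "s (r \<odot>\<^bsub>?F\<^esub> f) \<subseteq> s f" using r by (auto simp: free_module_def s_def)
    qed (use f r sB[OF f] in \<open>auto intro: F.smult_closed\<close>)
    also have "\<dots> = (\<Oplus>\<^bsub>M\<^esub>b\<in>s f. r \<odot>\<^bsub>M\<^esub> (f b \<odot>\<^bsub>M\<^esub> g b))"
      using sB[OF f] fR[OF f] r gM by (intro M.finsum_cong')
        (auto simp: free_module_def smult_assoc intro!: smult_closed)
    also have "\<dots> = r \<odot>\<^bsub>M\<^esub> h f"
      using sB[OF f] fR[OF f] r gM f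
      by (subst smult_finsum[symmetric]) (auto simp: h_def intro!: smult_closed)
    finally show "h (r \<odot>\<^bsub>?F\<^esub> f) = r \<odot>\<^bsub>M\<^esub> h f" .
  qed
  moreover have "x \<in> h ` carrier ?F" if "x \<in> K" for x
  proof -
    obtain b where b: "b \<in> B" "x = g b" using \<open>x \<in> K\<close> g by blast
    let ?e = "\<lambda>b'. if b' = b then \<one> else \<zero>"
    have "{b'. ?e b' \<noteq> \<zero>} \<subseteq> {b}" by auto
    then have e: "?e \<in> carrier ?F" using b finite_subset by (fastforce simp: free_module_def)
    have "h ?e = (\<Oplus>\<^bsub>M\<^esub>b'\<in>{b}. ?e b' \<odot>\<^bsub>M\<^esub> g b')"
      using b by (intro hA e) (auto simp: s_def)
    also have "\<dots> = x" using b gM[of b] by (simp add: smult_one M.finsum_insert)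
    finally show ?thesis using e by (metis imageI)
  qed
  ultimately show ?thesis using hK by blast
qed

lemma mod_hom_zero:
  fixes R :: "'r ring" and M :: "('r, 'm) module" and N :: "('r, 'n) module"
  assumes "left_module R M" "left_module R N" "f \<in> mod_hom R M N"
  shows "f \<zero>\<^bsub>M\<^esub> = \<zero>\<^bsub>N\<^esub>"
proof -
  interpret M: left_module R M by fact
  interpret N: left_module R N by fact
  have "f \<zero>\<^bsub>M\<^esub> \<in> carrier N" "f (\<zero>\<^bsub>M\<^esub> \<oplus>\<^bsub>M\<^esub> \<zero>\<^bsub>M\<^esub>) = f \<zero>\<^bsub>M\<^esub> \<oplus>\<^bsub>N\<^esub> f \<zero>\<^bsub>M\<^esub>"
    using assms(3) unfolding mod_hom_def by blast+
  then show ?thesis by (metis M.M.r_zero M.M.zero_closed N.M.add.l_cancel_one')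
qed

lemma syzygy_exists:
  fixes R :: "'r ring" and M :: "('r, 'm) module" and B :: "('r, 'x) gen set"
  assumes "left_module R M" "f \<in> mod_hom R (free_module R B) M"
  shows "\<exists>B' h. h \<in> mod_hom R (free_module R B' :: ('r, ('r, 'x) gen \<Rightarrow> 'r) module) (free_module R B) \<and>
    h ` carrier (free_module R B') = a_kernel (free_module R B) M f"
proof -
  let ?F = "free_module R B"
  interpret M: left_module R M by fact
  interpret F: left_module R ?F by (rule free_module_left_module) (rule M.R.ring_axioms)
  let ?K = "a_kernel ?F M f"
  define g where "g y = (case y of Syz xs \<Rightarrow>
      \<lambda>b. (case map_of xs b of None \<Rightarrow> \<zero>\<^bsub>R\<^esub> | Some r \<Rightarrow> r) | Base x \<Rightarrow> \<lambda>b. \<zero>\<^bsub>R\<^esub>)" for y :: "('r, 'x) gen"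
  have "x \<in> range g" if "x \<in> ?K" for x
  proof -
    have "finite {b. x b \<noteq> \<zero>\<^bsub>R\<^esub>}" using that by (auto simp: a_kernel_def' free_module_def)
    then obtain bs where "set bs = {b. x b \<noteq> \<zero>\<^bsub>R\<^esub>}" using finite_list by blast
    then have "g (Syz (map (\<lambda>b. (b, x b)) bs)) = x"
      by (auto simp: g_def map_of_map_restrict restrict_map_def)
    then show ?thesis by (metis rangeI)
  qed
  then have "g ` (g -` ?K) = ?K" by auto
  moreover have "?K \<subseteq> carrier ?F" by (auto simp: a_kernel_def')
  moreover have "\<zero>\<^bsub>?F\<^esub> \<in> ?K"
    using mod_hom_zero[OF F.left_module_axioms M.left_module_axioms assms(2)]
    by (simp add: a_kernel_def')
  moreover have "x \<oplus>\<^bsub>?F\<^esub> y \<in> ?K" if "x \<in> ?K" "y \<in> ?K" for x y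
    using that assms(2) by (auto simp: a_kernel_def' mod_hom_def)
  moreover have "r \<odot>\<^bsub>?F\<^esub> x \<in> ?K" if "r \<in> carrier R" "x \<in> ?K" for r x
    using that assms(2) by (auto simp: a_kernel_def' mod_hom_def F.smult_closed M.smult_zero_r)
  ultimately show ?thesis using free_module_onto[OF F.left_module_axioms, of ?K g "g -` ?K"] by metis
qed

theorem free_resolution_exists:
  fixes R :: "'r ring" and M :: "('r, 'm) module"
  assumes "left_module R M"
  shows "\<exists>(B :: nat \<Rightarrow> ('r, 'm) gen set) d e. free_resolution R M B d e"
proof -
  interpret M: left_module R M by fact
  define B0 :: "('r, 'm) gen set" where "B0 = Base ` carrier M"
  have "\<exists>e. e \<in> mod_hom R (free_module R B0) M \<and> e ` carrier (free_module R B0) = carrier M"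
    by (rule free_module_onto[OF assms, where g = "\<lambda>y. case y of Base x \<Rightarrow> x | Syz _ \<Rightarrow> undefined"])
       (auto simp: B0_def image_image M.smult_closed)
  then obtain e where e: "e \<in> mod_hom R (free_module R B0) M"
    "e ` carrier (free_module R B0) = carrier M" by blast
  let ?P = "\<lambda>(B, B', h). h \<in> mod_hom R (free_module R (B' :: ('r, 'm) gen set)) (free_module R (B :: ('r, 'm) gen set))"
  let ?Q = "\<lambda>(B, B', h) (C, C', h'). C = B' \<and>
     h' ` carrier (free_module R C') = a_kernel (free_module R B') (free_module R B) h"
  obtain B1 d0 where d0: "d0 \<in> mod_hom R (free_module R (B1 :: ('r, 'm) gen set)) (free_module R B0)"
    "d0 ` carrier (free_module R B1) = a_kernel (free_module R B0) M e"
    using syzygy_exists[OF assms e(1)] by blast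
  have "\<exists>f. \<forall>n. (?P (f n) \<and> (n = 0 \<longrightarrow> f n = (B0, B1, d0))) \<and> ?Q (f n) (f (Suc n))"
    proof (rule dependent_nat_choice)
      show "\<exists>x. ?P x \<and> (0 = (0::nat) \<longrightarrow> x = (B0, B1, d0))" using d0 by auto
    next
      fix x and n :: nat
      assume *: "?P x \<and> (n = 0 \<longrightarrow> x = (B0, B1, d0))"
      obtain B B' h where x: "x = (B, B', h)" by (cases x)
      with * have "h \<in> mod_hom R (free_module R B') (free_module R B)" by simp
      from syzygy_exists[OF free_module_left_module[OF M.R.ring_axioms] this]
      show "\<exists>y. (?P y \<and> (Suc n = 0 \<longrightarrow> y = (B0, B1, d0))) \<and> ?Q x y"
        by (auto simp: x)
    qed
  then obtain f where *: "\<forall>n. (?P (f n) \<and> (n = 0 \<longrightarrow> f n = (B0, B1, d0))) \<and> ?Q (f n) (f (Suc n))"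
    by (rule exE)
  have f: "?P (f n)" "f 0 = (B0, B1, d0)" "?Q (f n) (f (Suc n))" for n
    using conjunct1[OF conjunct1[OF spec[OF *, of n]]] conjunct2[OF spec[OF *, of n]]
      conjunct2[OF conjunct1[OF spec[OF *, of 0]]] by simp_all
  define B where "B n = fst (f n)" for n
  define d where "d n = snd (snd (f n))" for n
  have B': "fst (snd (f n)) = B (Suc n)" for n
    using f(3)[of n] by (auto simp: B_def case_prod_beta)
  have "free_resolution R M B d e"
    unfolding free_resolution_def Let_def
  proof (intro conjI allI)
    show "e \<in> mod_hom R (free_module R (B 0)) M" "e ` carrier (free_module R (B 0)) = carrier M"
      using e f(2) by (auto simp: B_def)
    show "d 0 ` carrier (free_module R (B (Suc 0))) = a_kernel (free_module R (B 0)) M e"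
      using d0 f(2) B'[of 0] by (auto simp: B_def d_def)
    show "d n \<in> mod_hom R (free_module R (B (Suc n))) (free_module R (B n))" for n
      using f(1)[of n] B'[of n] by (auto simp: B_def d_def case_prod_beta)
    show "d (Suc n) ` carrier (free_module R (B (Suc (Suc n)))) =
        a_kernel (free_module R (B (Suc n))) (free_module R (B n)) (d n)" for n
      using f(3)[of n] B'[of n] B'[of "Suc n"] by (auto simp: B_def d_def case_prod_beta)
  qed
  then show ?thesis by blast
qed

corollary Ext_resolution:
  fixes R :: "'r ring" and M :: "('r, 'm) module" and N :: "('r, 'n) module"
  assumes "left_module R M"
  obtains B :: "nat \<Rightarrow> ('r, 'm) gen set" and d e
  where "free_resolution R M B d e" and "\<And>n. Ext R M N n = cohomology R B d N n"
proof -
  define p where "p = (SOME (B :: nat \<Rightarrow> ('r, 'm) gen set, d). \<exists>e. free_resolution R M B d e)"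
  have "case p of (B, d) \<Rightarrow> \<exists>e. free_resolution R M B d e"
    unfolding p_def by (rule someI_ex) (use free_resolution_exists[OF assms] in auto)
  then show ?thesis using that by (auto simp: Ext_def p_def[symmetric] case_prod_beta)
qed


lemma hom_group_comm_group:
  fixes R :: "'r ring" and M :: "('r, 'm) module" and N :: "('r, 'n) module"
  assumes "left_module R M" "left_module R N"
  shows "comm_group (hom_group R M N)"
proof -
  interpret M: left_module R M by fact
  interpret N: left_module R N by fact
  let ?H = "hom_group R M N"
  have c: "f x \<in> carrier N" if "f \<in> mod_hom R M N" "x \<in> carrier M" for f x
    using that by (auto simp: mod_hom_def)
  have ext: "f = (\<lambda>x\<in>carrier M. f x)" if "f \<in> mod_hom R M N" for f
    using that by (auto simp: mod_hom_def PiE_def extensional_restrict)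
  have neg: "\<ominus>\<^bsub>N\<^esub> (r \<odot>\<^bsub>N\<^esub> y) = r \<odot>\<^bsub>N\<^esub> (\<ominus>\<^bsub>N\<^esub> y)" if "r \<in> carrier R" "y \<in> carrier N" for r y
  proof (rule N.M.minus_equality)
    show "r \<odot>\<^bsub>N\<^esub> (\<ominus>\<^bsub>N\<^esub> y) \<oplus>\<^bsub>N\<^esub> r \<odot>\<^bsub>N\<^esub> y = \<zero>\<^bsub>N\<^esub>"
      using that by (simp add: N.smult_r_distr[symmetric] N.M.l_neg N.smult_zero_r)
  qed (use that in \<open>auto intro: N.smult_closed\<close>)
  show ?thesis
  proof (rule comm_groupI)
    fix f g assume "f \<in> carrier ?H" "g \<in> carrier ?H"
    then have fg: "f \<in> mod_hom R M N" "g \<in> mod_hom R M N" by (auto simp: hom_group_def)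
    then have "f (x \<oplus>\<^bsub>M\<^esub> y) = f x \<oplus>\<^bsub>N\<^esub> f y" "g (x \<oplus>\<^bsub>M\<^esub> y) = g x \<oplus>\<^bsub>N\<^esub> g y"
      "r \<in> carrier R \<Longrightarrow> f (r \<odot>\<^bsub>M\<^esub> x) = r \<odot>\<^bsub>N\<^esub> f x"
      "r \<in> carrier R \<Longrightarrow> g (r \<odot>\<^bsub>M\<^esub> x) = r \<odot>\<^bsub>N\<^esub> g x"
      if "x \<in> carrier M" "y \<in> carrier M" for x y r
      using that by (auto simp: mod_hom_def)
    with fg show "f \<otimes>\<^bsub>?H\<^esub> g \<in> carrier ?H"
      by (auto simp: hom_group_def mod_hom_def[of R M N] M.smult_closed N.smult_r_distr c N.M.add.m_ac)
    show "f \<otimes>\<^bsub>?H\<^esub> g = g \<otimes>\<^bsub>?H\<^esub> f"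
      using fg by (auto simp: hom_group_def c N.M.a_comm intro!: restrict_ext)
  next
    fix f g h assume "f \<in> carrier ?H" "g \<in> carrier ?H" "h \<in> carrier ?H"
    then show "f \<otimes>\<^bsub>?H\<^esub> g \<otimes>\<^bsub>?H\<^esub> h = f \<otimes>\<^bsub>?H\<^esub> (g \<otimes>\<^bsub>?H\<^esub> h)"
      by (auto simp: hom_group_def c N.M.a_assoc intro!: restrict_ext)
  next
    show "\<one>\<^bsub>?H\<^esub> \<in> carrier ?H"
      by (auto simp: hom_group_def mod_hom_def M.smult_closed N.smult_zero_r)
  next
    fix f assume "f \<in> carrier ?H"
    then have f: "f \<in> mod_hom R M N" by (simp add: hom_group_def)
    then show "\<one>\<^bsub>?H\<^esub> \<otimes>\<^bsub>?H\<^esub> f = f"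
      by (subst (2) ext[OF f]) (auto simp: hom_group_def c intro!: restrict_ext)
    have e: "f (x \<oplus>\<^bsub>M\<^esub> y) = f x \<oplus>\<^bsub>N\<^esub> f y" "r \<in> carrier R \<Longrightarrow> f (r \<odot>\<^bsub>M\<^esub> x) = r \<odot>\<^bsub>N\<^esub> f x"
      if "x \<in> carrier M" "y \<in> carrier M" for x y r
      using that f by (auto simp: mod_hom_def)
    have "(\<lambda>x\<in>carrier M. \<ominus>\<^bsub>N\<^esub> f x) \<in> carrier ?H"
      using c[OF f] e by (auto simp: hom_group_def mod_hom_def M.smult_closed neg N.M.minus_add)
    moreover have "(\<lambda>x\<in>carrier M. \<ominus>\<^bsub>N\<^esub> f x) \<otimes>\<^bsub>?H\<^esub> f = \<one>\<^bsub>?H\<^esub>"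
      using c[OF f] by (auto simp: hom_group_def N.M.l_neg intro!: restrict_ext)
    ultimately show "\<exists>g\<in>carrier ?H. g \<otimes>\<^bsub>?H\<^esub> f = \<one>\<^bsub>?H\<^esub>" by blast
  qed
qed

lemma cohomology_comm_group:
  fixes R :: "'r ring" and M :: "('r, 'm) module" and N :: "('r, 'n) module"
  assumes "left_module R M" "left_module R N" "free_resolution R M B d e"
  shows "comm_group (cohomology R B d N n)"
proof -
  interpret M: left_module R M by fact
  interpret N: left_module R N by fact
  let ?F = "\<lambda>n. free_module R (B n)"
  let ?H = "\<lambda>n. hom_group R (?F n) N"
  have F: "left_module R (?F n)" for n by (rule free_module_left_module[OF M.R.ring_axioms])
  have H: "comm_group (?H n)" for n by (rule hom_group_comm_group[OF F assms(2)])
  have d: "d n \<in> mod_hom R (?F (Suc n)) (?F n)" for n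
    using assms(3) by (simp add: free_resolution_def Let_def)
  have dx: "d n x \<in> carrier (?F n)" if "x \<in> carrier (?F (Suc n))" for n x
    using d[of n] that unfolding mod_hom_def by blast
  have dd: "d n (d (Suc n) x) = \<zero>\<^bsub>?F n\<^esub>" if "x \<in> carrier (?F (Suc (Suc n)))" for n x
  proof -
    have "d (Suc n) x \<in> a_kernel (?F (Suc n)) (?F n) (d n)"
      using assms(3) that unfolding free_resolution_def Let_def by blast
    then show ?thesis by (simp add: a_kernel_def')
  qed
  have cod_closed: "codiff R B d n f \<in> mod_hom R (?F (Suc n)) N" if "f \<in> mod_hom R (?F n) N" for f n
  proof -
    interpret F: left_module R "?F (Suc n)" by (rule F)
    have "f (d n (x \<oplus>\<^bsub>?F (Suc n)\<^esub> y)) = f (d n x) \<oplus>\<^bsub>N\<^esub> f (d n y)"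
      "r \<in> carrier R \<Longrightarrow> f (d n (r \<odot>\<^bsub>?F (Suc n)\<^esub> x)) = r \<odot>\<^bsub>N\<^esub> f (d n x)"
      "f (d n x) \<in> carrier N"
      if "x \<in> carrier (?F (Suc n))" "y \<in> carrier (?F (Suc n))" for x y r
      using that \<open>f \<in> mod_hom R (?F n) N\<close> d[of n] dx unfolding mod_hom_def by auto
    then show ?thesis
      by (auto simp: mod_hom_def[of R "?F (Suc n)"] codiff_def compose_def F.smult_closed)
  qed
  have cod_hom: "codiff R B d n \<in> Group.hom (?H n) (?H (Suc n))" for n
  proof (rule homI)
    fix f assume "f \<in> carrier (?H n)"
    then show "codiff R B d n f \<in> carrier (?H (Suc n))"
      using cod_closed by (simp add: hom_group_def)
  next
    fix f g
    show "codiff R B d n (f \<otimes>\<^bsub>?H n\<^esub> g) = codiff R B d n f \<otimes>\<^bsub>?H (Suc n)\<^esub> codiff R B d n g"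
      using dx by (auto simp: hom_group_def codiff_def compose_def intro!: restrict_ext)
  qed
  interpret C: group_hom "?H k" "?H (Suc k)" "codiff R B d k" for k
    using H cod_hom by (simp add: group_hom_def group_hom_axioms_def comm_group.axioms)
  have Z: "subgroup (cocycles R B d N n) (?H n)"
    unfolding cocycles_def by (rule C.subgroup_kernel)
  have "coboundaries R B d N n \<subseteq> cocycles R B d N n"
  proof (cases n)
    case 0
    then show ?thesis by (simp add: cocycles_def kernel_def C.hom_one)
  next
    case (Suc k)
    have "codiff R B d (Suc k) (codiff R B d k f) = \<one>\<^bsub>?H (Suc (Suc k))\<^esub>"
      if "f \<in> mod_hom R (?F k) N" for f
      using mod_hom_zero[OF F assms(2) that] dx dd
      by (auto simp: codiff_def compose_def hom_group_def intro!: restrict_ext)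
    with cod_closed show ?thesis
      by (auto simp: Suc cocycles_def kernel_def) (auto simp: hom_group_def)
  qed
  moreover have "subgroup (coboundaries R B d N n) (?H n)"
  proof (cases n)
    case 0
    then show ?thesis by (simp add: group.triv_subgroup[OF comm_group.axioms(2)[OF H]])
  next
    case (Suc k)
    then show ?thesis using C.img_is_subgroup by simp
  qed
  ultimately have "subgroup (coboundaries R B d N n) ((?H n)\<lparr>carrier := cocycles R B d N n\<rparr>)"
    using Z by (intro group.subgroup_incl[OF comm_group.axioms(2)[OF H]])
  moreover have "comm_group ((?H n)\<lparr>carrier := cocycles R B d N n\<rparr>)"
  proof (rule group.group_comm_groupI)
    show "Group.group ((?H n)\<lparr>carrier := cocycles R B d N n\<rparr>)"
      using Z comm_group.axioms(2)[OF H] by (rule subgroup.subgroup_is_group)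
  next
    fix f g assume "f \<in> carrier ((?H n)\<lparr>carrier := cocycles R B d N n\<rparr>)"
      "g \<in> carrier ((?H n)\<lparr>carrier := cocycles R B d N n\<rparr>)"
    then show "f \<otimes>\<^bsub>(?H n)\<lparr>carrier := cocycles R B d N n\<rparr>\<^esub> g =
        g \<otimes>\<^bsub>(?H n)\<lparr>carrier := cocycles R B d N n\<rparr>\<^esub> f"
      using comm_monoid.m_comm[OF comm_group.axioms(1)[OF H]] subgroup.subset[OF Z] by auto
  qed
  ultimately show ?thesis
    unfolding cohomology_def by (metis comm_group.abelian_FactGroup)
qed

theorem Ext_comm_group:
  assumes "left_module R M" "left_module R N"
  shows "comm_group (Ext R M N n)"
  using assms by (metis Ext_resolution cohomology_comm_group)

end

theory Submission
  imports Complex_Main Defs "HOL-Library.Function_Algebras" "HOL-Library.Fun_Lexorder" "HOL-Library.Infinite_Set"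
begin

text \<open>Let \<open>A\<close> be the quantum complete intersection.  Each algebra \<open>k[x]/(x^a)\<close> has a bimodule resolution
of period 2, whose maps are multiplication by \<open>x \<otimes> 1 - 1 \<otimes> x\<close> and by \<open>\<Sum>s<a. x^s \<otimes> x^(a-1-s)\<close>.
Multiplying these resolutions for \<open>x_1, \<dots>, x_c\<close>, with powers of \<open>q\<close> inserted because the variables
only \<open>q\<close>-commute, gives a bimodule resolution of \<open>A\<close>.  Its terms are indexed by multi-indices
\<open>i \<in> \<nat>^c\<close>, in homological degree \<open>|i|\<close>.  For modules \<open>M\<close>, \<open>N\<close> it yields a complex \<open>C(M)\<close> of families
\<open>z(i) \<in> Hom_k(M,N)\<close> whose cohomology is \<open>Ext_A(M,N)\<close>.  The exponents of \<open>q\<close> depend on \<open>i\<close> through the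
internal degree of the generator, in which \<open>i_l\<close> counts \<open>a\<close> for every two steps.  As \<open>q^a = 1\<close>, raising
an \<open>i_l\<close> by 2 changes no coefficient, so the shifts \<open>\<chi>_1, \<dots>, \<chi>_c\<close> by 2 in the \<open>c\<close> directions commute
with the differential: \<open>C(M)\<close> is a complex of modules over the polynomial ring
\<open>k[\<chi>_1, \<dots>, \<chi>_c]\<close>, finitely generated when \<open>M\<close> and \<open>N\<close> are.

Three facts give the theorem.

\<^item> Noetherianity.  The cohomology classes killed by all \<open>\<chi>_j\<close> form a finitely generated module on
  which the \<open>\<chi>_j\<close> act as zero, so they live in bounded degrees.  Beyond those degrees, a
  nonzero class in degree \<open>n\<close> has a nonzero multiple in degree \<open>n + 2\<close> (\<open>exact_at_minus_2\<close>, from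
  \<open>eventually_generated\<close>).  Hence in the even degrees, and likewise in the odd ones, the cohomology is
  eventually zero or eventually nonzero.

\<^item> Vanishing in large degrees implies vanishing in positive degrees
  (\<open>eventually_vanish_imp_vanish\<close>).  Dividing \<open>C(M)\<close> by \<open>\<chi>_l\<close> bounds \<open>i_l\<close> by 1; dividing by
  all of them leaves a complex in the degrees \<open>0, \<dots>, c\<close>.  In the long exact sequence of
  \<open>\<chi>_l\<close>, vanishing above degree \<open>e\<close> for the quotient makes \<open>\<chi>_l\<close> injective on the cohomology above
  degree \<open>e - 1\<close>, hence this cohomology, which vanishes eventually, vanishes already there.  Undoing
  the \<open>c\<close> divisions lowers the bound from \<open>c\<close> to 0.

\<^item> The complex computes \<open>Ext\<close> (\<open>trivial_Ext_iff\<close>).  No comparison of resolutions is made: \<open>C(-)\<close>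
  is exact, and \<open>C(F)\<close> is acyclic in positive degrees for \<open>F\<close> free (\<open>free_exact\<close>).  So dimension
  shifting along any free resolution turns the vanishing of degree \<open>n + 1\<close> for \<open>M\<close> into the statement
  that homomorphisms from a syzygy to \<open>N\<close> extend to the free module containing it
  (\<open>presentation\<close>), which is the vanishing of \<open>Ext\<close>.\<close>

section \<open>Multi-indices\<close>

definition mdeg :: "nat \<Rightarrow> (nat \<Rightarrow> nat) \<Rightarrow> nat" where
  "mdeg c i = (\<Sum>l\<in>{1..c}. i l)"

text \<open>Only the coordinates \<open>1, \<dots>, c\<close> of a function matter as a multi-index.  Elsewhere coordinate 0 is
free to carry a finite label.\<close>

definition msupp :: "nat \<Rightarrow> (nat \<Rightarrow> nat) \<Rightarrow> bool" where
  "msupp c i \<longleftrightarrow> (\<forall>l. l \<notin> {1..c} \<longrightarrow> i l = 0)"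

text \<open>Multiplication by the polynomial variable \<open>\<chi>_j\<close> on families indexed by multi-indices.\<close>

definition shift :: "nat \<Rightarrow> ((nat \<Rightarrow> nat) \<Rightarrow> 'b::zero) \<Rightarrow> (nat \<Rightarrow> nat) \<Rightarrow> 'b" where
  "shift j z i = (if 2 \<le> i j then z (i(j := i j - 2)) else 0)"

lemma mdeg_upd: "l \<in> {1..c} \<Longrightarrow> mdeg c (i(l := p)) + i l = mdeg c i + p"
  unfolding mdeg_def by (simp add: sum.remove)

lemma msupp_upd: "l \<in> {1..c} \<Longrightarrow> msupp c (i(l := p)) \<longleftrightarrow> msupp c i"
  by (auto simp: msupp_def)

section \<open>Noetherianity of the shifts\<close>

lemma incseq_subsequence:
  fixes s :: "nat \<Rightarrow> nat"
  shows "\<exists>r. strict_mono (r :: nat \<Rightarrow> nat) \<and> (\<forall>k k'. k \<le> k' \<longrightarrow> s (r k) \<le> s (r k'))"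
proof -
  \<comment> \<open>\<open>t n\<close> is an index after \<open>n\<close> at which the tail after \<open>n\<close> attains its minimum.\<close>
  have "\<exists>t>n. \<forall>m>n. s t \<le> s m" for n
    using ex_has_least_nat[of "\<lambda>m. n < m" "Suc n" s] by blast
  then obtain t where t: "\<And>n. n < t n" "\<And>n m. n < m \<Longrightarrow> s (t n) \<le> s m" by metis
  define r where "r k = (t ^^ Suc k) 0" for k
  have r: "r (Suc k) = t (r k)" for k by (simp add: r_def)
  have m: "strict_mono r" by (rule strict_mono_Suc_iff[THEN iffD2]) (simp add: r t)
  have "s (r k) \<le> s (r k')" if "k \<le> k'" for k k'
  proof (cases "k = k'")
    case False
    then have "k < k'" using that by simp
    have "r k = t ((t ^^ k) 0)" by (simp add: r_def)
    moreover have "(t ^^ k) 0 < r k'"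
      using strict_mono_less[OF m, of k k'] \<open>k < k'\<close> t(1)[of "(t ^^ k) 0"] calculation by linarith
    ultimately show ?thesis using t(2) by simp
  qed simp
  with m show ?thesis by blast
qed

text \<open>Dickson's lemma.\<close>

lemma dickson:
  fixes f :: "nat \<Rightarrow> 'a \<Rightarrow> nat"
  assumes "finite A"
  shows "\<exists>r. strict_mono (r :: nat \<Rightarrow> nat) \<and> (\<forall>m\<in>A. \<forall>k k'. k \<le> k' \<longrightarrow> f (r k) m \<le> f (r k') m)"
  using assms
proof (induction A rule: finite_induct)
  case empty
  show ?case by (intro exI[of _ id]) (simp add: strict_mono_def)
next
  case (insert x A)
  then obtain r :: "nat \<Rightarrow> nat" where r: "strict_mono r" "\<And>m k k'. m \<in> A \<Longrightarrow> k \<le> k' \<Longrightarrow> f (r k) m \<le> f (r k') m" by blast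
  obtain r' :: "nat \<Rightarrow> nat" where r': "strict_mono r'" "\<And>k k'. k \<le> k' \<Longrightarrow> f (r (r' k)) x \<le> f (r (r' k')) x"
    using incseq_subsequence[of "\<lambda>k. f (r k) x"] by blast
  have "f (r (r' k)) m \<le> f (r (r' k')) m" if "m \<in> insert x A" "k \<le> k'" for m k k'
    using that r(2)[of m "r' k" "r' k'"] r'(2)[of k k'] strict_mono_less_eq[OF r'(1)] by auto
  moreover have "strict_mono (r \<circ> r')" using r(1) r'(1) by (simp add: strict_mono_def)
  ultimately show ?case by (intro exI[of _ "r \<circ> r'"]) (simp add: o_def)
qed

text \<open>A graded module \<open>T\<close> over \<open>k[\<chi>_1, \<dots>, \<chi>_c]\<close>, the variables having degree 2, with a map \<open>ev\<close> to families
of scalars under which the variables become shifts.  A position is a multi-index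
together with one of \<open>N\<close> labels, kept in coordinate 0; finitely many labels mean that \<open>ev\<close> maps to a
finitely generated free module.\<close>

locale graded_shift_module =
  fixes c N :: nat and T :: "nat \<Rightarrow> 'e set" and ev :: "'e \<Rightarrow> (nat \<Rightarrow> nat) \<Rightarrow> 'k::field"
    and cmb :: "'e \<Rightarrow> 'k \<Rightarrow> 'e \<Rightarrow> 'e" and sh :: "nat \<Rightarrow> 'e \<Rightarrow> 'e"
  assumes T_cmb: "\<lbrakk>z \<in> T n; y \<in> T n\<rbrakk> \<Longrightarrow> cmb z r y \<in> T n"
    and T_sh: "\<lbrakk>z \<in> T n; j \<in> {1..c}\<rbrakk> \<Longrightarrow> sh j z \<in> T (n + 2)"
    and ev_cmb: "\<lbrakk>z \<in> T n; y \<in> T n\<rbrakk> \<Longrightarrow> ev (cmb z r y) f = ev z f - r * ev y f"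
    and ev_sh: "\<lbrakk>z \<in> T n; j \<in> {1..c}\<rbrakk> \<Longrightarrow> ev (sh j z) f = shift j (ev z) f"
begin

definition pos :: "nat \<Rightarrow> (nat \<Rightarrow> nat) set" where
  "pos n = {f. f 0 < N \<and> (\<forall>m>c. f m = 0) \<and> mdeg c f = n}"

text \<open>The lexicographically largest position with a nonzero entry: the leading monomial of Groebner
basis theory.\<close>

definition lead :: "nat \<Rightarrow> 'e \<Rightarrow> (nat \<Rightarrow> nat) \<Rightarrow> bool" where
  "lead n z f \<longleftrightarrow> f \<in> pos n \<and> ev z f \<noteq> 0 \<and> (\<forall>g\<in>pos n. less_fun f g \<longrightarrow> ev z g = 0)"

lemma finite_pos: "finite (pos n)"
proof -
  let ?B = "PiE {0..c} (\<lambda>m. {..N + n})"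
  have "inj_on (\<lambda>f. restrict f {0..c}) (pos n)"
  proof (rule inj_onI)
    fix f g assume fg: "f \<in> pos n" "g \<in> pos n" "restrict f {0..c} = restrict g {0..c}"
    show "f = g"
    proof
      fix m show "f m = g m"
        using fg(1,2) fun_cong[OF fg(3), of m] by (cases "m \<le> c") (auto simp: pos_def)
    qed
  qed
  moreover have "(\<lambda>f. restrict f {0..c}) ` pos n \<subseteq> ?B"
  proof (intro image_subsetI PiE_I)
    fix f m assume f: "f \<in> pos n" "m \<in> {0..c}"
    have "f m \<le> n" if "m \<in> {1..c}"
      using that f(1) member_le_sum[of m "{1..c}" f] by (simp add: pos_def mdeg_def)
    then show "restrict f {0..c} m \<in> {..N + n}" using f by (cases "m = 0") (auto simp: pos_def)
  qed auto
  moreover have "finite ?B" by (intro finite_PiE) auto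
  ultimately show ?thesis by (metis finite_imageD finite_subset)
qed

lemma pos_total:
  assumes "f \<in> pos n" "g \<in> pos n" shows "less_fun f g \<or> f = g \<or> less_fun g f"
proof (rule less_fun_trichotomy)
  have "{k. f k \<noteq> g k} \<subseteq> {..c}" using assms by (auto simp: pos_def intro: ccontr)
  then show "finite {k. f k \<noteq> g k}" by (rule finite_subset) simp
qed

lemma asymp_less_fun: "asymp_on A less_fun" "transp_on A less_fun"
  using less_fun_asym less_fun_trans by (blast intro: asymp_onI transp_onI)+

lemma lead_exists:
  assumes "f \<in> pos n" "ev z f \<noteq> 0" shows "\<exists>f. lead n z f"
proof -
  let ?A = "{f \<in> pos n. ev z f \<noteq> 0}"
  have "\<exists>m\<in>?A. \<forall>x\<in>?A. x \<noteq> m \<longrightarrow> \<not> less_fun m x"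
    using assms finite_pos by (intro Finite_Set.bex_max_element asymp_less_fun) auto
  then obtain m where "m \<in> ?A" "\<And>x. x \<in> ?A \<Longrightarrow> x \<noteq> m \<Longrightarrow> \<not> less_fun m x" by blast
  moreover have "x \<noteq> m" if "less_fun m x" for x using that less_fun_irrefl by metis
  ultimately have "lead n z m" unfolding lead_def by blast
  then show ?thesis by blast
qed

lemma pos_up: "f \<in> pos n \<Longrightarrow> j \<in> {1..c} \<Longrightarrow> f(j := f j + 2) \<in> pos (n + 2)"
  using mdeg_upd[of j c f "f j + 2"] by (auto simp: pos_def)

lemma pos_down: "f \<in> pos (n + 2) \<Longrightarrow> j \<in> {1..c} \<Longrightarrow> 2 \<le> f j \<Longrightarrow> f(j := f j - 2) \<in> pos n"
  using mdeg_upd[of j c f "f j - 2"] by (auto simp: pos_def)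

lemma lead_sh:
  assumes z: "z \<in> T n" and f: "lead n z f" and j: "j \<in> {1..c}"
  shows "lead (n + 2) (sh j z) (f(j := f j + 2))"
  unfolding lead_def
proof (intro conjI ballI impI)
  show "f(j := f j + 2) \<in> pos (n + 2)" using f j pos_up unfolding lead_def by blast
  show "ev (sh j z) (f(j := f j + 2)) \<noteq> 0"
    using f by (simp add: ev_sh[OF z j] shift_def lead_def)
  fix g assume g: "g \<in> pos (n + 2)" "less_fun (f(j := f j + 2)) g"
  show "ev (sh j z) g = 0"
  proof (cases "2 \<le> g j")
    case True
    from g(2) obtain k where k: "(f(j := f j + 2)) k < g k" "\<And>k'. k' < k \<Longrightarrow> (f(j := f j + 2)) k' = g k'"
      by (rule less_funE) (rule that)
    have "less_fun f (g(j := g j - 2))"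
    proof (intro less_funI exI conjI allI impI)
      show "f k < (g(j := g j - 2)) k" using k(1) by (auto split: if_splits)
      show "f k' = (g(j := g j - 2)) k'" if "k' < k" for k' using k(2)[OF that] by (auto split: if_splits)
    qed
    then show ?thesis using f pos_down[OF g(1) j True] True
      by (simp add: ev_sh[OF z j] shift_def lead_def)
  qed (simp add: ev_sh[OF z j] shift_def)
qed

definition leads :: "nat \<Rightarrow> (nat \<Rightarrow> nat) set" where
  "leads n = {f. \<exists>z\<in>T n. lead n z f}"

text \<open>Shifts preserve the lexicographic order, so leading positions are closed under them, as the leading
monomials of an ideal are closed under multiplication by monomials.\<close>

lemma leads_up: "f \<in> leads n \<Longrightarrow> j \<in> {1..c} \<Longrightarrow> f(j := f j + 2) \<in> leads (n + 2)"
  unfolding leads_def using lead_sh T_sh by blast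

lemma leads_mono:
  assumes f: "f \<in> leads n" and g: "g \<in> pos m" "g 0 = f 0"
    and le: "\<And>l. l \<in> {1..c} \<Longrightarrow> f l \<le> g l \<and> even (f l + g l)"
  shows "g \<in> leads m"
  using g le
proof (induction m arbitrary: g rule: less_induct)
  case (less m)
  have fpos: "f \<in> pos n" using f by (auto simp: leads_def lead_def)
  show ?case
  proof (cases "\<exists>j\<in>{1..c}. f j < g j")
    case True
    then obtain j where j: "j \<in> {1..c}" "f j < g j" by blast
    have "even (f j + g j)" using less.prems(3)[OF j(1)] by simp
    with j(2) have fj: "f j + 2 \<le> g j" by presburger
    have dg: "m = mdeg c g" using less.prems by (simp add: pos_def)
    have "g j \<le> m" using j dg member_le_sum[of j "{1..c}" g] by (simp add: mdeg_def)
    then obtain m' where m': "m = m' + 2" using fj by (metis add.commute add_leD2 le_Suc_ex order_trans)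
    let ?g = "g(j := g j - 2)"
    have "?g \<in> leads m'"
    proof (rule less.IH)
      show "?g \<in> pos m'" using less.prems(1) j fj unfolding m' by (intro pos_down) auto
      show "f l \<le> ?g l \<and> even (f l + ?g l)" if "l \<in> {1..c}" for l
        using less.prems(3)[OF that] fj by auto
    qed (use m' less.prems(2) j in auto)
    from leads_up[OF this j(1)] have "?g(j := ?g j + 2) \<in> leads m" unfolding m' .
    moreover have "?g(j := ?g j + 2) = g" using fj by (intro ext) auto
    ultimately show ?thesis by simp
  next
    case False
    have "g l = f l" for l
    proof (cases "l \<in> {1..c}")
      case True
      then show ?thesis using False less.prems(3)[OF True] by force
    next
      case l: False
      then show ?thesis using less.prems(1,2) fpos by (cases "l = 0") (auto simp: pos_def)
    qed
    then have "g = f" ..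
    then show ?thesis using f fpos less.prems(1) by (simp add: pos_def)
  qed
qed

text \<open>Leading positions that are not shifts of other leading positions occur in boundedly many degrees.
Otherwise infinitely many of them would share label and parities, and by Dickson's lemma one of
them would be coordinatewise below a later one; the later one would then be a shift.\<close>

lemma leads_eventually_generated:
  "\<exists>m0. \<forall>n\<ge>m0. \<forall>f\<in>leads (n + 2). \<exists>j\<in>{1..c}. 2 \<le> f j \<and> f(j := f j - 2) \<in> leads n"
proof (rule ccontr)
  assume "\<not> ?thesis"
  then have bad: "\<exists>n\<ge>m0. \<exists>f\<in>leads (n + 2). \<forall>j\<in>{1..c}. 2 \<le> f j \<longrightarrow> f(j := f j - 2) \<notin> leads n" for m0
    by blast
  define S where "S = {n. \<exists>f\<in>leads (n + 2). \<forall>j\<in>{1..c}. 2 \<le> f j \<longrightarrow> f(j := f j - 2) \<notin> leads n}"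
  have "infinite S" unfolding infinite_nat_iff_unbounded_le S_def using bad by blast
  have "\<forall>n\<in>S. \<exists>f. f \<in> leads (n + 2) \<and> (\<forall>j\<in>{1..c}. 2 \<le> f j \<longrightarrow> f(j := f j - 2) \<notin> leads n)"
    unfolding S_def by blast
  from bchoice[OF this] obtain F where F: "F n \<in> leads (n + 2)" "j \<in> {1..c} \<Longrightarrow> 2 \<le> F n j \<Longrightarrow> (F n)(j := F n j - 2) \<notin> leads n"
    if "n \<in> S" for n j
    by blast
  have Fpos: "F n \<in> pos (n + 2)" if "n \<in> S" for n using F(1)[OF that] by (auto simp: leads_def lead_def)
  \<comment> \<open>Shifts move by 2, so comparable positions must agree in parity as well as in the label.\<close>
  define col where "col n = (F n 0, {l\<in>{1..c}. odd (F n l)})" for n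
  have "col ` S \<subseteq> {..<N} \<times> Pow {1..c}" using Fpos by (auto simp: col_def pos_def)
  then have "finite (col ` S)" by (rule finite_subset) simp
  then obtain n0 where n0: "infinite {n \<in> S. col n = col n0}"
    using pigeonhole_infinite[OF \<open>infinite S\<close>] by blast
  define e where "e = enumerate {n \<in> S. col n = col n0}"
  have e: "strict_mono e" "\<And>k. e k \<in> S" "\<And>k. col (e k) = col n0"
    using enumerate_in_set[OF n0] strict_mono_enumerate[OF n0] by (auto simp: e_def)
  obtain r :: "nat \<Rightarrow> nat" where r: "strict_mono r"
    "\<And>m k k'. m \<in> {1..c} \<Longrightarrow> k \<le> k' \<Longrightarrow> F (e (r k)) m \<le> F (e (r k')) m"
    using dickson[of "{1..c}" "\<lambda>k. F (e k)"] by blast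
  define n1 n2 where "n1 = e (r 0)" and "n2 = e (r 1)"
  have n12: "n1 < n2" "n1 \<in> S" "n2 \<in> S"
    using r(1) e unfolding n1_def n2_def by (auto simp: strict_mono_less)
  have le: "F n1 l \<le> F n2 l" if "l \<in> {1..c}" for l using r(2)[OF that, of 0 1] by (simp add: n1_def n2_def)
  have "col n1 = col n2" using e(3) by (simp add: n1_def n2_def)
  then have c: "F n1 0 = F n2 0" "even (F n1 l + F n2 l)" if "l \<in> {1..c}" for l
    using that by (auto simp: col_def)
  have c0: "F n1 0 = F n2 0" using \<open>col n1 = col n2\<close> by (simp add: col_def)
  have deg: "mdeg c (F n1) = n1 + 2" "mdeg c (F n2) = n2 + 2" using Fpos n12 by (auto simp: pos_def)
  have "\<exists>j\<in>{1..c}. F n1 j < F n2 j"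
  proof (rule ccontr)
    assume "\<not> ?thesis"
    then have "mdeg c (F n2) \<le> mdeg c (F n1)" unfolding mdeg_def by (intro sum_mono) (simp add: not_less)
    then show False using deg n12 by simp
  qed
  then obtain j where j: "j \<in> {1..c}" "F n1 j < F n2 j" by blast
  have "even (F n1 j + F n2 j)" by (rule c(2)[OF j(1)])
  with j(2) have fj: "F n1 j + 2 \<le> F n2 j" by presburger
  have "(F n2)(j := F n2 j - 2) \<in> leads n2"
  proof (rule leads_mono[OF F(1)[OF n12(2)]])
    show "(F n2)(j := F n2 j - 2) \<in> pos n2" using Fpos[OF n12(3)] j fj by (intro pos_down) auto
    show "F n1 l \<le> ((F n2)(j := F n2 j - 2)) l \<and> even (F n1 l + ((F n2)(j := F n2 j - 2)) l)"
      if "l \<in> {1..c}" for l using le[OF that] c(2)[OF that] fj by auto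
  qed (use j c0 in auto)
  then show False using F(2)[OF n12(3) j(1)] fj by simp
qed

text \<open>In large degrees \<open>T\<close> is generated from two degrees below, up to elements invisible to \<open>ev\<close>.  This is
phrased through a set \<open>W\<close> that is to contain everything, which avoids sums of shifts.  An element
outside \<open>W\<close> with the smallest possible leading position could be reduced by a shift with the same
leading position, contradicting minimality.\<close>

theorem eventually_generated:
  "\<exists>m0. \<forall>n\<ge>m0. \<forall>W. (\<forall>j\<in>{1..c}. \<forall>y\<in>T n. sh j y \<in> W) \<longrightarrow>
     (\<forall>z\<in>T (n + 2). (\<forall>f\<in>pos (n + 2). ev z f = 0) \<longrightarrow> z \<in> W) \<longrightarrow>
     (\<forall>z\<in>T (n + 2). \<forall>y\<in>T (n + 2). \<forall>r. cmb z r y \<in> W \<longrightarrow> y \<in> W \<longrightarrow> z \<in> W) \<longrightarrow> T (n + 2) \<subseteq> W"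
proof -
  obtain m0 where m0: "\<And>n f. m0 \<le> n \<Longrightarrow> f \<in> leads (n + 2) \<Longrightarrow> \<exists>j\<in>{1..c}. 2 \<le> f j \<and> f(j := f j - 2) \<in> leads n"
    using leads_eventually_generated by blast
  show ?thesis
  proof (intro exI allI impI)
    fix n W
    assume n: "m0 \<le> n" and sh: "\<forall>j\<in>{1..c}. \<forall>y\<in>T n. sh j y \<in> W"
      and zero: "\<forall>z\<in>T (n + 2). (\<forall>f\<in>pos (n + 2). ev z f = 0) \<longrightarrow> z \<in> W"
      and cmb: "\<forall>z\<in>T (n + 2). \<forall>y\<in>T (n + 2). \<forall>r. cmb z r y \<in> W \<longrightarrow> y \<in> W \<longrightarrow> z \<in> W"
    let ?A = "{f. \<exists>z\<in>T (n + 2) - W. lead (n + 2) z f}"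
    have lead: "\<exists>f. lead (n + 2) z f" if "z \<in> T (n + 2) - W" for z
      using that zero lead_exists by blast
    show "T (n + 2) \<subseteq> W"
    proof (rule ccontr)
      assume "\<not> ?thesis"
      then have "?A \<noteq> {}" using lead by blast
      moreover have "?A \<subseteq> pos (n + 2)" by (auto simp: lead_def)
      then have "finite ?A" by (rule finite_subset) (rule finite_pos)
      ultimately have "\<exists>m\<in>?A. \<forall>x\<in>?A. x \<noteq> m \<longrightarrow> \<not> less_fun x m"
        by (intro Finite_Set.bex_min_element asymp_less_fun)
      then obtain f where f: "f \<in> ?A" "\<And>x. x \<in> ?A \<Longrightarrow> x \<noteq> f \<Longrightarrow> \<not> less_fun x f" by blast
      then obtain z where z: "z \<in> T (n + 2)" "z \<notin> W" "lead (n + 2) z f" by blast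
      have min: "\<not> less_fun g f" if "y \<in> T (n + 2)" "y \<notin> W" "lead (n + 2) y g" for g y
        using f(2)[of g] that less_fun_irrefl[of f] by blast
      have "f \<in> leads (n + 2)" using z by (auto simp: leads_def)
      from m0[OF n this] obtain j y where j: "j \<in> {1..c}" "2 \<le> f j" "y \<in> T n" "lead n y (f(j := f j - 2))"
        by (auto simp: leads_def)
      let ?y = "sh j y"
      have y: "?y \<in> T (n + 2)" "?y \<in> W" using T_sh sh j by auto
      have "lead (n + 2) ?y ((f(j := f j - 2))(j := (f(j := f j - 2)) j + 2))" by (rule lead_sh) (use j in auto)
      moreover have "(f(j := f j - 2))(j := (f(j := f j - 2)) j + 2) = f" using j(2) by (intro ext) auto
      ultimately have ly: "lead (n + 2) ?y f" by simp
      let ?z = "cmb z (ev z f / ev ?y f) ?y"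
      have zT: "?z \<in> T (n + 2)" using z y by (intro T_cmb)
      have zW: "?z \<notin> W" using cmb z y by blast
      then obtain g where g: "lead (n + 2) ?z g" using lead zT by blast
      have "ev ?z f = 0" using ly by (simp add: ev_cmb[OF z(1) y(1)] lead_def)
      moreover have "ev ?z h = 0" if "h \<in> pos (n + 2)" "less_fun f h" for h
        using that z(3) ly by (simp add: ev_cmb[OF z(1) y(1)] lead_def)
      ultimately have "less_fun g f"
        using g z(3) pos_total[of f "n + 2" g] by (auto simp: lead_def)
      then show False using min[OF zT zW g] by simp
    qed
  qed
qed

end

section \<open>Complexes on which the shifts act\<close>

text \<open>A complex of \<open>V\<close>-valued families indexed by multi-indices, on which the differential only looks one
step down in each direction.  Degrees are not separated: a family is defined on all multi-indices,
and statements about degree \<open>n\<close> restrict to \<open>mdeg c i = n\<close>.\<close>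

locale periodic_complex =
  fixes c :: nat and V :: "'v::ab_group_add set"
    and d :: "((nat \<Rightarrow> nat) \<Rightarrow> 'v) \<Rightarrow> (nat \<Rightarrow> nat) \<Rightarrow> 'v"
  assumes V_zero: "0 \<in> V" and V_diff: "\<lbrakk>v \<in> V; w \<in> V\<rbrakk> \<Longrightarrow> v - w \<in> V"
    and d_closed: "(\<And>i. z i \<in> V) \<Longrightarrow> d z i \<in> V"
    and d_diff: "\<lbrakk>\<And>i. z i \<in> V; \<And>i. y i \<in> V\<rbrakk> \<Longrightarrow> d (\<lambda>i. z i - y i) i = d z i - d y i"
    and d_local: "(\<And>l. \<lbrakk>l \<in> {1..c}; 0 < i l\<rbrakk> \<Longrightarrow> z (i(l := i l - 1)) = y (i(l := i l - 1))) \<Longrightarrow> d z i = d y i"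
    and d_d: "(\<And>i. z i \<in> V) \<Longrightarrow> d (d z) i = 0"
    and d_shift: "\<lbrakk>\<And>i. z i \<in> V; j \<in> {1..c}\<rbrakk> \<Longrightarrow> d (shift j z) i = shift j (d z) i"
begin

text \<open>The indices that survive division by \<open>\<chi>_(k+1), \<dots>, \<chi>_c\<close>.  They are closed under
lowering coordinates, so restricting a family to them is passing to a quotient complex.\<close>

definition box :: "nat \<Rightarrow> (nat \<Rightarrow> nat) \<Rightarrow> bool" where
  "box k i \<longleftrightarrow> msupp c i \<and> (\<forall>m\<in>{k<..c}. i m \<le> 1)"

text \<open>Exactness in degree \<open>n\<close> of the complex truncated to \<open>box k\<close>.\<close>

definition vanish :: "nat \<Rightarrow> nat \<Rightarrow> bool" where
  "vanish k n \<longleftrightarrow> (\<forall>z. (\<forall>i. z i \<in> V) \<longrightarrow> (\<forall>i. box k i \<longrightarrow> mdeg c i = Suc n \<longrightarrow> d z i = 0) \<longrightarrow>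
     (\<exists>y. (\<forall>i. y i \<in> V) \<and> (\<forall>i. box k i \<longrightarrow> mdeg c i = n \<longrightarrow> z i = d y i)))"

lemma vanishE:
  assumes "vanish k n" "\<And>i. z i \<in> V" "\<And>i. box k i \<Longrightarrow> mdeg c i = Suc n \<Longrightarrow> d z i = 0"
  obtains y where "\<And>i. y i \<in> V" "\<And>i. box k i \<Longrightarrow> mdeg c i = n \<Longrightarrow> z i = d y i"
  using assms unfolding vanish_def by blast

lemma d_box_cong:
  assumes "box k i" "mdeg c i = Suc n" "\<And>i. box k i \<Longrightarrow> mdeg c i = n \<Longrightarrow> z i = y i"
  shows "d z i = d y i"
proof (rule d_local)
  fix l assume l: "l \<in> {1..c}" "0 < i l"
  have "mdeg c (i(l := i l - 1)) = n" using mdeg_upd[OF l(1), of i "i l - 1"] l assms(2) by simp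
  moreover have "box k (i(l := i l - 1))"
    using assms(1) l unfolding box_def by (auto simp: msupp_upd le_diff_conv)
  ultimately show "z (i(l := i l - 1)) = y (i(l := i l - 1))" by (intro assms(3))
qed

lemma shift_closed: "(\<And>i. z i \<in> V) \<Longrightarrow> shift j z i \<in> V"
  by (simp add: shift_def V_zero)

lemma shift_up: "shift j z (i(j := i j + 2)) = z i"
  by (simp add: shift_def)

lemma shift_down: "shift j (\<lambda>i. w (i(j := i j + 2))) i = (if 2 \<le> i j then w i else 0)"
proof (cases "2 \<le> i j")
  case True
  then have "i(j := i j - 2 + 2) = i" by (intro ext) auto
  then show ?thesis using True by (simp only: shift_def fun_upd_same fun_upd_upd if_True)
qed (simp add: shift_def)

lemma box_up: "Suc k \<le> c \<Longrightarrow> box (Suc k) i \<Longrightarrow> box (Suc k) (i(Suc k := p))"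
  by (auto simp: box_def msupp_upd)

lemma box_Suc: "Suc k \<le> c \<Longrightarrow> box k i \<longleftrightarrow> box (Suc k) i \<and> i (Suc k) \<le> 1"
proof -
  assume "Suc k \<le> c"
  then have "{k<..c} = insert (Suc k) {Suc k<..c}" by auto
  then show ?thesis by (auto simp: box_def)
qed

lemma mdeg_up: "j \<in> {1..c} \<Longrightarrow> mdeg c (i(j := Suc (Suc (i j)))) = Suc (Suc (mdeg c i))"
  using mdeg_upd[of j c i "i j + 2"] by simp

lemma mdeg_down: "j \<in> {1..c} \<Longrightarrow> 2 \<le> i j \<Longrightarrow> mdeg c (i(j := i j - 2)) + 2 = mdeg c i"
  using mdeg_upd[of j c i "i j - 2"] by simp

text \<open>This is exactness of \<open>H^(n+1)(C') \<rightarrow> H^(n+1)(C'/\<chi>C') \<rightarrow> H^n(C')\<close>, where \<open>C'\<close> is the complex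
truncated to \<open>box (Suc k)\<close>, and \<open>\<chi>\<close> is the shift by 2 in direction \<open>Suc k\<close>.  The connecting map
lifts a cocycle \<open>z\<close> by zero and divides the differential of the lift by \<open>\<chi>\<close>; the quotient is \<open>y\<close>.\<close>

lemma vanish_down:
  assumes k: "Suc k \<le> c" and v: "vanish (Suc k) (Suc n)" "vanish (Suc k) n"
  shows "vanish k (Suc n)"
  unfolding vanish_def
proof (intro allI impI)
  let ?j = "Suc k"
  have j: "?j \<in> {1..c}" using k by auto
  fix z assume zV: "\<forall>i. z i \<in> V" and cocycle: "\<forall>i. box k i \<longrightarrow> mdeg c i = Suc (Suc n) \<longrightarrow> d z i = 0"
  \<comment> \<open>The lift by zero, and the quotient of its differential by the shift.\<close>
  define z' where "z' i = (if box k i then z i else 0)" for i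
  have z'V: "z' i \<in> V" for i using zV V_zero by (simp add: z'_def)
  have dz'V: "d z' i \<in> V" for i by (rule d_closed[OF z'V])
  have dz': "d z' i = 0" if "box k i" "mdeg c i = Suc (Suc n)" for i
    using d_box_cong[OF that, of z' z] cocycle that by (simp add: z'_def)
  define y where "y i = d z' (i(?j := i ?j + 2))" for i
  have yV: "y i \<in> V" for i by (simp add: y_def dz'V)
  have shift_y: "shift ?j y i = d z' i" if "box ?j i" "mdeg c i = Suc (Suc n)" for i
    using dz'[of i] that box_Suc[OF k, of i] unfolding y_def shift_down by auto
  have dy: "d y i = 0" if i: "box ?j i" "mdeg c i = Suc n" for i
  proof -
    let ?i = "i(?j := i ?j + 2)"
    have "d y i = d (shift ?j y) ?i" by (simp only: d_shift[OF yV j] shift_up)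
    also have "\<dots> = d (d z') ?i"
      by (rule d_box_cong[OF box_up[OF k i(1)] _ shift_y]) (simp_all add: mdeg_up[OF j] i)
    also have "\<dots> = 0" by (rule d_d[OF z'V])
    finally show ?thesis .
  qed
  obtain v where vV: "\<And>i. v i \<in> V" and v': "\<And>i. box ?j i \<Longrightarrow> mdeg c i = n \<Longrightarrow> y i = d v i"
    using vanishE[OF v(2) yV dy] by metis
  \<comment> \<open>A corrected lift, which is a cocycle.\<close>
  let ?w = "\<lambda>i. z' i - shift ?j v i"
  have wV: "?w i \<in> V" for i by (intro V_diff z'V shift_closed vV)
  have dw: "d ?w i = 0" if i: "box ?j i" "mdeg c i = Suc (Suc n)" for i
  proof -
    have "shift ?j (d v) i = d z' i"
    proof (cases "2 \<le> i ?j")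
      case True
      then have "Suc (Suc (i ?j - 2)) = i ?j" by simp
      then show ?thesis using True v'[of "i(?j := i ?j - 2)"] box_up[OF k i(1)] mdeg_down[where i = i, OF j True] i
        by (simp add: shift_def y_def)
    next
      case False
      then show ?thesis using dz'[of i] i box_Suc[OF k, of i] by (simp add: shift_def)
    qed
    then show ?thesis by (simp add: d_diff[OF z'V shift_closed[OF vV]] d_shift[OF vV j])
  qed
  obtain t where t: "\<And>i. t i \<in> V" "\<And>i. box ?j i \<Longrightarrow> mdeg c i = Suc n \<Longrightarrow> ?w i = d t i"
    using vanishE[OF v(1) wV dw] by metis
  have "z i = d t i" if "box k i" "mdeg c i = Suc n" for i
    using t(2)[of i] that box_Suc[OF k, of i] by (simp add: shift_def z'_def)
  with t(1) show "\<exists>y. (\<forall>i. y i \<in> V) \<and> (\<forall>i. box k i \<longrightarrow> mdeg c i = Suc n \<longrightarrow> z i = d y i)" by blast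
qed

text \<open>If \<open>H^(n+1)(C'/\<chi>C') = 0\<close> then \<open>\<chi> : H^n(C') \<rightarrow> H^(n+2)(C')\<close> is injective.\<close>

lemma vanish_up:
  assumes k: "Suc k \<le> c" and v: "vanish k (Suc n)" "vanish (Suc k) (Suc (Suc n))"
  shows "vanish (Suc k) n"
  unfolding vanish_def
proof (intro allI impI)
  let ?j = "Suc k"
  have j: "?j \<in> {1..c}" using k by auto
  fix z assume zV: "\<forall>i. z i \<in> V" and cocycle: "\<forall>i. box ?j i \<longrightarrow> mdeg c i = Suc n \<longrightarrow> d z i = 0"
  have zV': "z i \<in> V" for i using zV by simp
  have ds: "d (shift ?j z) i = 0" if i: "box ?j i" "mdeg c i = Suc (Suc (Suc n))" for i
    using cocycle mdeg_down[where i = i, OF j] box_up[OF k i(1)] i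
    by (simp add: d_shift[OF zV' j]) (simp add: shift_def)
  obtain y where yV: "\<And>i. y i \<in> V"
    and y: "\<And>i. box ?j i \<Longrightarrow> mdeg c i = Suc (Suc n) \<Longrightarrow> shift ?j z i = d y i"
    by (rule vanishE[OF v(2) shift_closed[OF zV'] ds], assumption, assumption, rule that, blast+)
  have dy: "d y i = 0" if "box k i" "mdeg c i = Suc (Suc n)" for i
    using y[of i] that box_Suc[OF k, of i] by (simp add: shift_def)
  obtain t where tV: "\<And>i. t i \<in> V" and t: "\<And>i. box k i \<Longrightarrow> mdeg c i = Suc n \<Longrightarrow> y i = d t i"
    by (rule vanishE[OF v(1) yV dy], assumption, assumption, rule that, blast+)
  define w where "w = (\<lambda>i. y i - d t i)"
  have dtV: "d t i \<in> V" for i by (rule d_closed[OF tV])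
  have wV: "w i \<in> V" for i by (simp add: w_def V_diff yV dtV)
  define v where "v i = w (i(?j := i ?j + 2))" for i
  have vV: "v i \<in> V" for i unfolding v_def by (rule wV)
  have w_shift: "w i = shift ?j v i" if "box ?j i" "mdeg c i = Suc n" for i
    using t[of i] that box_Suc[OF k, of i] unfolding v_def shift_down by (auto simp: w_def)
  have "z i = d v i" if i: "box ?j i" "mdeg c i = n" for i
  proof -
    let ?i = "i(?j := i ?j + 2)"
    have b: "box ?j ?i" "mdeg c ?i = Suc (Suc n)" using box_up[OF k i(1)] i by (simp_all add: mdeg_up[OF j])
    have "z i = d y ?i" using y[OF b] by (simp only: shift_up)
    also have "\<dots> = d w ?i" by (simp add: w_def d_diff[OF yV dtV] d_d[OF tV])
    also have "\<dots> = d (shift ?j v) ?i" by (rule d_box_cong[OF b w_shift])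
    also have "\<dots> = d v i" by (simp only: d_shift[OF vV j] shift_up)
    finally show ?thesis .
  qed
  with vV show "\<exists>y. (\<forall>i. y i \<in> V) \<and> (\<forall>i. box ?j i \<longrightarrow> mdeg c i = n \<longrightarrow> z i = d y i)" by blast
qed

text \<open>Eventual vanishing passes down to all truncations.  The complex on \<open>box 0\<close> has no index of degree
above \<open>c\<close>, and each step up from \<open>k\<close> to \<open>Suc k\<close> improves the bound above which the cohomology
vanishes by one, from \<open>c - k\<close> to \<open>c - Suc k\<close>.\<close>

theorem eventually_vanish_imp_vanish:
  assumes "\<And>n. m0 \<le> n \<Longrightarrow> vanish c n" and "0 < n"
  shows "vanish c n"
proof -
  have ev: "\<exists>m. \<forall>n\<ge>m. vanish (c - k) n" if "k \<le> c" for k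
    using that
  proof (induction k)
    case (Suc k)
    then obtain m where m: "\<forall>n\<ge>m. vanish (c - k) n" by auto
    have s: "Suc (c - Suc k) = c - k" "Suc (c - Suc k) \<le> c" using Suc by auto
    have "vanish (c - Suc k) n" if "Suc m \<le> n" for n
      using vanish_down[OF s(2), of "n - 1"] m that unfolding s(1) by (cases n) auto
    then show ?case by blast
  qed (use assms in auto)
  have "vanish k n" if "k \<le> c" "c < n + k" for k n
    using that
  proof (induction k arbitrary: n)
    case 0
    have "mdeg c i \<noteq> n" if "box 0 i" for i
    proof -
      have "mdeg c i \<le> (\<Sum>l\<in>{1..c}. 1)" unfolding mdeg_def
        using that by (intro sum_mono) (auto simp: box_def)
      then show ?thesis using 0 by simp
    qed
    then show ?case unfolding vanish_def using V_zero by (intro allI impI exI[of _ "\<lambda>_. 0"]) auto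
  next
    case (Suc k)
    obtain m where m: "\<forall>n\<ge>m. vanish (Suc k) n" using ev[of "c - Suc k"] Suc.prems by auto
    have "vanish (Suc k) n" if "c < n + Suc k" for n
      using that
    proof (induction "m - n" arbitrary: n rule: less_induct)
      case less
      show ?case
      proof (cases "m \<le> n")
        case False
        then have "vanish (Suc k) (Suc (Suc n))" using less.prems by (intro less.hyps) auto
        moreover have "vanish k (Suc n)" using Suc.IH Suc.prems less.prems by simp
        ultimately show ?thesis using vanish_up Suc.prems by blast
      qed (use m in auto)
    qed
    then show ?case using Suc.prems by blast
  qed
  then show ?thesis using assms(2) by simp
qed

end

section \<open>Operators in several q-commuting directions\<close>

lemma sum_list_swap2:
  fixes f :: "'a \<Rightarrow> 'b \<Rightarrow> 'c::comm_monoid_add"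
  shows "(\<Sum>x\<leftarrow>xs. \<Sum>y\<leftarrow>ys. f x y) = (\<Sum>y\<leftarrow>ys. \<Sum>x\<leftarrow>xs. f x y)"
  by (induction xs) (simp_all add: sum_list_addf)

lemma sum_list_cong:
  "(\<And>x. x \<in> set xs \<Longrightarrow> f x = g x) \<Longrightarrow> (\<Sum>x\<leftarrow>xs. f x) = (\<Sum>x\<leftarrow>xs. (g x :: 'c::comm_monoid_add))"
  by (metis map_cong)

text \<open>The target module \<open>N\<close> in linear coordinates: \<open>W\<close> is its image in a vector space \<open>'w\<close>, and \<open>L l\<close> is the
action of \<open>x_l\<close>.  The operators are defined on all of \<open>'w\<close> with the relations of the algebra holding
everywhere, so that the identities below need no membership conditions; \<open>W\<close> only enters as a subspace
that everything preserves.

A cochain on a module is studied through the families \<open>g i u\<close> of its values on the monomial multiples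
\<open>x^u m\<close> of a fixed element \<open>m\<close>, rescaled by a power of \<open>q\<close> (\<open>gauge\<close> below) chosen so
that the right action of \<open>x_l\<close> becomes the plain shift of \<open>u_l\<close>, with no \<open>q\<close> in it.\<close>

locale quantum_operators = vector_space sc
  for sc :: "'k::field \<Rightarrow> 'w::ab_group_add \<Rightarrow> 'w" (infixr "\<cdot>" 75) +
  fixes c a :: nat and q :: 'k and L :: "nat \<Rightarrow> 'w \<Rightarrow> 'w" and W :: "'w set"
  assumes a_ge_2: "2 \<le> a" and q_root: "q ^ a = 1"
    and L_add: "L l (x + y) = L l x + L l y"
    and L_scale: "L l (r \<cdot> x) = r \<cdot> L l x"
    and L_q_commute: "\<lbrakk>1 \<le> l; l < m; m \<le> c\<rbrakk> \<Longrightarrow> L l (L m x) = q \<cdot> L m (L l x)"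
    and L_nilpotent: "l \<in> {1..c} \<Longrightarrow> (L l ^^ a) x = 0"
    and W_subspace: "subspace W"
    and L_closed: "x \<in> W \<Longrightarrow> L l x \<in> W"
begin

lemma Lpow_add: "(L l ^^ s) (x + y) = (L l ^^ s) x + (L l ^^ s) y"
  by (induction s) (simp_all add: L_add)

lemma Lpow_scale: "(L l ^^ s) (r \<cdot> x) = r \<cdot> (L l ^^ s) x"
  by (induction s) (simp_all add: L_scale)

lemma Lpow_zero [simp]: "(L l ^^ s) 0 = 0"
  using Lpow_scale[of s l 0 0] by simp

lemma Lpow_sum_list: "(L l ^^ s) (\<Sum>x\<leftarrow>xs. f x) = (\<Sum>x\<leftarrow>xs. (L l ^^ s) (f x))"
  by (induction xs) (simp_all add: Lpow_add)

lemma scale_sum_list: "r \<cdot> (\<Sum>x\<leftarrow>xs. f x) = (\<Sum>x\<leftarrow>xs. r \<cdot> f x)"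
  by (induction xs) (simp_all add: scale_right_distrib)

lemma Lpow_closed: "x \<in> W \<Longrightarrow> (L l ^^ s) x \<in> W"
  by (induction s) (simp_all add: L_closed)

lemma Lpow_q_commute:
  assumes "1 \<le> l" "l < m" "m \<le> c"
  shows "(L l ^^ s) ((L m ^^ t) x) = q ^ (s * t) \<cdot> (L m ^^ t) ((L l ^^ s) x)"
proof -
  have 1: "L l ((L m ^^ t) x) = q ^ t \<cdot> (L m ^^ t) (L l x)" for x
    by (induction t) (simp_all add: L_q_commute[OF assms] L_scale mult.commute)
  show ?thesis
    by (induction s) (simp_all add: 1 L_scale power_add mult.commute)
qed

text \<open>The degree in \<open>x_l\<close> of the generator with index \<open>p\<close> of the periodic resolution of \<open>k[x_l]/(x_l^a)\<close>: the
maps of the resolution have degree 1 and \<open>a - 1\<close> alternately.\<close>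

definition wt :: "nat \<Rightarrow> nat" where
  "wt p = (p div 2) * a + p mod 2"

text \<open>The total degree in the variables before \<open>x_l\<close>.  Acting by \<open>x_l\<close> costs the factor \<open>q\<close> to this power,
since \<open>x_l\<close> has to move past that many earlier variables.\<close>

definition kap :: "nat \<Rightarrow> (nat \<Rightarrow> nat) \<Rightarrow> (nat \<Rightarrow> nat) \<Rightarrow> nat" where
  "kap l i u = (\<Sum>m\<in>{1..<l}. wt (i m) + u m)"

text \<open>A stencil lists, for each value \<open>p\<close> of \<open>i_l\<close> and \<open>v\<close> of \<open>u_l\<close>, the terms of an operator that acts in one
direction \<open>l\<close> only: \<open>(r, s, p', v')\<close> stands for \<open>r\<close> times the action of \<open>x_l^s\<close> on the value at \<open>(p', v')\<close>.\<close>

type_synonym 'f stencil = "nat \<Rightarrow> nat \<Rightarrow> ('f \<times> nat \<times> nat \<times> nat) list"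

definition dirop :: "nat \<Rightarrow> 'k stencil \<Rightarrow> ((nat \<Rightarrow> nat) \<Rightarrow> (nat \<Rightarrow> nat) \<Rightarrow> 'w) \<Rightarrow> (nat \<Rightarrow> nat) \<Rightarrow> (nat \<Rightarrow> nat) \<Rightarrow> 'w" where
  "dirop l S g i u = (\<Sum>(r, s, p, v)\<leftarrow>S (i l) (u l).
     (r * q ^ (kap l i u * s)) \<cdot> (L l ^^ s) (g (i(l := p)) (u(l := v))))"

text \<open>Homogeneity: what is lost in degree is made up by the power of \<open>x_l\<close> that acts.  Odd change of
\<open>p\<close> makes the operator change sign under the alternating signs of the total complex.\<close>

definition homog :: "'k stencil \<Rightarrow> bool" where
  "homog S \<longleftrightarrow> (\<forall>p v. \<forall>(r, s, p', v')\<in>set (S p v). wt p' + v' + s = wt p + v \<and> odd (p + p'))"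

lemma kap_upd_ge: "l \<le> m \<Longrightarrow> kap l (i(m := p)) (u(m := v)) = kap l i u"
  by (auto simp: kap_def intro!: sum.cong)

lemma kap_upd_less:
  assumes "1 \<le> m" "m < l" "wt p + v + s = wt (i m) + u m"
  shows "kap l (i(m := p)) (u(m := v)) + s = kap l i u"
proof -
  have "m \<in> {1..<l}" "finite {1..<l}" using assms by auto
  then have "kap l i' u' = wt (i' m) + u' m + (\<Sum>n\<in>{1..<l}-{m}. wt (i' n) + u' n)" for i' u'
    unfolding kap_def by (subst sum.remove) auto
  moreover have "(\<Sum>n\<in>{1..<l}-{m}. wt ((i(m:=p)) n) + (u(m:=v)) n) = (\<Sum>n\<in>{1..<l}-{m}. wt (i n) + u n)"
    by (rule sum.cong) auto
  ultimately show ?thesis using assms(3) by simp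
qed

text \<open>The point of the twist \<open>kap\<close>.  The operator in direction \<open>l\<close> lowers the degree by \<open>s\<close> when it applies
\<open>x_l^s\<close>, which changes the factor in front of \<open>x_m^s'\<close> by \<open>q^(s * s')\<close>; this is exactly the
factor from exchanging \<open>x_l^s\<close> with \<open>x_m^s'\<close>.\<close>

lemma dirop_commute_less:
  assumes lm: "1 \<le> l" "l < m" "m \<le> c" and S: "homog S"
  shows "dirop l S (dirop m T g) i u = dirop m T (dirop l S g) i u"
proof -
  have "dirop l S (dirop m T g) i u = (\<Sum>(r, s, p, v)\<leftarrow>S (i l) (u l). \<Sum>(r', s', p', v')\<leftarrow>T (i m) (u m).
      (r * r' * q ^ (kap l i u * s) * q ^ (kap m i u * s')) \<cdot> (L m ^^ s') ((L l ^^ s) (g (i(l := p, m := p')) (u(l := v, m := v')))))"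
    unfolding dirop_def
  proof (rule sum_list_cong, clarify)
    fix r s p v assume "(r, s, p, v) \<in> set (S (i l) (u l))"
    then have "wt p + v + s = wt (i l) + u l" using S unfolding homog_def by fast
    from kap_upd_less[of l m p v s i u, OF lm(1,2) this]
    have k: "q ^ (s' * kap m i u) = q ^ (s * s') * q ^ (s' * kap m (i(l := p)) (u(l := v)))" for s'
      by (metis add_mult_distrib power_add mult.commute)
    show "(r * q ^ (kap l i u * s)) \<cdot> (L l ^^ s) (\<Sum>(r', s', p', v')\<leftarrow>T ((i(l := p)) m) ((u(l := v)) m).
         (r' * q ^ (kap m (i(l := p)) (u(l := v)) * s')) \<cdot> (L m ^^ s') (g (i(l := p, m := p')) (u(l := v, m := v')))) =
      (\<Sum>(r', s', p', v')\<leftarrow>T (i m) (u m).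
      (r * r' * q ^ (kap l i u * s) * q ^ (kap m i u * s')) \<cdot> (L m ^^ s') ((L l ^^ s) (g (i(l := p, m := p')) (u(l := v, m := v')))))"
      using lm by (simp add: Lpow_sum_list scale_sum_list case_prod_unfold Lpow_scale Lpow_q_commute[OF lm]
          k mult_ac)
  qed
  also have "\<dots> = (\<Sum>(r', s', p', v')\<leftarrow>T (i m) (u m). \<Sum>(r, s, p, v)\<leftarrow>S (i l) (u l).
      (r * r' * q ^ (kap l i u * s) * q ^ (kap m i u * s')) \<cdot> (L m ^^ s') ((L l ^^ s) (g (i(l := p, m := p')) (u(l := v, m := v')))))"
    by (simp add: case_prod_unfold sum_list_swap2[of _ "S (i l) (u l)"])
  also have "\<dots> = dirop m T (dirop l S g) i u"
    using lm by (simp add: dirop_def Lpow_sum_list scale_sum_list case_prod_unfold Lpow_scale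
        kap_upd_ge fun_upd_twist mult_ac)
  finally show ?thesis .
qed

text \<open>The Koszul sign of direction \<open>l\<close>, turning commuting operators into anticommuting ones.\<close>

definition sgn_at :: "nat \<Rightarrow> (nat \<Rightarrow> nat) \<Rightarrow> 'k" where
  "sgn_at l i = (- 1) ^ (\<Sum>m\<in>{1..<l}. i m)"

definition sdirop :: "nat \<Rightarrow> 'k stencil \<Rightarrow> ((nat \<Rightarrow> nat) \<Rightarrow> (nat \<Rightarrow> nat) \<Rightarrow> 'w) \<Rightarrow> (nat \<Rightarrow> nat) \<Rightarrow> (nat \<Rightarrow> nat) \<Rightarrow> 'w" where
  "sdirop l S g i u = sgn_at l i \<cdot> dirop l S g i u"

lemma sgn_at_square [simp]: "sgn_at l i * sgn_at l i = 1"
  by (simp add: sgn_at_def flip: power_add mult_2)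

lemma sgn_at_upd_ge: "l \<le> m \<Longrightarrow> sgn_at l (i(m := p)) = sgn_at l i"
  by (auto simp: sgn_at_def intro!: sum.cong arg_cong2[of _ _ _ _ power])

lemma sgn_at_upd_less:
  assumes "1 \<le> m" "m < l" "odd (i m + p)"
  shows "sgn_at l (i(m := p)) = - sgn_at l i"
proof -
  have "m \<in> {1..<l}" "finite {1..<l}" using assms by auto
  then have "sum i' {1..<l} = i' m + (\<Sum>n\<in>{1..<l}-{m}. i' n)" for i' :: "nat \<Rightarrow> nat"
    by (subst sum.remove) auto
  moreover have "(\<Sum>n\<in>{1..<l}-{m}. (i(m:=p)) n) = (\<Sum>n\<in>{1..<l}-{m}. i n)"
    by (rule sum.cong) auto
  ultimately show ?thesis using assms(3)
    by (cases "even p") (simp_all add: sgn_at_def power_add)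
qed

lemma dirop_cong:
  assumes "\<And>r s p v. (r, s, p, v) \<in> set (S (i l) (u l)) \<Longrightarrow> g (i(l := p)) (u(l := v)) = h (i(l := p)) (u(l := v))"
  shows "dirop l S g i u = dirop l S h i u"
  unfolding dirop_def using assms by (intro sum_list_cong) auto

lemma dirop_scale_factor:
  assumes "\<And>r s p v. (r, s, p, v) \<in> set (S (i l) (u l)) \<Longrightarrow> g (i(l := p)) (u(l := v)) = t \<cdot> h (i(l := p)) (u(l := v))"
  shows "dirop l S g i u = t \<cdot> dirop l S h i u"
  unfolding dirop_def scale_sum_list using assms
  by (intro sum_list_cong) (auto simp: Lpow_scale mult_ac)

lemma dirop_add: "dirop l S (\<lambda>i u. g i u + h i u) i u = dirop l S g i u + dirop l S h i u"
  by (simp add: dirop_def case_prod_unfold Lpow_add scale_right_distrib sum_list_addf)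

lemma sdirop_add: "sdirop l S (\<lambda>i u. g i u + h i u) i u = sdirop l S g i u + sdirop l S h i u"
  by (simp add: sdirop_def dirop_add scale_right_distrib)

lemma dirop_scale: "dirop l S (\<lambda>i u. r \<cdot> h i u) i u = r \<cdot> dirop l S h i u"
  by (rule dirop_scale_factor) simp

lemma sdirop_scale: "sdirop l S (\<lambda>i u. r \<cdot> h i u) i u = r \<cdot> sdirop l S h i u"
  by (simp add: sdirop_def dirop_scale mult.commute)

lemma dirop_zero: "dirop l S (\<lambda>i u. 0) i u = 0"
  using dirop_scale[of l S 0 "\<lambda>i u. 0"] by simp

lemma sdirop_sum: "finite A \<Longrightarrow> sdirop l S (\<lambda>i u. \<Sum>x\<in>A. g x i u) i u = (\<Sum>x\<in>A. sdirop l S (g x) i u)"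
  by (induction A rule: finite_induct) (simp_all add: sdirop_add sdirop_def dirop_zero dirop_add scale_right_distrib)

lemma homogD: "homog S \<Longrightarrow> (r, s, p', v') \<in> set (S p v) \<Longrightarrow> wt p' + v' + s = wt p + v"
  "homog S \<Longrightarrow> (r, s, p', v') \<in> set (S p v) \<Longrightarrow> odd (p + p')"
  unfolding homog_def by fast+

lemma sdirop_anticommute_less:
  assumes lm: "1 \<le> l" "l < m" "m \<le> c" and S: "homog S" and T: "homog T"
  shows "sdirop l S (sdirop m T g) i u = - sdirop m T (sdirop l S g) i u"
proof -
  have "dirop l S (sdirop m T g) i u = (- sgn_at m i) \<cdot> dirop l S (dirop m T g) i u"
    using lm homogD(2)[OF S]
    by (intro dirop_scale_factor) (auto simp: sdirop_def sgn_at_upd_less)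
  moreover have "dirop m T (sdirop l S g) i u = sgn_at l i \<cdot> dirop m T (dirop l S g) i u"
    using lm
    by (intro dirop_scale_factor) (auto simp: sdirop_def sgn_at_upd_ge)
  moreover have "dirop l S (dirop m T g) i u = dirop m T (dirop l S g) i u"
    by (rule dirop_commute_less[OF lm S])
  ultimately show ?thesis by (simp add: sdirop_def mult.commute)
qed

lemma sdirop_anticommute:
  assumes "l \<in> {1..c}" "m \<in> {1..c}" "l \<noteq> m" "homog S" "homog T"
  shows "sdirop l S (sdirop m T g) i u = - sdirop m T (sdirop l S g) i u"
  using assms sdirop_anticommute_less[of l m S T g i u] sdirop_anticommute_less[of m l T S g i u]
  by (metis atLeastAtMost_iff linorder_neqE_nat minus_minus)

lemma sdirop_same: "sdirop l S (sdirop l T g) i u = dirop l S (dirop l T g) i u"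
proof -
  have "dirop l S (sdirop l T g) i u = sgn_at l i \<cdot> dirop l S (dirop l T g) i u"
    by (intro dirop_scale_factor) (auto simp: sdirop_def sgn_at_upd_ge)
  then show ?thesis by (simp add: sdirop_def)
qed


text \<open>The differential of the periodic complex: \<open>x f - f x\<close> into odd positions and
\<open>\<Sum>s<a. x^s f x^(a-1-s)\<close> into even ones.  In coordinates, right multiplication by \<open>x\<close> raises \<open>v\<close>.\<close>

definition diff_stencil :: "'k stencil" where
  "diff_stencil p v =
    (if p = 0 then [] else if odd p then [(1, 1, p - 1, v), (- 1, 0, p - 1, Suc v)]
     else map (\<lambda>s. (1, s, p - 1, v + (a - 1 - s))) [0..<a])"

text \<open>A contracting homotopy in one direction, for values on a module that is free over \<open>k[x]/(x^a)\<close> with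
basis the elements with \<open>v = 0\<close>.  A map \<open>f\<close> on it is reconstructed from \<open>h = x f - f x\<close> and
\<open>f\<close> on the basis by telescoping, and a map is in the image of the norm if it is carried by the top
power \<open>v = a - 1\<close>.  The case \<open>a \<le> v\<close> has to be excluded because \<open>x^v\<close> is zero there.\<close>

definition htpy_stencil :: "'k stencil" where
  "htpy_stencil p v =
    (if a \<le> v then [] else if even p then map (\<lambda>r. (- 1, v - 1 - r, Suc p, r)) [0..<v]
     else if v = a - 1 then [(1, 0, Suc p, 0)] else [])"

text \<open>The module maps among all maps, \<open>f(x^v b) = x^v f(b)\<close>: what the homotopy leaves over in position 0.\<close>

definition proj_stencil :: "'k stencil" where
  "proj_stencil p v = (if p = 0 \<and> v < a then [(1, v, 0, 0)] else [])"

lemma wt_odd: "odd p \<Longrightarrow> wt p = wt (p - 1) + 1"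
  by (elim oddE) (simp add: wt_def)

lemma wt_even: "even p \<Longrightarrow> 0 < p \<Longrightarrow> wt p = wt (p - 1) + (a - 1)"
proof -
  assume "even p" "0 < p"
  then obtain k where "p = 2 * Suc k" by (metis evenE gr0_implies_Suc nat_0_less_mult_iff)
  then show ?thesis using a_ge_2 by (simp add: wt_def)
qed

lemma homog_diff: "homog diff_stencil"
  unfolding homog_def
proof (intro allI ballI)
  fix p v x assume "x \<in> set (diff_stencil p v)"
  then show "case x of (r, s, p', v') \<Rightarrow> wt p' + v' + s = wt p + v \<and> odd (p + p')"
    using wt_odd[of p] wt_even[of p]
    by (cases "odd p") (auto simp: diff_stencil_def split: if_splits)
qed

lemma homog_htpy: "homog htpy_stencil"
  unfolding homog_def
proof (intro allI ballI)
  fix p v x assume "x \<in> set (htpy_stencil p v)"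
  then show "case x of (r, s, p', v') \<Rightarrow> wt p' + v' + s = wt p + v \<and> odd (p + p')"
    using wt_odd[of "Suc p"] wt_even[of "Suc p"]
    by (cases "odd p") (auto simp: htpy_stencil_def split: if_splits)
qed

text \<open>A stencil applied in a single direction, with all other coordinates frozen and the twisted action
of \<open>x_l\<close> abbreviated to one operator \<open>\<Lambda>\<close>.  Compositions of operators in the same
direction can be computed here without any \<open>q\<close>.\<close>

definition slice_op :: "('w \<Rightarrow> 'w) \<Rightarrow> 'k stencil \<Rightarrow> (nat \<Rightarrow> nat \<Rightarrow> 'w) \<Rightarrow> nat \<Rightarrow> nat \<Rightarrow> 'w" where
  "slice_op \<Lambda> S G p v = (\<Sum>(r, s, p', v')\<leftarrow>S p v. r \<cdot> (\<Lambda> ^^ s) (G p' v'))"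

context
  fixes \<Lambda> :: "'w \<Rightarrow> 'w" and G :: "nat \<Rightarrow> nat \<Rightarrow> 'w"
  assumes \<Lambda>_add: "\<Lambda> (x + y) = \<Lambda> x + \<Lambda> y" and \<Lambda>_nil: "(\<Lambda> ^^ a) x = 0"
    and G_bounded: "a \<le> v \<Longrightarrow> G p v = 0"
begin

lemma \<Lambda>pow_add: "(\<Lambda> ^^ s) (x + y) = (\<Lambda> ^^ s) x + (\<Lambda> ^^ s) y"
  by (induction s) (simp_all add: \<Lambda>_add)

lemma \<Lambda>pow_zero: "(\<Lambda> ^^ s) 0 = 0"
  using \<Lambda>pow_add[of s 0 0] by simp

lemma \<Lambda>pow_diff: "(\<Lambda> ^^ s) (x - y) = (\<Lambda> ^^ s) x - (\<Lambda> ^^ s) y"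
  by (metis \<Lambda>pow_add add_diff_cancel diff_add_cancel)

lemma \<Lambda>pow_neg: "(\<Lambda> ^^ s) (- y) = - (\<Lambda> ^^ s) y"
  using \<Lambda>pow_diff[of s 0 y] by (simp add: \<Lambda>pow_zero)

lemma \<Lambda>pow_sum: "(\<Lambda> ^^ s) (sum f A) = (\<Sum>x\<in>A. (\<Lambda> ^^ s) (f x))"
  by (induction A rule: infinite_finite_induct) (simp_all add: \<Lambda>pow_add \<Lambda>pow_zero)

lemma slice_op_diff_0: "slice_op \<Lambda> diff_stencil H 0 v = 0"
  by (simp add: slice_op_def diff_stencil_def)

lemma slice_op_diff_odd: "odd p \<Longrightarrow> slice_op \<Lambda> diff_stencil H p v = \<Lambda> (H (p - 1) v) - H (p - 1) (Suc v)"
  using odd_pos[of p] by (simp add: slice_op_def diff_stencil_def)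

lemma slice_op_diff_even: "even p \<Longrightarrow> 0 < p \<Longrightarrow>
    slice_op \<Lambda> diff_stencil H p v = (\<Sum>s<a. (\<Lambda> ^^ s) (H (p - 1) (v + (a - 1 - s))))"
  by (simp add: slice_op_def diff_stencil_def o_def interv_sum_list_conv_sum_set_nat atLeast0LessThan)

lemma slice_op_htpy_even: "even p \<Longrightarrow> v < a \<Longrightarrow>
    slice_op \<Lambda> htpy_stencil H p v = - (\<Sum>r<v. (\<Lambda> ^^ (v - 1 - r)) (H (Suc p) r))"
  by (simp add: slice_op_def htpy_stencil_def o_def interv_sum_list_conv_sum_set_nat atLeast0LessThan sum_negf)

lemma slice_op_htpy_odd: "odd p \<Longrightarrow>
    slice_op \<Lambda> htpy_stencil H p v = (if v = a - 1 then H (Suc p) 0 else 0)"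
  using a_ge_2 by (simp add: slice_op_def htpy_stencil_def)

lemma slice_op_htpy_large: "a \<le> v \<Longrightarrow> slice_op \<Lambda> htpy_stencil H p v = 0"
  by (simp add: slice_op_def htpy_stencil_def)

lemma slice_op_diff_large: "a \<le> v \<Longrightarrow> slice_op \<Lambda> diff_stencil G p v = 0"
  by (cases "p = 0"; cases "odd p")
     (simp_all add: slice_op_diff_0 slice_op_diff_odd slice_op_diff_even G_bounded \<Lambda>pow_zero \<Lambda>pow_zero[of 1, simplified])

text \<open>The product of \<open>x \<otimes> 1 - 1 \<otimes> x\<close> with the norm element is \<open>x^a \<otimes> 1 - 1 \<otimes> x^a = 0\<close>.\<close>

lemma diff_diff_telescope:
  "(\<Sum>s<a. (\<Lambda> ^^ Suc s) (G p (v + (a - 1 - s)))) = (\<Sum>s<a. (\<Lambda> ^^ s) (G p (Suc (v + (a - 1 - s)))))"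
proof -
  let ?T = "\<lambda>s. (\<Lambda> ^^ s) (G p (v + (a - s)))"
  have "(\<Sum>s<a. (\<Lambda> ^^ Suc s) (G p (v + (a - 1 - s)))) - (\<Sum>s<a. (\<Lambda> ^^ s) (G p (Suc (v + (a - 1 - s))))) =
      (\<Sum>s<a. ?T (Suc s) - ?T s)"
    unfolding sum_subtractf[symmetric] by (rule sum.cong) (simp_all add: Suc_diff_Suc)
  also have "\<dots> = ?T a - ?T 0" by (rule sum_lessThan_telescope)
  also have "\<dots> = 0" by (simp add: \<Lambda>_nil G_bounded)
  finally show ?thesis by simp
qed

lemma slice_op_diff_diff: "slice_op \<Lambda> diff_stencil (slice_op \<Lambda> diff_stencil G) p v = 0"
proof (cases "p \<le> 1")
  case True
  then have "p = 0 \<or> p = 1" by auto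
  then show ?thesis by (elim disjE) (simp_all add: slice_op_diff_0 slice_op_diff_odd \<Lambda>pow_zero[of 1, simplified])
next
  case False
  then have p: "0 < p" "p - 1 - 1 = p - 2" "0 < p - 1" by auto
  note T = diff_diff_telescope[of "p - 2" v, unfolded funpow.simps o_apply]
  show ?thesis
  proof (cases "odd p")
    case True
    then have "even (p - 1)" by simp
    then show ?thesis
      unfolding slice_op_diff_odd[OF True] slice_op_diff_even[OF \<open>even (p - 1)\<close> p(3)] p(2) add_Suc \<Lambda>pow_sum[of 1, simplified] T
      by simp
  next
    case even: False
    then have o: "odd (p - 1)" "even p" using p by auto
    then show ?thesis using T
      unfolding slice_op_diff_even[OF o(2) p(1)] slice_op_diff_odd[OF o(1)] p(2) \<Lambda>pow_diff sum_subtractf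
      by (simp add: funpow_swap1)
  qed
qed

lemma htpy_telescope: "v < a \<Longrightarrow>
   - (\<Sum>r<v. (\<Lambda> ^^ (v - 1 - r)) (\<Lambda> (G p r) - G p (Suc r))) = G p v - (\<Lambda> ^^ v) (G p 0)"
proof -
  let ?T = "\<lambda>r. (\<Lambda> ^^ (v - r)) (G p r)"
  have "- (\<Sum>r<v. (\<Lambda> ^^ (v - 1 - r)) (\<Lambda> (G p r) - G p (Suc r))) = (\<Sum>r<v. ?T (Suc r) - ?T r)"
    unfolding sum_negf[symmetric]
  proof (rule sum.cong)
    fix r assume "r \<in> {..<v}"
    then have "v - r = Suc (v - 1 - r)" by auto
    then show "- (\<Lambda> ^^ (v - 1 - r)) (\<Lambda> (G p r) - G p (Suc r)) = ?T (Suc r) - ?T r"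
      by (simp add: \<Lambda>pow_diff funpow_swap1)
  qed simp
  also have "\<dots> = ?T v - ?T 0" by (rule sum_lessThan_telescope)
  finally show ?thesis by simp
qed

lemma slice_op_htpy:
  "slice_op \<Lambda> diff_stencil (slice_op \<Lambda> htpy_stencil G) p v + slice_op \<Lambda> htpy_stencil (slice_op \<Lambda> diff_stencil G) p v
    = G p v - slice_op \<Lambda> proj_stencil G p v"
proof (cases "v < a")
  case False
  then have "slice_op \<Lambda> diff_stencil (slice_op \<Lambda> htpy_stencil G) p v = 0"
    by (cases "p = 0"; cases "odd p")
       (simp_all add: slice_op_diff_0 slice_op_diff_odd slice_op_diff_even slice_op_htpy_large \<Lambda>pow_zero \<Lambda>pow_zero[of 1, simplified])
  moreover have "slice_op \<Lambda> proj_stencil G p v = 0" using False by (simp add: slice_op_def proj_stencil_def)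
  ultimately show ?thesis using False by (simp add: slice_op_htpy_large G_bounded)
next
  case v: True
  consider "p = 0" | "even p" "0 < p" | "odd p" by auto
  then show ?thesis
  proof cases
    case 1
    then show ?thesis using v htpy_telescope[OF v]
      by (simp add: slice_op_diff_0 slice_op_htpy_even slice_op_diff_odd) (simp add: slice_op_def proj_stencil_def)
  next
    case 2
    have "slice_op \<Lambda> diff_stencil (slice_op \<Lambda> htpy_stencil G) p v =
        (\<Sum>s<a. if s = v then (\<Lambda> ^^ s) (G p 0) else 0)"
      using 2 v unfolding slice_op_diff_even[OF 2] by (intro sum.cong) (auto simp: slice_op_htpy_odd \<Lambda>pow_zero)
    also have "\<dots> = (\<Lambda> ^^ v) (G p 0)" using v by simp
    finally show ?thesis using 2 v htpy_telescope[OF v]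
      by (simp add: slice_op_htpy_even slice_op_diff_odd) (simp add: slice_op_def proj_stencil_def)
  next
    case 3
    then have p: "0 < p" "even (p - 1)" "even (Suc p)" by (auto simp: odd_pos)
    have P: "slice_op \<Lambda> proj_stencil G p v = 0" using p by (simp add: slice_op_def proj_stencil_def)
    have A: "\<Lambda> (slice_op \<Lambda> htpy_stencil G (p - 1) v) = - (\<Sum>r<v. (\<Lambda> ^^ (v - r)) (G p r))"
    proof -
      have "\<Lambda> ((\<Lambda> ^^ (v - 1 - r)) x) = (\<Lambda> ^^ (v - r)) x" if "r < v" for r x
      proof -
        have "v - r = Suc (v - 1 - r)" using that by auto
        then show ?thesis by simp
      qed
      then show ?thesis using p v
        by (simp add: slice_op_htpy_even \<Lambda>pow_neg[of 1, simplified] \<Lambda>pow_sum[of 1, simplified])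
    qed
    show ?thesis
    proof (cases "v = a - 1")
      case False
      then have "Suc v < a" using v by auto
      then show ?thesis using 3 p A False P
        by (simp add: slice_op_diff_odd slice_op_htpy_odd) (simp add: slice_op_htpy_even)
    next
      case True
      then have va: "a = Suc v" using v by auto
      have "(\<Sum>s<a. (\<Lambda> ^^ s) (G p (a - 1 - s))) = (\<Sum>r<a. (\<Lambda> ^^ (v - r)) (G p r))"
        by (rule sum.reindex_bij_witness[where i = "\<lambda>r. v - r" and j = "\<lambda>r. v - r"]) (auto simp: va)
      then have "slice_op \<Lambda> htpy_stencil (slice_op \<Lambda> diff_stencil G) p v = (\<Sum>r<a. (\<Lambda> ^^ (v - r)) (G p r))"
        unfolding slice_op_htpy_odd[OF 3] slice_op_diff_even[OF p(3) zero_less_Suc] using True by simp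
      also have "\<dots> = (\<Sum>r<v. (\<Lambda> ^^ (v - r)) (G p r)) + G p v"
        unfolding va by simp
      finally have H: "slice_op \<Lambda> htpy_stencil (slice_op \<Lambda> diff_stencil G) p v = (\<Sum>r<v. (\<Lambda> ^^ (v - r)) (G p r)) + G p v" .
      have "slice_op \<Lambda> htpy_stencil G (p - 1) (Suc v) = 0" by (rule slice_op_htpy_large) (simp add: va)
      then show ?thesis using A H P by (simp add: slice_op_diff_odd[OF 3])
    qed
  qed
qed

end


abbreviation twist :: "nat \<Rightarrow> (nat \<Rightarrow> nat) \<Rightarrow> (nat \<Rightarrow> nat) \<Rightarrow> 'w \<Rightarrow> 'w" where
  "twist l i u x \<equiv> q ^ kap l i u \<cdot> L l x"

lemma twist_pow: "(twist l i u ^^ s) x = q ^ (kap l i u * s) \<cdot> (L l ^^ s) x"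
  by (induction s) (simp_all add: L_scale power_add)

lemma dirop_ev1:
  "dirop l S g i u = slice_op (twist l i u) S (\<lambda>p v. g (i(l := p)) (u(l := v))) (i l) (u l)"
  by (simp add: dirop_def slice_op_def twist_pow)

lemma dirop_dirop_ev1:
  "dirop l S (dirop l T g) i u =
    slice_op (twist l i u) S (slice_op (twist l i u) T (\<lambda>p v. g (i(l := p)) (u(l := v)))) (i l) (u l)"
  by (simp add: dirop_ev1 kap_upd_ge)

text \<open>Values on monomials \<open>x^u m\<close> with some \<open>u_l \<ge> a\<close> are zero, since the monomial is.\<close>

definition bounded :: "((nat \<Rightarrow> nat) \<Rightarrow> (nat \<Rightarrow> nat) \<Rightarrow> 'w) \<Rightarrow> bool" where
  "bounded g \<longleftrightarrow> (\<forall>i u. (\<exists>l\<in>{1..c}. a \<le> u l) \<longrightarrow> g i u = 0)"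

definition valued :: "((nat \<Rightarrow> nat) \<Rightarrow> (nat \<Rightarrow> nat) \<Rightarrow> 'w) \<Rightarrow> bool" where
  "valued g \<longleftrightarrow> (\<forall>i u. g i u \<in> W)"

lemma twist_ops:
  assumes "l \<in> {1..c}"
  shows "twist l i u (x + y) = twist l i u x + twist l i u y" "(twist l i u ^^ a) x = 0"
  using assms by (simp_all add: L_add scale_right_distrib twist_pow L_nilpotent)

lemma bounded_slice: "bounded g \<Longrightarrow> l \<in> {1..c} \<Longrightarrow> a \<le> v \<Longrightarrow> g (i(l := p)) (u(l := v)) = 0"
  unfolding bounded_def by (metis fun_upd_same)

lemma dirop_diff_diff:
  assumes "l \<in> {1..c}" "bounded g"
  shows "dirop l diff_stencil (dirop l diff_stencil g) i u = 0"
  unfolding dirop_dirop_ev1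
  by (rule slice_op_diff_diff[OF twist_ops[OF assms(1)]]) (rule bounded_slice[OF assms(2,1)])

lemma dirop_htpy:
  assumes "l \<in> {1..c}" "bounded g"
  shows "dirop l diff_stencil (dirop l htpy_stencil g) i u + dirop l htpy_stencil (dirop l diff_stencil g) i u
    = g i u - dirop l proj_stencil g i u"
proof -
  let ?G = "\<lambda>p v. g (i(l := p)) (u(l := v))" and ?T = "twist l i u"
  have "slice_op ?T diff_stencil (slice_op ?T htpy_stencil ?G) (i l) (u l) + slice_op ?T htpy_stencil (slice_op ?T diff_stencil ?G) (i l) (u l)
      = ?G (i l) (u l) - slice_op ?T proj_stencil ?G (i l) (u l)"
    by (rule slice_op_htpy[OF twist_ops[OF assms(1)]]) (rule bounded_slice[OF assms(2,1)])
  then show ?thesis unfolding dirop_dirop_ev1 dirop_ev1[of l proj_stencil] by simp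
qed


lemma bounded_sdirop:
  assumes l: "l \<in> {1..c}" and g: "bounded g" and S: "S = diff_stencil \<or> S = htpy_stencil"
  shows "bounded (sdirop l S g)"
  unfolding bounded_def
proof (intro allI impI)
  fix i u :: "nat \<Rightarrow> nat" assume "\<exists>l\<in>{1..c}. a \<le> u l"
  then obtain m where m: "m \<in> {1..c}" "a \<le> u m" by blast
  have "dirop l S g i u = 0"
  proof (cases "m = l")
    case True
    have "slice_op (twist l i u) diff_stencil (\<lambda>p v. g (i(l := p)) (u(l := v))) (i l) (u l) = 0"
      by (rule slice_op_diff_large[OF twist_ops[OF l] bounded_slice[OF g l]]) (use True m in auto)
    moreover have "slice_op (twist l i u) htpy_stencil (\<lambda>p v. g (i(l := p)) (u(l := v))) (i l) (u l) = 0"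
      by (rule slice_op_htpy_large[OF twist_ops[OF l] bounded_slice[OF g l]]) (use True m in auto)
    ultimately show ?thesis using S by (auto simp: dirop_ev1)
  next
    case False
    then have "a \<le> (u(l := v)) m" for v using m by simp
    then have "g (i(l := p)) (u(l := v)) = 0" for p v
      using g m(1) unfolding bounded_def by blast
    then have "dirop l S g i u = 0 \<cdot> dirop l S g i u" by (intro dirop_scale_factor) auto
    then show ?thesis by simp
  qed
  then show "sdirop l S g i u = 0" by (simp add: sdirop_def)
qed

lemma sum_list_closed: "(\<And>x. x \<in> set xs \<Longrightarrow> f x \<in> W) \<Longrightarrow> (\<Sum>x\<leftarrow>xs. f x) \<in> W"
  by (induction xs) (auto intro: subspace_add[OF W_subspace] subspace_0[OF W_subspace])

lemma valued_sdirop: "valued g \<Longrightarrow> valued (sdirop l S g)"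
  by (auto simp: valued_def sdirop_def dirop_def
      intro!: subspace_scale[OF W_subspace] Lpow_closed sum_list_closed)

definition cdiff :: "((nat \<Rightarrow> nat) \<Rightarrow> (nat \<Rightarrow> nat) \<Rightarrow> 'w) \<Rightarrow> (nat \<Rightarrow> nat) \<Rightarrow> (nat \<Rightarrow> nat) \<Rightarrow> 'w" where
  "cdiff g i u = (\<Sum>l\<in>{1..c}. sdirop l diff_stencil g i u)"

lemma cdiff_add: "cdiff (\<lambda>i u. g i u + h i u) i u = cdiff g i u + cdiff h i u"
  by (simp add: cdiff_def sdirop_add sum.distrib)

lemma cdiff_scale: "cdiff (\<lambda>i u. r \<cdot> g i u) i u = r \<cdot> cdiff g i u"
  by (simp add: cdiff_def sdirop_scale scale_sum_right)

lemma cdiff_diff: "cdiff (\<lambda>i u. g i u - h i u) i u = cdiff g i u - cdiff h i u"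
  using cdiff_add[of g "\<lambda>i u. (-1) \<cdot> h i u" i u] cdiff_scale[of "-1" h i u] by simp

lemma sum_antisymmetric:
  fixes t :: "nat \<Rightarrow> nat \<Rightarrow> 'w"
  assumes "finite A" "B \<subseteq> A" and diag: "\<And>l. l \<in> A \<Longrightarrow> t l l = 0"
    and anti: "\<And>l m. l \<in> A \<Longrightarrow> m \<in> A \<Longrightarrow> l \<noteq> m \<Longrightarrow> t l m + t m l = 0"
  shows "(\<Sum>l\<in>B. \<Sum>m\<in>B. t l m) = 0"
proof -
  have "finite B" using assms(1,2) by (rule finite_subset[rotated])
  then show ?thesis using assms(2)
  proof (induction B rule: finite_induct)
    case (insert x B)
    have "(\<Sum>l\<in>insert x B. \<Sum>m\<in>insert x B. t l m) =
        t x x + ((\<Sum>l\<in>B. t x l + t l x) + (\<Sum>l\<in>B. \<Sum>m\<in>B. t l m))"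
      using insert.hyps by (simp add: sum.distrib)
    also have "(\<Sum>l\<in>B. t x l + t l x) = 0"
    proof (rule sum.neutral, rule ballI)
      fix l assume "l \<in> B"
      then show "t x l + t l x = 0" using insert.hyps insert.prems by (intro anti) auto
    qed
    also have "t x x = 0" using insert.prems by (intro diag) auto
    also have "(\<Sum>l\<in>B. \<Sum>m\<in>B. t l m) = 0" using insert.prems by (intro insert.IH) auto
    finally show ?case by simp
  qed simp
qed

lemma cdiff_cdiff:
  assumes "bounded g"
  shows "cdiff (cdiff g) i u = 0"
proof -
  have "cdiff (cdiff g) i u = (\<Sum>l\<in>{1..c}. \<Sum>m\<in>{1..c}. sdirop l diff_stencil (sdirop m diff_stencil g) i u)"
    unfolding cdiff_def by (simp add: sdirop_sum)
  also have "\<dots> = 0"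
  proof (rule sum_antisymmetric[OF _ order.refl])
    show "sdirop l diff_stencil (sdirop m diff_stencil g) i u + sdirop m diff_stencil (sdirop l diff_stencil g) i u = 0"
      if "l \<in> {1..c}" "m \<in> {1..c}" "l \<noteq> m" for l m
      using sdirop_anticommute[OF that homog_diff homog_diff, of g i u] by simp
  qed (simp_all add: sdirop_same dirop_diff_diff assms)
  finally show ?thesis .
qed

text \<open>The homotopy in direction \<open>k\<close> anticommutes with the other directions, so it contracts the total
complex onto the part on which direction \<open>k\<close> is trivial.\<close>

lemma cdiff_htpy:
  assumes g: "bounded g" and k: "k \<in> {1..c}"
  shows "cdiff (sdirop k htpy_stencil g) i u + sdirop k htpy_stencil (cdiff g) i u
    = g i u - dirop k proj_stencil g i u"
proof -
  have "cdiff (sdirop k htpy_stencil g) i u + sdirop k htpy_stencil (cdiff g) i u =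
     (\<Sum>l\<in>{1..c}. sdirop l diff_stencil (sdirop k htpy_stencil g) i u + sdirop k htpy_stencil (sdirop l diff_stencil g) i u)"
    unfolding cdiff_def by (simp add: sdirop_sum sum.distrib)
  also have "\<dots> = (\<Sum>l\<in>{1..c}. if l = k then g i u - dirop k proj_stencil g i u else 0)"
  proof (rule sum.cong)
    fix l assume l: "l \<in> {1..c}"
    show "sdirop l diff_stencil (sdirop k htpy_stencil g) i u + sdirop k htpy_stencil (sdirop l diff_stencil g) i u
      = (if l = k then g i u - dirop k proj_stencil g i u else 0)"
    proof (cases "l = k")
      case True
      then show ?thesis using dirop_htpy[OF k g, of i u] by (simp add: sdirop_same)
    next
      case False
      then show ?thesis using sdirop_anticommute[OF k l _ homog_htpy homog_diff, of g i u] by simp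
    qed
  qed simp
  finally show ?thesis using k by simp
qed

lemma dirop_proj: "dirop l proj_stencil g i u =
    (if i l = 0 \<and> u l < a then q ^ (kap l i u * u l) \<cdot> (L l ^^ u l) (g i (u(l := 0))) else 0)"
proof -
  have "i(l := 0) = i" if "i l = 0" using that by auto
  then show ?thesis by (auto simp: dirop_def proj_stencil_def)
qed

lemma bounded_cdiff: "bounded g \<Longrightarrow> bounded (cdiff g)"
  using bounded_sdirop[of _ g diff_stencil] unfolding bounded_def cdiff_def by (auto intro!: sum.neutral)

lemma valued_cdiff: "valued g \<Longrightarrow> valued (cdiff g)"
  using valued_sdirop[of g _ diff_stencil] unfolding valued_def cdiff_def
  by (auto intro!: subspace_sum[OF W_subspace])

lemma bounded_add: "bounded g \<Longrightarrow> bounded h \<Longrightarrow> bounded (\<lambda>i u. g i u + h i u)"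
  unfolding bounded_def by auto

lemma valued_add: "valued g \<Longrightarrow> valued h \<Longrightarrow> valued (\<lambda>i u. g i u + h i u)"
  unfolding valued_def by (auto intro: subspace_add[OF W_subspace])

lemma bounded_minus: "bounded g \<Longrightarrow> bounded h \<Longrightarrow> bounded (\<lambda>i u. g i u - h i u)"
  unfolding bounded_def by auto

lemma valued_minus: "valued g \<Longrightarrow> valued h \<Longrightarrow> valued (\<lambda>i u. g i u - h i u)"
  unfolding valued_def by (auto intro: subspace_diff[OF W_subspace])

text \<open>Contracting the directions one after the other changes a cocycle by coboundaries until it is
concentrated at the index 0, which has degree 0.\<close>

lemma acyclic_all:
  assumes g: "bounded g" "valued g" and cocycle: "\<And>i u. mdeg c i = Suc n \<Longrightarrow> cdiff g i u = 0" and n: "0 < n"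
  shows "\<exists>y. bounded y \<and> valued y \<and> (\<forall>i u. mdeg c i = n \<longrightarrow> g i u = cdiff y i u)"
proof -
  have "\<exists>y. bounded y \<and> valued y \<and> (\<forall>i u. mdeg c i = n \<longrightarrow> (\<exists>m\<in>{1..k}. i m \<noteq> 0) \<longrightarrow> g i u = cdiff y i u)"
    if "k \<le> c" for k
    using that
  proof (induction k)
    case 0
    have "bounded (\<lambda>i u. 0)" "valued (\<lambda>i u. 0)"
      by (auto simp: bounded_def valued_def subspace_0[OF W_subspace])
    then show ?case by (intro exI[of _ "\<lambda>i u. 0"]) auto
  next
    case (Suc k)
    then obtain y where y: "bounded y" "valued y"
      "\<And>i u. mdeg c i = n \<Longrightarrow> (\<exists>m\<in>{1..k}. i m \<noteq> 0) \<Longrightarrow> g i u = cdiff y i u" by fastforce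
    let ?K = "Suc k"
    have K: "?K \<in> {1..c}" using Suc by auto
    define z where "z = (\<lambda>i u. g i u - cdiff y i u)"
    have z: "bounded z" "valued z" unfolding z_def
      by (intro bounded_minus valued_minus bounded_cdiff valued_cdiff g y)+
    let ?h = "sdirop ?K htpy_stencil z"
    have dz: "cdiff z i u = 0" if "mdeg c i = Suc n" for i u
      using that by (simp add: z_def cdiff_diff cocycle cdiff_cdiff y)
    have h: "bounded ?h" "valued ?h" using z by (simp_all add: bounded_sdirop[OF K] valued_sdirop)
    show ?case
    proof (intro exI conjI allI impI)
      show "bounded (\<lambda>i u. y i u + ?h i u)" "valued (\<lambda>i u. y i u + ?h i u)"
        by (intro bounded_add valued_add y h)+
      fix i u assume i: "mdeg c i = n" "\<exists>m\<in>{1..?K}. i m \<noteq> 0"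
      have "dirop ?K htpy_stencil (cdiff z) i u = 0 \<cdot> dirop ?K htpy_stencil (cdiff z) i u"
      proof (rule dirop_scale_factor)
        fix r s p v assume S: "(r, s, p, v) \<in> set (htpy_stencil (i ?K) (u ?K))"
        then have "p = Suc (i ?K)" by (auto simp: htpy_stencil_def split: if_splits)
        then have "mdeg c (i(?K := p)) = Suc n" using mdeg_upd[OF K, of i p] i by simp
        then show "cdiff z (i(?K := p)) (u(?K := v)) = 0 \<cdot> cdiff z (i(?K := p)) (u(?K := v))"
          by (simp add: dz)
      qed
      then have "sdirop ?K htpy_stencil (cdiff z) i u = 0" by (simp add: sdirop_def)
      with cdiff_htpy[OF z(1) K, of i u]
      have "cdiff ?h i u = z i u - dirop ?K proj_stencil z i u" by simp
      moreover have "dirop ?K proj_stencil z i u = 0"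
      proof (cases "i ?K = 0")
        case True
        then have "\<exists>m\<in>{1..k}. i m \<noteq> 0" using i(2) by (metis atLeastAtMost_iff le_SucE)
        then have "z i u' = 0" for u' using y(3)[OF i(1)] by (simp add: z_def)
        then show ?thesis by (simp add: dirop_proj)
      qed (simp add: dirop_proj)
      ultimately show "g i u = cdiff (\<lambda>i u. y i u + ?h i u) i u"
        by (simp add: cdiff_add z_def)
    qed
  qed
  from this[of c] obtain y where y: "bounded y" "valued y"
    "\<And>i u. mdeg c i = n \<Longrightarrow> \<exists>m\<in>{1..c}. i m \<noteq> 0 \<Longrightarrow> g i u = cdiff y i u" by blast
  moreover have "\<exists>m\<in>{1..c}. i m \<noteq> 0" if "mdeg c i = n" for i
  proof (rule ccontr)
    assume "\<not> (\<exists>m\<in>{1..c}. i m \<noteq> 0)"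
    then have "mdeg c i = 0" by (auto simp: mdeg_def)
    then show False using that n by simp
  qed
  ultimately show ?thesis by blast
qed

lemma cdiff_cong:
  assumes "\<And>l p v. l \<in> {1..c} \<Longrightarrow> 0 < i l \<Longrightarrow> g (i(l := i l - 1)) (u(l := v)) = h (i(l := i l - 1)) (u(l := v))"
  shows "cdiff g i u = cdiff h i u"
proof -
  have "dirop l diff_stencil g i u = dirop l diff_stencil h i u" if l: "l \<in> {1..c}" for l
  proof (rule dirop_cong)
    fix r s p v assume "(r, s, p, v) \<in> set (diff_stencil (i l) (u l))"
    then have "p = i l - 1 \<and> 0 < i l" by (auto simp: diff_stencil_def split: if_splits)
    then show "g (i(l := p)) (u(l := v)) = h (i(l := p)) (u(l := v))" using assms[OF l] by simp
  qed
  then show ?thesis by (auto simp: cdiff_def sdirop_def intro!: sum.cong)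
qed

text \<open>The same with all conditions restricted to indices and exponents supported in \<open>{1..c}\<close>; masking the
other values changes nothing, as the differential never leaves the support.\<close>

lemma acyclic:
  assumes g: "bounded g" "valued g" and n: "0 < n"
    and cocycle: "\<And>i u. msupp c i \<Longrightarrow> msupp c u \<Longrightarrow> mdeg c i = Suc n \<Longrightarrow> cdiff g i u = 0"
  shows "\<exists>y. bounded y \<and> valued y \<and> (\<forall>i u. msupp c i \<longrightarrow> msupp c u \<longrightarrow> mdeg c i = n \<longrightarrow> g i u = cdiff y i u)"
proof -
  let ?g = "\<lambda>i u. if msupp c i \<and> msupp c u then g i u else 0"
  have "cdiff ?g i u = (if msupp c i \<and> msupp c u then cdiff g i u else 0)" for i u
  proof (cases "msupp c i \<and> msupp c u")
    case True
    then show ?thesis using cdiff_cong[of i ?g u g] by (simp add: msupp_upd)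
  next
    case False
    then have "cdiff ?g i u = cdiff (\<lambda>i u. 0 \<cdot> g i u) i u" by (intro cdiff_cong) (auto simp: msupp_upd)
    also have "\<dots> = 0" by (subst cdiff_scale) simp
    finally show ?thesis using False by auto
  qed
  then have "\<exists>y. bounded y \<and> valued y \<and> (\<forall>i u. mdeg c i = n \<longrightarrow> ?g i u = cdiff y i u)"
    using g cocycle n by (intro acyclic_all) (auto simp: bounded_def valued_def subspace_0[OF W_subspace])
  then obtain y where y: "bounded y" "valued y" "\<And>i u. mdeg c i = n \<Longrightarrow> ?g i u = cdiff y i u" by blast
  have "g i u = cdiff y i u" if "msupp c i" "msupp c u" "mdeg c i = n" for i u
    using y(3)[OF that(3), of u] that by simp
  with y show ?thesis by blast
qed

end

context quantum_operators begin

lemma wt_minus_2: "2 \<le> p \<Longrightarrow> wt (p - 2) + a = wt p"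
proof -
  assume "2 \<le> p"
  then obtain p' where "p = p' + 2" by (metis add.commute le_Suc_ex)
  then show ?thesis by (simp add: wt_def)
qed

lemma dirop_shift:
  assumes l: "l \<in> {1..c}" and j: "j \<in> {1..c}"
  shows "dirop l diff_stencil (\<lambda>i u. shift j (\<lambda>i. g i u) i) i u
    = (if 2 \<le> i j then dirop l diff_stencil g (i(j := i j - 2)) u else 0)"
proof (cases "l = j")
  case True
  show ?thesis
  proof (cases "2 < i j")
    case large: True
    have S: "diff_stencil (i j) v = map (\<lambda>(r, s, p, v). (r, s, p + 2, v)) (diff_stencil (i j - 2) v)" for v
      using large by (auto simp: diff_stencil_def even_diff_nat)
    have k: "kap l (i(j := p)) u = kap l i u" for p using kap_upd_ge[of l j i p u "u j"] True by simp
    show ?thesis using large unfolding dirop_def True S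
      by (simp add: o_def case_prod_unfold shift_def k[unfolded True])
  next
    case small: False
    have "dirop l diff_stencil (\<lambda>i u. shift j (\<lambda>i. g i u) i) i u = 0 \<cdot> dirop l diff_stencil (\<lambda>i u. shift j (\<lambda>i. g i u) i) i u"
    proof (rule dirop_scale_factor)
      fix r s p v assume "(r, s, p, v) \<in> set (diff_stencil (i l) (u l))"
      then have "p < 2" using small True by (auto simp: diff_stencil_def split: if_splits)
      then show "shift j (\<lambda>i. g i (u(l := v))) (i(l := p)) = 0 \<cdot> shift j (\<lambda>i. g i (u(l := v))) (i(l := p))"
        by (simp add: shift_def True)
    qed
    moreover have "dirop l diff_stencil g (i(j := i j - 2)) u = 0" if "2 \<le> i j"
      using small that True by (simp add: dirop_def diff_stencil_def)
    ultimately show ?thesis by simp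
  qed
next
  case False
  have q: "q ^ (kap l i u * s) = q ^ (kap l (i(j := i j - 2)) u * s)" if "2 \<le> i j" for s
  proof (cases "j < l")
    case True
    have "wt (i j - 2) + u j + a = wt (i j) + u j" using wt_minus_2[OF that] by simp
    from kap_upd_less[where m = j and l = l and i = i and u = u, OF _ True this] j have "kap l (i(j := i j - 2)) u + a = kap l i u" by simp
    then have "kap l i u * s = kap l (i(j := i j - 2)) u * s + a * s" by (metis add_mult_distrib)
    then show ?thesis by (simp add: power_add power_mult q_root)
  next
    case F: False
    then show ?thesis using kap_upd_ge[of l j i "i j - 2" u "u j"] False by simp
  qed
  show ?thesis using False
    by (auto simp: dirop_def shift_def fun_upd_twist q case_prod_unfold)
qed

lemma cdiff_shift:
  assumes j: "j \<in> {1..c}"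
  shows "cdiff (\<lambda>i u. shift j (\<lambda>i. g i u) i) i u = shift j (\<lambda>i. cdiff g i u) i"
proof -
  have s: "sgn_at l (i(j := i j - 2)) = sgn_at l i" if "2 \<le> i j" for l
  proof (cases "j < l")
    case True
    then have A: "{1..<l} = insert j ({1..<l} - {j})" "finite {1..<l}" using j by auto
    have "(\<Sum>m\<in>{1..<l}. i m) = i j + (\<Sum>m\<in>{1..<l}-{j}. i m)"
      "(\<Sum>m\<in>{1..<l}. (i(j := i j - 2)) m) = (i j - 2) + (\<Sum>m\<in>{1..<l}-{j}. i m)"
      by (subst A(1), simp add: sum.insert_remove)+
    then have "even (\<Sum>m\<in>{1..<l}. i m) \<longleftrightarrow> even (\<Sum>m\<in>{1..<l}. (i(j := i j - 2)) m)"
      using that by (simp add: even_diff_nat)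
    then show ?thesis unfolding sgn_at_def by (metis neg_one_even_power neg_one_odd_power)
  next
    case False
    then show ?thesis by (intro sgn_at_upd_ge) simp
  qed
  show ?thesis
  proof -
    have "sdirop l diff_stencil (\<lambda>i u. shift j (\<lambda>i. g i u) i) i u
      = (if 2 \<le> i j then sdirop l diff_stencil g (i(j := i j - 2)) u else 0)" if "l \<in> {1..c}" for l
      using s unfolding sdirop_def dirop_shift[OF that j] by auto
    then have "cdiff (\<lambda>i u. shift j (\<lambda>i. g i u) i) i u
      = (\<Sum>l\<in>{1..c}. if 2 \<le> i j then sdirop l diff_stencil g (i(j := i j - 2)) u else 0)"
      unfolding cdiff_def by (intro sum.cong) auto
    then show ?thesis by (auto simp: cdiff_def shift_def)
  qed
qed

text \<open>The exponent of \<open>q\<close> by which the values on \<open>x^u m\<close> are rescaled: the number of transpositions needed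
to reorder the monomial \<open>x^u\<close> past the generator of degree \<open>wt \<circ> i\<close> and past itself.\<close>

definition gauge :: "(nat \<Rightarrow> nat) \<Rightarrow> (nat \<Rightarrow> nat) \<Rightarrow> nat" where
  "gauge i u = (\<Sum>n\<in>{1..c}. (\<Sum>m\<in>{1..<n}. u m) * (wt (i n) + u n))"

lemma gauge_zero [simp]: "gauge i (\<lambda>_. 0) = 0" by (simp add: gauge_def)

lemma gauge_upd:
  assumes l: "l \<in> {1..c}" and w: "wt p + t + s = wt (i l)"
  shows "gauge (i(l := p)) (u(l := u l + t)) + s * (\<Sum>m\<in>{1..<l}. u m)
    = gauge i u + t * (\<Sum>n\<in>{l<..c}. wt (i n) + u n)"
proof -
  let ?i = "i(l := p)" and ?u = "u(l := u l + t)"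
  have S: "(\<Sum>m\<in>{1..<n}. ?u m) = (\<Sum>m\<in>{1..<n}. u m) + (if l < n then t else 0)" for n
  proof -
    have "(\<Sum>m\<in>{1..<n}. ?u m) = (\<Sum>m\<in>{1..<n}. u m + (if m = l then t else 0))"
      by (intro sum.cong) auto
    also have "\<dots> = (\<Sum>m\<in>{1..<n}. u m) + (if l < n then t else 0)"
      using l by (simp add: sum.distrib)
    finally show ?thesis .
  qed
  have "(\<Sum>m\<in>{1..<n}. ?u m) * (wt (?i n) + ?u n) + (if n = l then s * (\<Sum>m\<in>{1..<l}. u m) else 0)
      = (\<Sum>m\<in>{1..<n}. u m) * (wt (i n) + u n) + (if l < n then t * (wt (i n) + u n) else 0)" for n
  proof (cases "n = l")
    case True
    then show ?thesis unfolding S by (simp flip: w) (simp add: algebra_simps)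
  next
    case False
    then show ?thesis unfolding S by (simp add: add_mult_distrib)
  qed
  note pointwise = this
  have "gauge ?i ?u + s * (\<Sum>m\<in>{1..<l}. u m) =
      (\<Sum>n\<in>{1..c}. (\<Sum>m\<in>{1..<n}. ?u m) * (wt (?i n) + ?u n) + (if n = l then s * (\<Sum>m\<in>{1..<l}. u m) else 0))"
    unfolding sum.distrib gauge_def using l by (simp only: sum.delta finite_atLeastAtMost if_True)
  also have "\<dots> = (\<Sum>n\<in>{1..c}. (\<Sum>m\<in>{1..<n}. u m) * (wt (i n) + u n) + (if l < n then t * (wt (i n) + u n) else 0))"
    unfolding pointwise ..
  also have "\<dots> = gauge i u + (\<Sum>n\<in>{1..c}. if l < n then t * (wt (i n) + u n) else 0)"
    unfolding sum.distrib gauge_def ..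
  also have "(\<Sum>n\<in>{1..c}. if l < n then t * (wt (i n) + u n) else 0) = t * (\<Sum>n\<in>{l<..c}. wt (i n) + u n)"
    unfolding sum_distrib_left using l by (intro sum.mono_neutral_cong_right) auto
  finally show ?thesis .
qed

lemma kap_split: "kap l i u = kap l i (\<lambda>_. 0) + (\<Sum>m\<in>{1..<l}. u m)"
  by (simp add: kap_def sum.distrib)

lemma diff_stencil_split: "diff_stencil p v = map (\<lambda>(r, s, p', t). (r, s, p', v + t)) (diff_stencil p 0)"
  by (auto simp: diff_stencil_def)

lemma q_gauge_shift: "j \<in> {1..c} \<Longrightarrow> 2 \<le> i j \<Longrightarrow> q ^ gauge (i(j := i j - 2)) u = q ^ gauge i u"
proof -
  assume j: "j \<in> {1..c}" "2 \<le> i j"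
  have "wt (i j - 2) + 0 + a = wt (i j)" using wt_minus_2[OF j(2)] by simp
  from gauge_upd[where i = i and u = u, OF j(1) this]
  have "q ^ gauge i u = q ^ gauge (i(j := i j - 2)) u * q ^ (a * (\<Sum>m\<in>{1..<j}. u m))"
    by (simp flip: power_add)
  then show ?thesis by (simp add: power_mult q_root)
qed

end

section \<open>The complex of a module\<close>

text \<open>The monomial \<open>x_n^(u_n) \<cdots> x_1^(u_1)\<close> acting on \<open>x\<close>.  Decreasing order keeps all exponents of \<open>q\<close>
nonnegative when a variable is moved into place.\<close>

primrec xpow :: "(nat \<Rightarrow> 'x \<Rightarrow> 'x) \<Rightarrow> (nat \<Rightarrow> nat) \<Rightarrow> nat \<Rightarrow> 'x \<Rightarrow> 'x" where
  "xpow X u 0 x = x"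
| "xpow X u (Suc n) x = (X (Suc n) ^^ u (Suc n)) (xpow X u n x)"

lemma xpow_cong: "(\<And>l. l \<in> {1..n} \<Longrightarrow> u l = v l) \<Longrightarrow> xpow X u n x = xpow X v n x"
  by (induction n) auto

lemma xpow_zero: "xpow X (\<lambda>_. 0) n x = x"
  by (induction n) auto

lemma xpow_single: "xpow X ((\<lambda>_. 0)(l := t)) n x = (if l \<in> {1..n} then (X l ^^ t) x else x)"
  by (induction n) auto

text \<open>What is needed of a module over the quantum complete intersection: scalars, and the action of the
variables with their relations.  The additive structure is only used through \<open>k\<close>-linear maps out of it.\<close>

locale qrep =
  fixes c a :: nat and q :: "'k::field" and C :: "'x set" and pl :: "'x \<Rightarrow> 'x \<Rightarrow> 'x"
    and ze :: 'x and sm :: "'k \<Rightarrow> 'x \<Rightarrow> 'x" and X :: "nat \<Rightarrow> 'x \<Rightarrow> 'x"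
  assumes pl_closed: "\<lbrakk>x \<in> C; y \<in> C\<rbrakk> \<Longrightarrow> pl x y \<in> C" and ze_closed: "ze \<in> C"
    and sm_closed: "x \<in> C \<Longrightarrow> sm r x \<in> C"
    and X_closed: "\<lbrakk>l \<in> {1..c}; x \<in> C\<rbrakk> \<Longrightarrow> X l x \<in> C"
    and sm_0: "x \<in> C \<Longrightarrow> sm 0 x = ze" and sm_1: "x \<in> C \<Longrightarrow> sm 1 x = x"
    and pl_minus: "x \<in> C \<Longrightarrow> pl x (sm (- 1) x) = ze"
    and sm_sm: "x \<in> C \<Longrightarrow> sm r (sm s x) = sm (r * s) x"
    and sm_pl: "\<lbrakk>x \<in> C; y \<in> C\<rbrakk> \<Longrightarrow> sm r (pl x y) = pl (sm r x) (sm r y)"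
    and X_pl: "\<lbrakk>l \<in> {1..c}; x \<in> C; y \<in> C\<rbrakk> \<Longrightarrow> X l (pl x y) = pl (X l x) (X l y)"
    and X_sm: "\<lbrakk>l \<in> {1..c}; x \<in> C\<rbrakk> \<Longrightarrow> X l (sm r x) = sm r (X l x)"
    and X_q_commute: "\<lbrakk>1 \<le> l; l < m; m \<le> c; x \<in> C\<rbrakk> \<Longrightarrow> X l (X m x) = sm q (X m (X l x))"
    and X_nilpotent: "\<lbrakk>l \<in> {1..c}; x \<in> C\<rbrakk> \<Longrightarrow> (X l ^^ a) x = ze"
begin

lemma Xpow_closed: "l \<in> {1..c} \<Longrightarrow> x \<in> C \<Longrightarrow> (X l ^^ t) x \<in> C"
  by (induction t) (auto simp: X_closed)

lemma X_ze: "l \<in> {1..c} \<Longrightarrow> X l ze = ze"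
  using X_sm[of l ze 0] sm_0[OF ze_closed] sm_0[OF X_closed[OF _ ze_closed]] ze_closed by simp

lemma Xpow_ze: "l \<in> {1..c} \<Longrightarrow> (X l ^^ t) ze = ze"
  by (induction t) (auto simp: X_ze)

lemma Xpow_nilpotent: "l \<in> {1..c} \<Longrightarrow> x \<in> C \<Longrightarrow> a \<le> t \<Longrightarrow> (X l ^^ t) x = ze"
  using funpow_add[of "t - a" a "X l"] by (simp add: X_nilpotent Xpow_ze)

lemma Xpow_pl: "l \<in> {1..c} \<Longrightarrow> x \<in> C \<Longrightarrow> y \<in> C \<Longrightarrow> (X l ^^ t) (pl x y) = pl ((X l ^^ t) x) ((X l ^^ t) y)"
  by (induction t) (auto simp: X_pl Xpow_closed)

lemma Xpow_sm: "l \<in> {1..c} \<Longrightarrow> x \<in> C \<Longrightarrow> (X l ^^ t) (sm r x) = sm r ((X l ^^ t) x)"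
  by (induction t) (auto simp: X_sm Xpow_closed)

lemma xpow_closed: "n \<le> c \<Longrightarrow> x \<in> C \<Longrightarrow> xpow X u n x \<in> C"
  by (induction n) (auto simp: Xpow_closed)

lemma xpow_pl: "n \<le> c \<Longrightarrow> x \<in> C \<Longrightarrow> y \<in> C \<Longrightarrow> xpow X u n (pl x y) = pl (xpow X u n x) (xpow X u n y)"
  by (induction n) (auto simp: Xpow_pl xpow_closed)

lemma xpow_sm: "n \<le> c \<Longrightarrow> x \<in> C \<Longrightarrow> xpow X u n (sm r x) = sm r (xpow X u n x)"
  by (induction n) (auto simp: Xpow_sm xpow_closed)

lemma xpow_large:
  assumes "n \<le> c" "x \<in> C" "l \<in> {1..n}" "a \<le> u l" shows "xpow X u n x = ze"
  using assms
proof (induction n)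
  case (Suc n)
  show ?case
  proof (cases "l = Suc n")
    case True
    then show ?thesis using Suc.prems by (simp add: Xpow_nilpotent xpow_closed)
  next
    case False
    then have "xpow X u n x = ze" using Suc by auto
    then show ?thesis using Suc.prems by (simp add: Xpow_ze)
  qed
qed simp

lemma X_Xpow:
  assumes lm: "1 \<le> l" "l < m" "m \<le> c" and x: "x \<in> C"
  shows "X l ((X m ^^ t) x) = sm (q ^ t) ((X m ^^ t) (X l x))"
proof (induction t)
  case (Suc t)
  have m: "m \<in> {1..c}" "l \<in> {1..c}" using lm by auto
  have "X l ((X m ^^ Suc t) x) = sm q (X m (X l ((X m ^^ t) x)))"
    using X_q_commute[OF lm Xpow_closed[OF m(1) x]] by simp
  then show ?case using m x by (simp add: Suc X_sm sm_sm Xpow_closed X_closed)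
qed (use lm x in \<open>simp add: sm_1 X_closed\<close>)

lemma Xpow_Xpow:
  assumes lm: "1 \<le> l" "l < m" "m \<le> c" and x: "x \<in> C"
  shows "(X l ^^ s) ((X m ^^ t) x) = sm (q ^ (s * t)) ((X m ^^ t) ((X l ^^ s) x))"
proof (induction s)
  case (Suc s)
  have m: "m \<in> {1..c}" "l \<in> {1..c}" using lm by auto
  show ?case using m x
    by (simp add: Suc X_sm sm_sm Xpow_closed X_closed X_Xpow[OF lm] power_add mult.commute)
qed (use lm x in \<open>simp add: sm_1 Xpow_closed\<close>)

lemma Xpow_xpow:
  assumes l: "1 \<le> l" "l \<le> n" "n \<le> c" and x: "x \<in> C"
  shows "(X l ^^ t) (xpow X u n x) = sm (q ^ (t * (\<Sum>m\<in>{l<..n}. u m))) (xpow X (u(l := u l + t)) n x)"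
proof -
  define u' where "u' = u(l := u l + t)"
  have u': "u' l = u l + t" "m \<noteq> l \<Longrightarrow> u' m = u m" for m by (simp_all add: u'_def)
  have "(X l ^^ t) (xpow X u n x) = sm (q ^ (t * (\<Sum>m\<in>{l<..n}. u m))) (xpow X u' n x)"
    using l
  proof (induction n)
    case (Suc n)
    show ?case
    proof (cases "l = Suc n")
      case True
      then have "xpow X u' n x = xpow X u n x" by (intro xpow_cong) (simp add: u')
      moreover have "(X l ^^ t) ((X l ^^ u l) y) = (X l ^^ (u l + t)) y" for y
        by (metis add.commute comp_apply funpow_add)
      ultimately show ?thesis using True Suc.prems x u'(1)
        by (simp add: sm_1 Xpow_closed xpow_closed u')
    next
      case False
      then have l: "l \<le> n" "n \<le> c" "l < Suc n" using Suc.prems by auto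
      have "{l<..Suc n} = insert (Suc n) {l<..n}" using l by auto
      then have S: "t * (\<Sum>m\<in>{l<..Suc n}. u m) = t * u (Suc n) + t * (\<Sum>m\<in>{l<..n}. u m)"
        by (simp add: distrib_left)
      have c: "xpow X u' n x \<in> C" "xpow X u n x \<in> C" using x l by (auto simp: xpow_closed)
      have Sn: "Suc n \<in> {1..c}" using Suc.prems by auto
      have "(X l ^^ t) (xpow X u (Suc n) x)
          = sm (q ^ (t * u (Suc n))) ((X (Suc n) ^^ u (Suc n)) (sm (q ^ (t * (\<Sum>m\<in>{l<..n}. u m))) (xpow X u' n x)))"
        using Suc.IH[OF Suc.prems(1) l(1,2)] Xpow_Xpow[OF Suc.prems(1) l(3) Suc.prems(3) c(2)] by simp
      also have "\<dots> = sm (q ^ (t * (\<Sum>m\<in>{l<..Suc n}. u m))) (xpow X u' (Suc n) x)"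
        using False Sn c by (simp add: u' S power_add Xpow_sm sm_sm Xpow_closed)
      finally show ?thesis .
    qed
  qed (use l in auto)
  then show ?thesis by (simp add: u'_def)
qed

end

text \<open>The complex \<open>C(M)\<close>, for \<open>M\<close> given by \<open>qrep\<close> and \<open>N\<close> by \<open>quantum_operators\<close>.\<close>

locale cochains = quantum_operators sc c a q L W + qrep c a q C pl ze sm X
  for sc :: "'k::field \<Rightarrow> 'w::ab_group_add \<Rightarrow> 'w" (infixr "\<cdot>" 75)
    and c a :: nat and q :: 'k and L :: "nat \<Rightarrow> 'w \<Rightarrow> 'w" and W :: "'w set"
    and C :: "'x set" and pl ze sm X
begin

text \<open>Linear maps are zero outside the carrier, so that equality of functions is equality of maps.\<close>

definition Hom_k :: "('x \<Rightarrow> 'w) set" where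
  "Hom_k = {f. (\<forall>x\<in>C. f x \<in> W) \<and> (\<forall>x. x \<notin> C \<longrightarrow> f x = 0) \<and>
     (\<forall>x\<in>C. \<forall>y\<in>C. f (pl x y) = f x + f y) \<and> (\<forall>r. \<forall>x\<in>C. f (sm r x) = r \<cdot> f x)}"

lemma Hom_kD:
  assumes "f \<in> Hom_k"
  shows "f x \<in> W" "x \<notin> C \<Longrightarrow> f x = 0" "x \<in> C \<Longrightarrow> y \<in> C \<Longrightarrow> f (pl x y) = f x + f y"
    "x \<in> C \<Longrightarrow> f (sm r x) = r \<cdot> f x"
  using assms subspace_0[OF W_subspace] unfolding Hom_k_def by (cases "x \<in> C"; auto)+

lemma Hom_k_ze: "f \<in> Hom_k \<Longrightarrow> f ze = 0"
  using Hom_kD(4)[of f ze 0] sm_0[OF ze_closed] ze_closed by simp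

definition coord :: "((nat \<Rightarrow> nat) \<Rightarrow> 'x \<Rightarrow> 'w) \<Rightarrow> 'x \<Rightarrow> (nat \<Rightarrow> nat) \<Rightarrow> (nat \<Rightarrow> nat) \<Rightarrow> 'w" where
  "coord z m i u = q ^ gauge i u \<cdot> z i (xpow X u c m)"

text \<open>The differential is read off from the coordinates at the exponent 0.  Explicitly, it is the signed sum
over \<open>l\<close> of \<open>x_l z - z x_l\<close> or \<open>\<Sum>s<a. x_l^s z x_l^(a-1-s)\<close>, with powers of \<open>q\<close>.\<close>

definition dif :: "((nat \<Rightarrow> nat) \<Rightarrow> 'x \<Rightarrow> 'w) \<Rightarrow> (nat \<Rightarrow> nat) \<Rightarrow> 'x \<Rightarrow> 'w" where
  "dif z i = (\<lambda>m. if m \<in> C then cdiff (coord z m) i (\<lambda>_. 0) else 0)"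

lemma bounded_coord: "(\<And>i. z i \<in> Hom_k) \<Longrightarrow> m \<in> C \<Longrightarrow> bounded (coord z m)"
  unfolding bounded_def coord_def by (auto simp: xpow_large Hom_k_ze)

lemma valued_coord: "(\<And>i. z i \<in> Hom_k) \<Longrightarrow> valued (coord z m)"
  unfolding valued_def coord_def using subspace_scale[OF W_subspace] Hom_kD(1) by blast

text \<open>Both ways of collecting powers of \<open>q\<close> agree: evaluating at \<open>x^u m\<close> with exponent 0, or at \<open>m\<close> with
exponent \<open>u\<close>.\<close>

lemma coord_dif_exponent:
  assumes l: "l \<in> {1..c}" and w: "wt p + t + s = wt (i l)"
  shows "gauge i u + kap l i (\<lambda>_. 0) * s + gauge (i(l := p)) ((\<lambda>_. 0)(l := t)) + t * (\<Sum>m\<in>{l<..c}. u m)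
    = kap l i u * s + gauge (i(l := p)) (u(l := u l + t))"
proof -
  have "gauge (i(l := p)) ((\<lambda>_. 0)(l := t)) = t * (\<Sum>n\<in>{l<..c}. wt (i n))"
    using gauge_upd[where i = i and u = "\<lambda>_. 0", OF l w] by simp
  moreover have "t * (\<Sum>n\<in>{l<..c}. wt (i n) + u n) = t * (\<Sum>n\<in>{l<..c}. wt (i n)) + t * (\<Sum>m\<in>{l<..c}. u m)"
    by (simp add: sum.distrib distrib_left)
  moreover have "kap l i u * s = kap l i (\<lambda>_. 0) * s + s * (\<Sum>m\<in>{1..<l}. u m)"
    by (subst kap_split) (simp add: add_mult_distrib)
  ultimately show ?thesis using gauge_upd[where i = i and u = u, OF l w] by simp
qed

text \<open>Passing to coordinates commutes with the differential.  Everything proved for coordinate families, in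
particular that the differential squares to zero, thereby holds for cochains on arbitrary modules.\<close>

lemma coord_dif:
  assumes z: "\<And>i. z i \<in> Hom_k" and m: "m \<in> C"
  shows "coord (dif z) m i u = cdiff (coord z m) i u"
proof -
  let ?m = "xpow X u c m"
  have mC: "?m \<in> C" using m by (simp add: xpow_closed)
  have "q ^ gauge i u \<cdot> dirop l diff_stencil (coord z ?m) i (\<lambda>_. 0) = dirop l diff_stencil (coord z m) i u"
    if l: "l \<in> {1..c}" for l
  proof -
    have "q ^ gauge i u \<cdot> ((r * q ^ (kap l i (\<lambda>_. 0) * s)) \<cdot> (L l ^^ s) (coord z ?m (i(l := p)) ((\<lambda>_. 0)(l := t))))
        = (r * q ^ (kap l i u * s)) \<cdot> (L l ^^ s) (coord z m (i(l := p)) (u(l := u l + t)))"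
      if "(r, s, p, t) \<in> set (diff_stencil (i l) 0)" for r s p t
    proof -
      have w: "wt p + t + s = wt (i l)" using homogD(1)[OF homog_diff that] by simp
      have "xpow X ((\<lambda>_. 0)(l := t)) c ?m = sm (q ^ (t * (\<Sum>m\<in>{l<..c}. u m))) (xpow X (u(l := u l + t)) c m)"
        using Xpow_xpow[of l c m t u] l m by (simp add: xpow_single)
      then have "coord z ?m (i(l := p)) ((\<lambda>_. 0)(l := t)) =
          (q ^ (gauge (i(l := p)) ((\<lambda>_. 0)(l := t)) + t * (\<Sum>m\<in>{l<..c}. u m))) \<cdot> z (i(l := p)) (xpow X (u(l := u l + t)) c m)"
        using Hom_kD(4)[OF z xpow_closed[OF order.refl m]] by (simp add: coord_def power_add)
      then have "q ^ gauge i u \<cdot> ((r * q ^ (kap l i (\<lambda>_. 0) * s)) \<cdot> (L l ^^ s) (coord z ?m (i(l := p)) ((\<lambda>_. 0)(l := t))))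
        = (r * q ^ (gauge i u + kap l i (\<lambda>_. 0) * s + gauge (i(l := p)) ((\<lambda>_. 0)(l := t)) + t * (\<Sum>m\<in>{l<..c}. u m)))
           \<cdot> (L l ^^ s) (z (i(l := p)) (xpow X (u(l := u l + t)) c m))"
        by (simp add: Lpow_scale power_add mult_ac)
      also have "\<dots> = (r * q ^ (kap l i u * s)) \<cdot> (L l ^^ s) (coord z m (i(l := p)) (u(l := u l + t)))"
        unfolding coord_dif_exponent[where i = i and u = u, OF l w] by (simp add: coord_def Lpow_scale power_add mult_ac)
      finally show ?thesis .
    qed
    then show ?thesis
      unfolding dirop_def diff_stencil_split[of "i l" "u l"] scale_sum_list
      by (simp add: o_def case_prod_unfold) (intro sum_list_cong, auto)
  qed
  note dirop_coord = this
  have "q ^ gauge i u \<cdot> sdirop l diff_stencil (coord z ?m) i (\<lambda>_. 0) = sdirop l diff_stencil (coord z m) i u"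
    if "l \<in> {1..c}" for l
    unfolding sdirop_def by (subst scale_left_commute) (simp only: dirop_coord[OF that])
  then show ?thesis using mC by (simp add: coord_def[of "dif z"] dif_def cdiff_def scale_sum_right)
qed

lemma dif_Hom_k:
  assumes z: "\<And>i. z i \<in> Hom_k" shows "dif z i \<in> Hom_k"
proof -
  have "coord z (pl x y) = (\<lambda>i u. coord z x i u + coord z y i u)" if "x \<in> C" "y \<in> C" for x y
    using that by (intro ext) (simp add: coord_def xpow_pl Hom_kD(3)[OF z] xpow_closed scale_right_distrib)
  moreover have "coord z (sm r x) = (\<lambda>i u. r \<cdot> coord z x i u)" if "x \<in> C" for r x
    using that by (intro ext) (simp add: coord_def xpow_sm Hom_kD(4)[OF z] xpow_closed mult.commute)
  moreover have "cdiff (coord z x) i (\<lambda>_. 0) \<in> W" for x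
    using valued_cdiff[OF valued_coord[OF z]] by (simp add: valued_def)
  ultimately show ?thesis
    by (simp add: Hom_k_def dif_def pl_closed sm_closed cdiff_add cdiff_scale)
qed

lemma dif_dif:
  assumes z: "\<And>i. z i \<in> Hom_k" shows "dif (dif z) i = 0"
proof
  fix m
  have "cdiff (coord (dif z) m) i (\<lambda>_. 0) = 0" if m: "m \<in> C"
  proof -
    have "coord (dif z) m = cdiff (coord z m)" by (intro ext coord_dif z m)
    then show ?thesis by (simp add: cdiff_cdiff[OF bounded_coord[OF z m]])
  qed
  then show "dif (dif z) i m = 0 m" by (simp add: dif_def)
qed

lemma dif_shift:
  assumes j: "j \<in> {1..c}" shows "dif (shift j z) i = shift j (dif z) i"
proof
  fix m
  have "coord (shift j z) m = (\<lambda>i u. shift j (\<lambda>i. coord z m i u) i)"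
    using q_gauge_shift[OF j] by (intro ext) (auto simp: coord_def shift_def)
  then have "cdiff (coord (shift j z) m) i (\<lambda>_. 0) = shift j (\<lambda>i. cdiff (coord z m) i (\<lambda>_. 0)) i"
    by (simp add: cdiff_shift[OF j])
  then show "dif (shift j z) i m = shift j (dif z) i m"
    by (auto simp: dif_def shift_def)
qed

lemma dif_diff: "dif (\<lambda>i. z i - y i) i = dif z i - dif y i"
proof
  fix m
  have "coord (\<lambda>i. z i - y i) m = (\<lambda>i u. coord z m i u - coord y m i u)"
    by (intro ext) (simp add: coord_def scale_right_diff_distrib)
  then show "dif (\<lambda>i. z i - y i) i m = (dif z i - dif y i) m"
    by (simp add: dif_def cdiff_diff)
qed

lemma dif_add_scale: "dif (\<lambda>i m. z i m + r \<cdot> y i m) i m = dif z i m + r \<cdot> dif y i m"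
proof -
  have "coord (\<lambda>i m. z i m + r \<cdot> y i m) m = (\<lambda>i u. coord z m i u + r \<cdot> coord y m i u)"
    by (intro ext) (simp add: coord_def scale_right_distrib mult.commute)
  then show ?thesis by (simp add: dif_def cdiff_add cdiff_scale)
qed

lemma dif_local:
  assumes "\<And>l. \<lbrakk>l \<in> {1..c}; 0 < i l\<rbrakk> \<Longrightarrow> z (i(l := i l - 1)) = y (i(l := i l - 1))"
  shows "dif z i = dif y i"
proof
  fix m
  have "cdiff (coord z m) i (\<lambda>_. 0) = cdiff (coord y m) i (\<lambda>_. 0)"
    by (rule cdiff_cong) (simp only: coord_def assms)
  then show "dif z i m = dif y i m" by (simp add: dif_def)
qed

lemma Hom_k_0: "0 \<in> Hom_k" and Hom_k_diff: "f \<in> Hom_k \<Longrightarrow> g \<in> Hom_k \<Longrightarrow> f - g \<in> Hom_k"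
  by (auto simp: Hom_k_def subspace_0[OF W_subspace] subspace_diff[OF W_subspace] scale_right_diff_distrib)

lemma Hom_k_add_scale: "f \<in> Hom_k \<Longrightarrow> g \<in> Hom_k \<Longrightarrow> (\<lambda>m. f m + r \<cdot> g m) \<in> Hom_k"
  by (auto simp: Hom_k_def subspace_add[OF W_subspace] subspace_scale[OF W_subspace] scale_right_distrib mult.commute)

sublocale periodic_complex c Hom_k dif
proof
  show "0 \<in> Hom_k" by (rule Hom_k_0)
  show "v - w \<in> Hom_k" if "v \<in> Hom_k" "w \<in> Hom_k" for v w using that by (rule Hom_k_diff)
  show "dif z i \<in> Hom_k" if "\<And>i. z i \<in> Hom_k" for z i using that by (rule dif_Hom_k)
  show "dif (\<lambda>i. z i - y i) i = dif z i - dif y i" for z y i by (rule dif_diff)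
  show "dif z i = dif y i"
    if "\<And>l. \<lbrakk>l \<in> {1..c}; 0 < i l\<rbrakk> \<Longrightarrow> z (i(l := i l - 1)) = y (i(l := i l - 1))" for z y i
    using that by (rule dif_local)
  show "dif (dif z) i = 0" if "\<And>i. z i \<in> Hom_k" for z i using that by (rule dif_dif)
  show "dif (shift j z) i = shift j (dif z) i" if "j \<in> {1..c}" for z j i using that by (rule dif_shift)
qed

abbreviation exact_at :: "nat \<Rightarrow> bool" where "exact_at \<equiv> vanish c"

lemma box_c: "box c i \<longleftrightarrow> msupp c i" by (simp add: box_def)

text \<open>Apply noetherianity to the cocycles all of whose shifts are coboundaries.  They form a
submodule \<open>T\<close>; from some degree on it is generated by shifts of its own elements, which are
coboundaries by definition.  If degree \<open>n + 2\<close> is exact, every cocycle of degree \<open>n\<close> belongs to \<open>T\<close>.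
Finite generation enters through \<open>S\<close> and \<open>co\<close>: a linear map is determined by finitely many scalars,
the coordinates of its values on \<open>S\<close>.\<close>

theorem exact_at_minus_2:
  assumes S: "finite S" "S \<subseteq> C" "\<And>f. f \<in> Hom_k \<Longrightarrow> (\<And>x. x \<in> S \<Longrightarrow> f x = 0) \<Longrightarrow> f = 0"
    and co_add: "\<And>n x y. co n (x + y) = co n x + co n y" and co_scale: "\<And>n r x. co n (r \<cdot> x) = r * co n x"
    and co_inj: "\<And>x. x \<in> W \<Longrightarrow> (\<And>n. n < (M::nat) \<Longrightarrow> co n x = 0) \<Longrightarrow> x = 0"
  shows "\<exists>m0. \<forall>n\<ge>m0. exact_at (n + 2) \<longrightarrow> exact_at n"
proof -
  have "finite (S \<times> {..<M})" using S by simp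
  then obtain N :: nat and e where e: "e ` {..<N} = S \<times> {..<M}"
    using finite_imp_nat_seg_image_inj_on[of "S \<times> {..<M}"] unfolding lessThan_def by blast
  define cob where "cob n z \<longleftrightarrow> (\<exists>y. (\<forall>i. y i \<in> Hom_k) \<and> (\<forall>i. msupp c i \<longrightarrow> mdeg c i = n \<longrightarrow> z i = dif y i))" for n z
  define T where "T n = {z. (\<forall>i. z i \<in> Hom_k) \<and> (\<forall>i. msupp c i \<longrightarrow> mdeg c i = Suc n \<longrightarrow> dif z i = 0) \<and>
     (\<forall>j\<in>{1..c}. cob (n + 2) (shift j z))}" for n
  define ev where "ev z f = (case e (f 0) of (x, k) \<Rightarrow> co k (z (f(0 := 0)) x))" for z :: "(nat \<Rightarrow> nat) \<Rightarrow> 'x \<Rightarrow> 'w" and f :: "nat \<Rightarrow> nat"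
  define cmb where "cmb z r y = (\<lambda>i m. z i m + (- r) \<cdot> y i m)" for z y :: "(nat \<Rightarrow> nat) \<Rightarrow> 'x \<Rightarrow> 'w" and r
  have co_0: "co n 0 = 0" for n using co_scale[of n 0 0] by simp
  have co_diff: "co n (x - y) = co n x - co n y" for n x y
    using co_add[of n x "(- 1) \<cdot> y"] co_scale[of n "- 1" y] by simp
  have cob_add: "cob n (\<lambda>i m. z i m + r \<cdot> y i m)" if zy: "cob n z" "cob n y" for n z y r
  proof -
    obtain z' y' where "\<And>i. z' i \<in> Hom_k" "\<And>i. y' i \<in> Hom_k"
      "\<And>i. msupp c i \<Longrightarrow> mdeg c i = n \<Longrightarrow> z i = dif z' i" "\<And>i. msupp c i \<Longrightarrow> mdeg c i = n \<Longrightarrow> y i = dif y' i"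
      using zy unfolding cob_def by blast
    then show ?thesis unfolding cob_def
      by (intro exI[of _ "\<lambda>i m. z' i m + r \<cdot> y' i m"]) (auto simp: Hom_k_add_scale dif_add_scale intro!: ext)
  qed
  have cob_shift: "cob (n + 2) (shift j z)" if z: "cob n z" and j: "j \<in> {1..c}" for n j z
  proof -
    obtain y where y: "\<And>i. y i \<in> Hom_k" "\<And>i. msupp c i \<Longrightarrow> mdeg c i = n \<Longrightarrow> z i = dif y i"
      using z unfolding cob_def by blast
    have "shift j z i = dif (shift j y) i" if "msupp c i" "mdeg c i = n + 2" for i
      using that mdeg_down[of j i] y(2)[of "i(j := i j - 2)"] j msupp_upd[OF j, of i]
      by (simp add: dif_shift[OF j]) (simp add: shift_def)
    moreover have "shift j y i \<in> Hom_k" for i by (rule shift_closed) (rule y(1))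
    ultimately show ?thesis unfolding cob_def by blast
  qed
  have cob_cong: "cob n z \<longleftrightarrow> cob n y" if "\<And>i. msupp c i \<Longrightarrow> mdeg c i = n \<Longrightarrow> z i = y i" for n z y
    using that unfolding cob_def by auto
  interpret graded_shift_module c N T ev cmb shift
  proof
    fix z y n and r :: 'k assume z: "z \<in> T n" and y: "y \<in> T n"
    define t where "t = - r"
    have cmb: "cmb z r y = (\<lambda>i m. z i m + t \<cdot> y i m)" by (simp only: cmb_def t_def)
    have "shift j (cmb z r y) = (\<lambda>i m. shift j z i m + t \<cdot> shift j y i m)" for j
      by (intro ext) (simp add: shift_def cmb)
    then have "cob (n + 2) (shift j (cmb z r y))" if "j \<in> {1..c}" for j
      using cob_add[of "n + 2" "shift j z" "shift j y" t] z y that by (simp add: T_def)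
    moreover have "dif (cmb z r y) i = 0" if "msupp c i" "mdeg c i = Suc n" for i
      using z y that unfolding cmb T_def by (intro ext) (simp add: dif_add_scale)
    moreover have "cmb z r y i \<in> Hom_k" for i using z y Hom_k_add_scale unfolding cmb T_def by blast
    ultimately show "cmb z r y \<in> T n" unfolding T_def by blast
    show "ev (cmb z r y) f = ev z f - r * ev y f" for f
      by (simp add: ev_def cmb_def case_prod_unfold co_diff co_scale)
  next
    fix z n j assume z: "z \<in> T n" and j: "j \<in> {1..c}"
    have "dif (shift j z) i = 0" if "msupp c i" "mdeg c i = Suc (n + 2)" for i
      using that z mdeg_down[of j i] j msupp_upd[OF j, of i]
      by (simp add: dif_shift[OF j]) (simp add: shift_def T_def)
    then show "shift j z \<in> T (n + 2)"
      using z j cob_shift unfolding T_def by (auto simp: shift_closed)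
    show "ev (shift j z) f = shift j (ev z) f" for f
      using j by (auto simp: ev_def shift_def case_prod_unfold fun_upd_twist co_0)
  qed
  obtain m0 where m0: "\<forall>n\<ge>m0. \<forall>B. (\<forall>j\<in>{1..c}. \<forall>y\<in>T n. shift j y \<in> B) \<longrightarrow>
     (\<forall>z\<in>T (n + 2). (\<forall>f\<in>pos (n + 2). ev z f = 0) \<longrightarrow> z \<in> B) \<longrightarrow>
     (\<forall>z\<in>T (n + 2). \<forall>y\<in>T (n + 2). \<forall>r. cmb z r y \<in> B \<longrightarrow> y \<in> B \<longrightarrow> z \<in> B) \<longrightarrow> T (n + 2) \<subseteq> B"
    by (rule exE[OF eventually_generated]) (rule that)
  have "exact_at (n + 2)" if n: "m0 \<le> n" and v: "exact_at (n + 2 + 2)" for n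
  proof -
    have T_sub: "T (n + 2) \<subseteq> Collect (cob (n + 2))"
    proof (rule m0[THEN spec, THEN mp, OF n, THEN spec, THEN mp, THEN mp, THEN mp])
      show "\<forall>j\<in>{1..c}. \<forall>y\<in>T n. shift j y \<in> Collect (cob (n + 2))" by (auto simp: T_def)
      show "\<forall>z\<in>T (n + 2). (\<forall>f\<in>pos (n + 2). ev z f = 0) \<longrightarrow> z \<in> Collect (cob (n + 2))"
      proof (intro ballI impI CollectI)
        fix z assume z: "z \<in> T (n + 2)" "\<forall>f\<in>pos (n + 2). ev z f = 0"
        have "z i = 0" if i: "msupp c i" "mdeg c i = n + 2" for i
        proof (rule S(3))
          show zi: "z i \<in> Hom_k" using z by (simp add: T_def)
          fix x assume x: "x \<in> S"
          show "z i x = 0"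
          proof (rule co_inj)
            fix k assume "k < M"
            then have "(x, k) \<in> e ` {..<N}" using x e by auto
            then obtain p where p: "p < N" "e p = (x, k)" by auto
            have "i(0 := p, 0 := 0) = i" using i by (auto simp: msupp_def)
            moreover have "i(0 := p) \<in> pos (n + 2)"
              using i p by (auto simp: pos_def msupp_def mdeg_def)
            ultimately have "i(0 := p, 0 := 0) = i" "ev z (i(0 := p)) = 0" using z(2) by blast+
            then show "co k (z i x) = 0" using p by (simp add: ev_def)
          qed (use Hom_kD(1)[OF zi] in auto)
        qed
        moreover have "cob (n + 2) (\<lambda>_. 0)"
          unfolding cob_def by (intro exI[of _ "\<lambda>_. 0"]) (use Hom_k_0 dif_diff[of "\<lambda>_. 0" "\<lambda>_. 0"] in simp)
        ultimately show "cob (n + 2) z" using cob_cong[of "n + 2" z "\<lambda>_. 0"] by simp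
      qed
      show "\<forall>z\<in>T (n + 2). \<forall>y\<in>T (n + 2). \<forall>r. cmb z r y \<in> Collect (cob (n + 2)) \<longrightarrow>
          y \<in> Collect (cob (n + 2)) \<longrightarrow> z \<in> Collect (cob (n + 2))"
      proof (intro ballI allI impI CollectI)
        fix z y r assume "cmb z r y \<in> Collect (cob (n + 2))" "y \<in> Collect (cob (n + 2))"
        then have "cob (n + 2) (\<lambda>i m. cmb z r y i m + r \<cdot> y i m)" by (intro cob_add) auto
        moreover have "(\<lambda>i m. cmb z r y i m + r \<cdot> y i m) = z" by (intro ext) (simp add: cmb_def)
        ultimately show "cob (n + 2) z" by simp
      qed
    qed
    show ?thesis unfolding vanish_def box_c
    proof (intro allI impI)
      fix z assume z: "\<forall>i. z i \<in> Hom_k" "\<forall>i. msupp c i \<longrightarrow> mdeg c i = Suc (n + 2) \<longrightarrow> dif z i = 0"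
      have "cob (n + 2 + 2) (shift j z)" if j: "j \<in> {1..c}" for j
      proof -
        have "dif (shift j z) i = 0" if "msupp c i" "mdeg c i = Suc (n + 2 + 2)" for i
          using that z mdeg_down[of j i] j msupp_upd[OF j, of i]
          by (simp add: dif_shift[OF j]) (simp add: shift_def)
        moreover have "\<forall>i. shift j z i \<in> Hom_k" by (intro allI shift_closed) (use z(1) in blast)
        ultimately show ?thesis using v unfolding vanish_def box_c cob_def by blast
      qed
      then have "z \<in> T (n + 2)" using z by (simp add: T_def)
      then have "cob (n + 2) z" using T_sub by auto
      then show "\<exists>y. (\<forall>i. y i \<in> Hom_k) \<and> (\<forall>i. msupp c i \<longrightarrow> mdeg c i = n + 2 \<longrightarrow> z i = dif y i)"
        unfolding cob_def .
    qed
  qed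
  note step = this
  have "exact_at n" if h: "m0 + 2 \<le> n" "exact_at (n + 2)" for n
  proof -
    obtain k where "n = m0 + 2 + k" using le_Suc_ex[OF h(1)] by blast
    then have n: "n = m0 + k + 2" by simp
    show ?thesis using step[of "m0 + k"] h(2) unfolding n by simp
  qed
  then show ?thesis by blast
qed

text \<open>If neither parity is eventually nonexact, then arbitrarily large exact degrees of both parities
propagate downwards in steps of 2, so all large degrees are exact, and hence all positive ones.\<close>

theorem exact_at_trichotomy:
  assumes "\<exists>m0. \<forall>n\<ge>m0. exact_at (n + 2) \<longrightarrow> exact_at n"
  shows "(\<forall>n>0. exact_at n) \<or>
    (\<exists>m0. (\<forall>n\<ge>m0. even n \<longrightarrow> \<not> exact_at n) \<or> (\<forall>n\<ge>m0. odd n \<longrightarrow> \<not> exact_at n))"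
proof (rule disjCI)
  assume no: "\<not> (\<exists>m0. (\<forall>n\<ge>m0. even n \<longrightarrow> \<not> exact_at n) \<or> (\<forall>n\<ge>m0. odd n \<longrightarrow> \<not> exact_at n))"
  obtain m0 where m0: "\<And>n. m0 \<le> n \<Longrightarrow> exact_at (n + 2) \<Longrightarrow> exact_at n" using assms by blast
  have down: "exact_at n" if "m0 \<le> n" "exact_at (n + 2 * k)" for n k
    using that
  proof (induction k)
    case (Suc k)
    then show ?case using m0[of "n + 2 * k"] by simp
  qed simp
  have "exact_at n" if n: "m0 \<le> n" for n
  proof -
    have "\<exists>n'\<ge>n. (even n' \<longleftrightarrow> even n) \<and> exact_at n'"
    proof (rule ccontr)
      assume c: "\<not> ?thesis"
      show False
      proof (cases "even n")
        case True
        then have "\<forall>n'\<ge>n. even n' \<longrightarrow> \<not> exact_at n'" using c by blast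
        then show False using no by blast
      next
        case False
        then have "\<forall>n'\<ge>n. odd n' \<longrightarrow> \<not> exact_at n'" using c by blast
        then show False using no by blast
      qed
    qed
    then obtain n' where n': "n \<le> n'" "even n' \<longleftrightarrow> even n" "exact_at n'" by blast
    have "even (n' - n)" using n'(1,2) by simp
    then obtain k where "n' - n = 2 * k" by (rule evenE)
    then have "n' = n + 2 * k" using n'(1) by simp
    then show ?thesis using down n n'(3) by simp
  qed
  then show "\<forall>n>0. exact_at n" using eventually_vanish_imp_vanish[of m0] by simp
qed

end

section \<open>Short exact sequences of modules\<close>

context cochains begin

definition Hom_A :: "('x \<Rightarrow> 'w) set" where
  "Hom_A = {f \<in> Hom_k. \<forall>l\<in>{1..c}. \<forall>x\<in>C. f (X l x) = L l (f x)}"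

lemma dif_degree_1:
  assumes l: "l \<in> {1..c}" and m: "m \<in> C"
  shows "dif z ((\<lambda>_. 0)(l := 1)) m = L l (z (\<lambda>_. 0) m) - z (\<lambda>_. 0) (X l m)"
proof -
  let ?i = "(\<lambda>_. 0)(l := 1 :: nat)"
  have d: "diff_stencil 0 v = []" "diff_stencil 1 v = [(1, 1, 0, v), (- 1, 0, 0, Suc v)]" for v
    by (simp_all add: diff_stencil_def)
  have "sdirop l' diff_stencil (coord z m) ?i (\<lambda>_. 0) =
      (if l' = l then dirop l diff_stencil (coord z m) ?i (\<lambda>_. 0) else 0)" for l'
  proof (cases "l' = l")
    case True
    have "sgn_at l ?i = 1" by (simp add: sgn_at_def)
    then show ?thesis using True by (simp add: sdirop_def)
  next
    case False
    then show ?thesis by (simp add: sdirop_def dirop_def d)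
  qed
  then have "dif z ?i m = dirop l diff_stencil (coord z m) ?i (\<lambda>_. 0)"
    using l m by (simp add: dif_def cdiff_def)
  also have "\<dots> = L l (z (\<lambda>_. 0) m) - z (\<lambda>_. 0) (X l m)"
  proof -
    have k: "kap l ?i (\<lambda>_. 0) = 0" by (simp add: kap_def wt_def)
    have "wt 0 + 1 + 0 = wt (?i l)" by (simp add: wt_def)
    have u: "(\<lambda>_. 0)(l := 0) = (\<lambda>_. 0 :: nat)" by auto
    from gauge_upd[where i = ?i and u = "\<lambda>_. 0", OF l \<open>wt 0 + 1 + 0 = wt (?i l)\<close>]
    have g: "gauge (\<lambda>_. 0) ((\<lambda>_. 0)(l := 1)) = 0" unfolding fun_upd_upd u by (simp add: wt_def)
    have "dirop l diff_stencil (coord z m) ?i (\<lambda>_. 0) =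
       L l (coord z m (\<lambda>_. 0) (\<lambda>_. 0)) - coord z m (\<lambda>_. 0) ((\<lambda>_. 0)(l := 1))"
      unfolding dirop_def k fun_upd_same d by (simp add: u)
    also have "\<dots> = L l (z (\<lambda>_. 0) m) - z (\<lambda>_. 0) (X l m)"
      unfolding coord_def g using l by (simp add: xpow_zero xpow_single)
    finally show ?thesis .
  qed
  finally show ?thesis .
qed

lemma degree_1_cases:
  assumes "msupp c i" "mdeg c i = 1" obtains l where "l \<in> {1..c}" "i = (\<lambda>_. 0)(l := 1)"
proof -
  obtain l where l: "l \<in> {1..c}" "i l \<noteq> 0"
    using assms(2) unfolding mdeg_def by (metis sum.neutral zero_neq_one)
  have s: "mdeg c i = i l + (\<Sum>m\<in>{1..c}-{l}. i m)" unfolding mdeg_def using l(1) by (simp add: sum.remove)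
  have "(\<Sum>m\<in>{1..c}-{l}. i m) = 0" "i l = 1" using s assms(2) l(2) by linarith+
  then have "\<forall>m\<in>{1..c}-{l}. i m = 0" "i l = 1" by simp_all
  then have "i m = ((\<lambda>_. 0)(l := 1)) m" for m
    using assms(1) by (cases "m \<in> {1..c}") (auto simp: msupp_def)
  then show ?thesis using that l(1) by blast
qed

text \<open>In degree 0 the cocycles are the module homomorphisms: the differential into the index of \<open>x_l\<close> is
\<open>x_l z - z x_l\<close>.\<close>

lemma cocycle_0:
  assumes "\<And>i. z i \<in> Hom_k"
  shows "(\<forall>i. msupp c i \<longrightarrow> mdeg c i = Suc 0 \<longrightarrow> dif z i = 0) \<longleftrightarrow> z (\<lambda>_. 0) \<in> Hom_A"
proof
  assume h: "\<forall>i. msupp c i \<longrightarrow> mdeg c i = Suc 0 \<longrightarrow> dif z i = 0"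
  have "z (\<lambda>_. 0) (X l x) = L l (z (\<lambda>_. 0) x)" if l: "l \<in> {1..c}" and x: "x \<in> C" for l x
  proof -
    have "msupp c ((\<lambda>_. 0)(l := 1))" using l by (auto simp: msupp_def)
    moreover have "mdeg c ((\<lambda>_. 0)(l := 1)) = Suc 0" using mdeg_upd[OF l, of "\<lambda>_. 0" 1] by (simp add: mdeg_def)
    ultimately have "dif z ((\<lambda>_. 0)(l := 1)) = 0" using h by blast
    then show ?thesis using dif_degree_1[OF l x, of z] by simp
  qed
  then show "z (\<lambda>_. 0) \<in> Hom_A" using assms by (simp add: Hom_A_def)
next
  assume h: "z (\<lambda>_. 0) \<in> Hom_A"
  show "\<forall>i. msupp c i \<longrightarrow> mdeg c i = Suc 0 \<longrightarrow> dif z i = 0"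
  proof (intro allI impI)
    fix i assume "msupp c i" "mdeg c i = Suc 0"
    then obtain l where l: "l \<in> {1..c}" "i = (\<lambda>_. 0)(l := 1)" using degree_1_cases[of i] by auto
    show "dif z i = 0"
    proof
      fix m
      show "dif z i m = 0 m"
      proof (cases "m \<in> C")
        case True
        then show ?thesis using dif_degree_1[OF l(1) True, of z] h l by (simp add: Hom_A_def)
      next
        case False
        then show ?thesis by (simp add: dif_def)
      qed
    qed
  qed
qed

end

locale cochain_map = A: cochains sc c a q L W C pl ze sm X + B: cochains sc c a q L W C' pl' ze' sm' X'
  for sc :: "'k::field \<Rightarrow> 'w::ab_group_add \<Rightarrow> 'w" (infixr "\<cdot>" 75)
    and c a :: nat and q :: 'k and L :: "nat \<Rightarrow> 'w \<Rightarrow> 'w" and W :: "'w set"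
    and C :: "'x set" and pl ze sm X and C' :: "'y set" and pl' ze' sm' X' +
  fixes p :: "'x \<Rightarrow> 'y"
  assumes p_closed: "x \<in> C \<Longrightarrow> p x \<in> C'"
    and p_pl: "\<lbrakk>x \<in> C; y \<in> C\<rbrakk> \<Longrightarrow> p (pl x y) = pl' (p x) (p y)"
    and p_sm: "x \<in> C \<Longrightarrow> p (sm r x) = sm' r (p x)"
    and p_X: "\<lbrakk>l \<in> {1..c}; x \<in> C\<rbrakk> \<Longrightarrow> p (X l x) = X' l (p x)"
begin

definition pull :: "('y \<Rightarrow> 'w) \<Rightarrow> 'x \<Rightarrow> 'w" where
  "pull f = (\<lambda>x. if x \<in> C then f (p x) else 0)"

lemma pull_Hom_k: "f \<in> B.Hom_k \<Longrightarrow> pull f \<in> A.Hom_k"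
  by (auto simp: A.Hom_k_def B.Hom_k_def pull_def p_closed p_pl p_sm A.pl_closed A.sm_closed)

lemma p_Xpow: "l \<in> {1..c} \<Longrightarrow> x \<in> C \<Longrightarrow> p ((X l ^^ t) x) = (X' l ^^ t) (p x)"
  by (induction t) (auto simp: p_X A.Xpow_closed)

lemma p_xpow: "n \<le> c \<Longrightarrow> x \<in> C \<Longrightarrow> p (xpow X u n x) = xpow X' u n (p x)"
  by (induction n) (auto simp: p_Xpow A.xpow_closed)

lemma dif_pull: "A.dif (\<lambda>i. pull (z i)) i = pull (B.dif z i)"
proof
  fix m
  have "A.coord (\<lambda>i. pull (z i)) m = B.coord z (p m)" if "m \<in> C"
    using that by (intro ext) (simp add: A.coord_def B.coord_def pull_def A.xpow_closed p_xpow)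
  then show "A.dif (\<lambda>i. pull (z i)) i m = pull (B.dif z i) m"
    by (simp add: A.dif_def B.dif_def pull_def p_closed)
qed

end

text \<open>A short exact sequence \<open>0 \<rightarrow> K \<rightarrow> F \<rightarrow> Q \<rightarrow> 0\<close>, where \<open>C\<close> is the carrier of \<open>F\<close> and \<open>C'\<close> that of \<open>Q\<close>,
with a \<open>k\<close>-linear splitting \<open>\<pi>\<close>.  The splitting makes every \<open>k\<close>-linear map on \<open>K\<close> extend to \<open>F\<close>, so that
the sequence of complexes \<open>0 \<rightarrow> C(Q) \<rightarrow> C(F) \<rightarrow> C(K) \<rightarrow> 0\<close> is exact.\<close>

locale ses = cochain_map sc c a q L W C pl ze sm X C' pl' ze' sm' X' p
  for sc :: "'k::field \<Rightarrow> 'w::ab_group_add \<Rightarrow> 'w" (infixr "\<cdot>" 75)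
    and c a :: nat and q :: 'k and L :: "nat \<Rightarrow> 'w \<Rightarrow> 'w" and W :: "'w set"
    and C :: "'x set" and pl ze sm X and C' :: "'y set" and pl' ze' sm' X' and p +
  fixes K :: "'x set" and \<pi> :: "'x \<Rightarrow> 'x"
  assumes p_surj: "p ` C = C'" and K_def: "K = {x \<in> C. p x = ze'}"
    and \<pi>_closed: "x \<in> C \<Longrightarrow> \<pi> x \<in> K" and \<pi>_id: "x \<in> K \<Longrightarrow> \<pi> x = x"
    and \<pi>_pl: "\<lbrakk>x \<in> C; y \<in> C\<rbrakk> \<Longrightarrow> \<pi> (pl x y) = pl (\<pi> x) (\<pi> y)"
    and \<pi>_sm: "x \<in> C \<Longrightarrow> \<pi> (sm r x) = sm r (\<pi> x)"
begin

lemma p_ze: "p ze = ze'"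
  using p_sm[OF A.ze_closed, of 0] A.sm_0[OF A.ze_closed] B.sm_0[OF p_closed[OF A.ze_closed]] by simp

lemma K_qrep: "qrep c a q K pl ze sm X"
proof
  have ze': "pl' ze' ze' = ze'" "sm' r ze' = ze'" for r
    using B.pl_minus[OF B.ze_closed] B.sm_sm[OF B.ze_closed, of r 0] B.sm_sm[OF B.ze_closed, of "-1" 0]
      B.sm_0[OF B.ze_closed] by simp_all
  show "pl x y \<in> K" if "x \<in> K" "y \<in> K" for x y
    using that ze' by (auto simp: K_def A.pl_closed p_pl)
  show "ze \<in> K" by (simp add: K_def A.ze_closed p_ze)
  show "sm r x \<in> K" if "x \<in> K" for x r using that ze' by (auto simp: K_def A.sm_closed p_sm)
  show "X l x \<in> K" if "l \<in> {1..c}" "x \<in> K" for x l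
    using that by (auto simp: K_def A.X_closed p_X B.X_ze)
qed (simp_all add: K_def A.sm_0 A.sm_1 A.pl_minus A.sm_sm A.sm_pl A.X_pl A.X_sm A.X_q_commute A.X_nilpotent)

sublocale K: cochains sc c a q L W K pl ze sm X
  by (intro cochains.intro K_qrep A.quantum_operators_axioms)

lemma K_sub: "x \<in> K \<Longrightarrow> x \<in> C" by (simp add: K_def)

sublocale incl: cochain_map sc c a q L W K pl ze sm X C pl ze sm X "\<lambda>x. x"
  by unfold_locales (simp_all add: K_sub)

abbreviation restr :: "('x \<Rightarrow> 'w) \<Rightarrow> 'x \<Rightarrow> 'w" where "restr \<equiv> incl.pull"

definition ext :: "('x \<Rightarrow> 'w) \<Rightarrow> 'x \<Rightarrow> 'w" where "ext f = (\<lambda>x. if x \<in> C then f (\<pi> x) else 0)"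

lemma ext_Hom_k: "f \<in> K.Hom_k \<Longrightarrow> ext f \<in> A.Hom_k"
  by (auto simp: A.Hom_k_def K.Hom_k_def ext_def \<pi>_closed \<pi>_pl \<pi>_sm A.pl_closed A.sm_closed)

lemma restr_ext: "f \<in> K.Hom_k \<Longrightarrow> restr (ext f) = f"
  by (intro HOL.ext) (auto simp: incl.pull_def ext_def K_sub \<pi>_id K.Hom_k_def)

lemma factor:
  assumes w: "w \<in> A.Hom_k" and z: "\<And>x. x \<in> K \<Longrightarrow> w x = 0"
  shows "\<exists>v\<in>B.Hom_k. w = pull v"
proof -
  have wd: "w x = w y" if "x \<in> C" "y \<in> C" "p x = p y" for x y
  proof -
    have "pl x (sm (- 1) y) \<in> K"
      using that B.pl_minus[OF p_closed[OF that(2)]] by (simp add: K_def A.pl_closed A.sm_closed p_pl p_sm)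
    from z[OF this] have "w x + (- 1) \<cdot> w y = 0"
      using A.Hom_kD(3)[OF w that(1) A.sm_closed[OF that(2)]] A.Hom_kD(4)[OF w that(2)] by simp
    then show ?thesis by simp
  qed
  define s where "s y = (SOME x. x \<in> C \<and> p x = y)" for y
  have s: "s y \<in> C" "p (s y) = y" if "y \<in> C'" for y
  proof -
    have "\<exists>x. x \<in> C \<and> p x = y" using p_surj that by auto
    from someI_ex[OF this] show "s y \<in> C" "p (s y) = y" unfolding s_def by simp_all
  qed
  define v where "v = (\<lambda>y. if y \<in> C' then w (s y) else 0)"
  have vp: "v (p x) = w x" if "x \<in> C" for x
    using wd[OF s(1)[OF p_closed[OF that]] that s(2)[OF p_closed[OF that]]] p_closed[OF that] by (simp add: v_def)
  have "v \<in> B.Hom_k" unfolding B.Hom_k_def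
  proof (intro CollectI conjI ballI allI impI)
    fix y assume y: "y \<in> C'"
    show "v y \<in> W" using y A.Hom_kD(1)[OF w] by (simp add: v_def)
    show "v (sm' r y) = r \<cdot> v y" for r
      using vp[OF s(1)[OF y]] vp[OF A.sm_closed[OF s(1)[OF y]]] s(2)[OF y] A.Hom_kD(4)[OF w s(1)[OF y]] p_sm[OF s(1)[OF y]] by simp
    fix y' assume y': "y' \<in> C'"
    show "v (pl' y y') = v y + v y'"
      using vp[OF s(1)[OF y]] vp[OF s(1)[OF y']] vp[OF A.pl_closed[OF s(1)[OF y] s(1)[OF y']]] s(2)[OF y] s(2)[OF y']
        A.Hom_kD(3)[OF w s(1)[OF y] s(1)[OF y']] p_pl[OF s(1)[OF y] s(1)[OF y']] by simp
  qed (simp add: v_def)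
  moreover have "w = pull v"
    using A.Hom_kD(2)[OF w] by (intro HOL.ext) (simp add: pull_def vp)
  ultimately show ?thesis by blast
qed

lemma factor_family:
  assumes "\<And>i. w i \<in> A.Hom_k" "\<And>i x. msupp c i \<Longrightarrow> mdeg c i = n \<Longrightarrow> x \<in> K \<Longrightarrow> w i x = 0"
  obtains v where "\<And>i. v i \<in> B.Hom_k" "\<And>i. msupp c i \<Longrightarrow> mdeg c i = n \<Longrightarrow> w i = pull (v i)"
proof -
  have "\<exists>v. v \<in> B.Hom_k \<and> (msupp c i \<longrightarrow> mdeg c i = n \<longrightarrow> w i = pull v)" for i
    using factor[OF assms(1)[of i]] assms(2)[of i] B.Hom_k_0 by blast
  then have "\<forall>i. \<exists>v. v \<in> B.Hom_k \<and> (msupp c i \<longrightarrow> mdeg c i = n \<longrightarrow> w i = pull v)" by blast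
  from choice[OF this] show ?thesis using that by blast
qed

lemma pull_inj: "f \<in> B.Hom_k \<Longrightarrow> g \<in> B.Hom_k \<Longrightarrow> pull f = pull g \<Longrightarrow> f = g"
proof
  fix y assume f: "f \<in> B.Hom_k" "g \<in> B.Hom_k" "pull f = pull g"
  show "f y = g y"
  proof (cases "y \<in> C'")
    case True
    then obtain x where "x \<in> C" "y = p x" using p_surj by auto
    then show ?thesis using fun_cong[OF f(3), of x] by (simp add: pull_def)
  next
    case False
    then show ?thesis using B.Hom_kD(2)[OF f(1)] B.Hom_kD(2)[OF f(2)] by simp
  qed
qed

lemma dif_cong_degree:
  assumes "msupp c i" "mdeg c i = Suc n" "\<And>i. msupp c i \<Longrightarrow> mdeg c i = n \<Longrightarrow> z i = y i"
  shows "A.dif z i = A.dif y i"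
  using A.d_box_cong[of c i n z y] assms by (simp add: A.box_c)

text \<open>Surjectivity of \<open>Z^n(C(F)) \<rightarrow> Z^n(C(K))\<close>.  For \<open>F\<close> acyclic this is equivalent both to exactness of \<open>C(Q)\<close> in
degree \<open>n + 1\<close> and, for \<open>n > 0\<close>, to exactness of \<open>C(K)\<close> in degree \<open>n\<close>; the four lemmas that follow
are the parts of this diagram chase.\<close>

definition lifts :: "nat \<Rightarrow> bool" where
  "lifts n \<longleftrightarrow> (\<forall>z. (\<forall>i. z i \<in> K.Hom_k) \<longrightarrow> (\<forall>i. msupp c i \<longrightarrow> mdeg c i = Suc n \<longrightarrow> K.dif z i = 0) \<longrightarrow>
     (\<exists>s. (\<forall>i. s i \<in> A.Hom_k) \<and> (\<forall>i. msupp c i \<longrightarrow> mdeg c i = Suc n \<longrightarrow> A.dif s i = 0) \<and>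
       (\<forall>i. msupp c i \<longrightarrow> mdeg c i = n \<longrightarrow> restr (s i) = z i)))"

lemma exact_quotient_imp_lifts:
  assumes v: "B.exact_at (Suc n)" shows "lifts n"
  unfolding lifts_def
proof (intro allI impI)
  fix z assume z: "\<forall>i. z i \<in> K.Hom_k" "\<forall>i. msupp c i \<longrightarrow> mdeg c i = Suc n \<longrightarrow> K.dif z i = 0"
  define e where "e i = ext (z i)" for i
  have e: "e i \<in> A.Hom_k" for i using z by (simp add: e_def ext_Hom_k)
  have re: "restr (e i) = z i" for i using z by (simp add: e_def restr_ext)
  have "A.dif e i x = 0" if "msupp c i" "mdeg c i = Suc n" "x \<in> K" for i x
  proof -
    have "restr (A.dif e i) = 0" using incl.dif_pull[of e i] z(2) that by (simp add: re)
    then have "restr (A.dif e i) x = 0" by simp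
    then show ?thesis using that(3) by (simp add: incl.pull_def)
  qed
  then obtain w where w: "\<And>i. w i \<in> B.Hom_k" "\<And>i. msupp c i \<Longrightarrow> mdeg c i = Suc n \<Longrightarrow> A.dif e i = pull (w i)"
    by (rule factor_family[OF A.dif_Hom_k[OF e]]) blast+
  have "B.dif w i = 0" if "msupp c i" "mdeg c i = Suc (Suc n)" for i
  proof (rule pull_inj)
    have "pull (B.dif w i) = A.dif (A.dif e) i"
      unfolding dif_pull[symmetric] using that by (rule dif_cong_degree) (simp add: w(2))
    then show "pull (B.dif w i) = pull 0" by (simp add: A.dif_dif[OF e]) (simp add: pull_def fun_eq_iff)
  qed (simp_all add: B.dif_Hom_k w B.Hom_k_0)
  then obtain y where y: "\<And>i. y i \<in> B.Hom_k" "\<And>i. msupp c i \<Longrightarrow> mdeg c i = Suc n \<Longrightarrow> w i = B.dif y i"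
    using v w(1) unfolding B.vanish_def B.box_c by blast
  define s where "s = (\<lambda>i. e i - pull (y i))"
  have "s i \<in> A.Hom_k" for i by (simp add: s_def A.Hom_k_diff e pull_Hom_k y)
  moreover have "A.dif s i = 0" if "msupp c i" "mdeg c i = Suc n" for i
    using w(2)[OF that] y(2)[OF that] by (simp add: s_def A.dif_diff dif_pull)
  moreover have "restr (s i) = z i" for i
  proof
    fix x
    have "x \<in> K \<Longrightarrow> pull (y i) x = 0" by (simp add: pull_def K_def B.Hom_k_ze y)
    then show "restr (s i) x = z i x"
      using fun_cong[OF re[of i], of x] by (auto simp: incl.pull_def s_def)
  qed
  ultimately show "\<exists>s. (\<forall>i. s i \<in> A.Hom_k) \<and> (\<forall>i. msupp c i \<longrightarrow> mdeg c i = Suc n \<longrightarrow> A.dif s i = 0) \<and>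
       (\<forall>i. msupp c i \<longrightarrow> mdeg c i = n \<longrightarrow> restr (s i) = z i)" by blast
qed

lemma lifts_imp_exact_quotient:
  assumes l: "lifts n" and F: "A.exact_at (Suc n)" shows "B.exact_at (Suc n)"
  unfolding B.vanish_def B.box_c
proof (intro allI impI)
  fix z assume z: "\<forall>i. z i \<in> B.Hom_k" "\<forall>i. msupp c i \<longrightarrow> mdeg c i = Suc (Suc n) \<longrightarrow> B.dif z i = 0"
  have "A.dif (\<lambda>i. pull (z i)) i = 0" if "msupp c i" "mdeg c i = Suc (Suc n)" for i
    using z(2) that unfolding dif_pull by (simp add: pull_def fun_eq_iff)
  moreover have "\<forall>i. pull (z i) \<in> A.Hom_k" using z by (simp add: pull_Hom_k)
  ultimately have "\<exists>y. (\<forall>i. y i \<in> A.Hom_k) \<and> (\<forall>i. msupp c i \<longrightarrow> mdeg c i = Suc n \<longrightarrow> pull (z i) = A.dif y i)"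
    using F[unfolded A.vanish_def A.box_c, THEN spec, of "\<lambda>i. pull (z i)"] by blast
  then obtain y where y: "\<And>i. y i \<in> A.Hom_k" "\<And>i. msupp c i \<Longrightarrow> mdeg c i = Suc n \<Longrightarrow> pull (z i) = A.dif y i"
    by blast
  have "K.dif (\<lambda>i. restr (y i)) i = 0" if "msupp c i" "mdeg c i = Suc n" for i
    unfolding incl.dif_pull
  proof
    fix x
    have "z i \<in> B.Hom_k" using z(1) by blast
    then have "pull (z i) x = 0" if "x \<in> K" using that by (simp add: pull_def K_def B.Hom_k_ze)
    then show "restr (A.dif y i) x = 0 x" using y(2)[OF that] by (simp add: incl.pull_def)
  qed
  moreover have "\<forall>i. restr (y i) \<in> K.Hom_k" using y by (simp add: incl.pull_Hom_k)
  ultimately have "\<exists>s. (\<forall>i. s i \<in> A.Hom_k) \<and> (\<forall>i. msupp c i \<longrightarrow> mdeg c i = Suc n \<longrightarrow> A.dif s i = 0) \<and>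
     (\<forall>i. msupp c i \<longrightarrow> mdeg c i = n \<longrightarrow> restr (s i) = restr (y i))"
    using l[unfolded lifts_def, THEN spec, of "\<lambda>i. restr (y i)"] by blast
  then obtain s where s: "\<And>i. s i \<in> A.Hom_k" "\<And>i. msupp c i \<Longrightarrow> mdeg c i = Suc n \<Longrightarrow> A.dif s i = 0"
    "\<And>i. msupp c i \<Longrightarrow> mdeg c i = n \<Longrightarrow> restr (s i) = restr (y i)" by blast
  have ysH: "y i - s i \<in> A.Hom_k" for i by (intro A.Hom_k_diff y s)
  have "(y i - s i) x = 0" if "msupp c i" "mdeg c i = n" "x \<in> K" for i x
    using fun_cong[OF s(3)[OF that(1,2)], of x] that(3) by (simp add: incl.pull_def)
  then obtain v where v: "\<And>i. v i \<in> B.Hom_k" "\<And>i. msupp c i \<Longrightarrow> mdeg c i = n \<Longrightarrow> y i - s i = pull (v i)"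
    by (rule factor_family[OF ysH]) blast+
  have "z i = B.dif v i" if i: "msupp c i" "mdeg c i = Suc n" for i
  proof (rule pull_inj)
    have "pull (B.dif v i) = A.dif (\<lambda>i. y i - s i) i"
      unfolding dif_pull[symmetric] using i by (rule dif_cong_degree) (simp add: v(2))
    then show "pull (z i) = pull (B.dif v i)" using y(2)[OF i] s(2)[OF i] by (simp add: A.dif_diff)
  qed (use z v in \<open>simp_all add: B.dif_Hom_k\<close>)
  with v(1) show "\<exists>y. (\<forall>i. y i \<in> B.Hom_k) \<and> (\<forall>i. msupp c i \<longrightarrow> mdeg c i = Suc n \<longrightarrow> z i = B.dif y i)" by blast
qed

lemma exact_sub_imp_lifts:
  assumes v: "K.exact_at n" shows "lifts n"
  unfolding lifts_def
proof (intro allI impI)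
  fix z assume z: "\<forall>i. z i \<in> K.Hom_k" "\<forall>i. msupp c i \<longrightarrow> mdeg c i = Suc n \<longrightarrow> K.dif z i = 0"
  then obtain t where t: "\<And>i. t i \<in> K.Hom_k" "\<And>i. msupp c i \<Longrightarrow> mdeg c i = n \<Longrightarrow> z i = K.dif t i"
    using v unfolding K.vanish_def K.box_c by blast
  let ?t = "\<lambda>i. ext (t i)"
  have tH: "?t i \<in> A.Hom_k" for i by (simp add: ext_Hom_k t)
  have "restr (A.dif ?t i) = z i" if "msupp c i" "mdeg c i = n" for i
    using t(2)[OF that] incl.dif_pull[of ?t i] by (simp add: restr_ext t(1))
  then show "\<exists>s. (\<forall>i. s i \<in> A.Hom_k) \<and> (\<forall>i. msupp c i \<longrightarrow> mdeg c i = Suc n \<longrightarrow> A.dif s i = 0) \<and>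
       (\<forall>i. msupp c i \<longrightarrow> mdeg c i = n \<longrightarrow> restr (s i) = z i)"
    by (intro exI[of _ "A.dif ?t"]) (simp add: A.dif_Hom_k A.dif_dif tH)
qed

lemma lifts_imp_exact_sub:
  assumes l: "lifts n" and F: "A.exact_at n" shows "K.exact_at n"
  unfolding K.vanish_def K.box_c
proof (intro allI impI)
  fix z assume z: "\<forall>i. z i \<in> K.Hom_k" "\<forall>i. msupp c i \<longrightarrow> mdeg c i = Suc n \<longrightarrow> K.dif z i = 0"
  then obtain s where s: "\<forall>i. s i \<in> A.Hom_k" "\<forall>i. msupp c i \<longrightarrow> mdeg c i = Suc n \<longrightarrow> A.dif s i = 0"
    "\<And>i. msupp c i \<Longrightarrow> mdeg c i = n \<Longrightarrow> restr (s i) = z i"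
    using l unfolding lifts_def by blast
  then obtain y where y: "\<And>i. y i \<in> A.Hom_k" "\<And>i. msupp c i \<Longrightarrow> mdeg c i = n \<Longrightarrow> s i = A.dif y i"
    using F unfolding A.vanish_def A.box_c by blast
  have "z i = K.dif (\<lambda>i. restr (y i)) i" if "msupp c i" "mdeg c i = n" for i
    using s(3)[OF that] y(2)[OF that] incl.dif_pull[of y i] by simp
  then show "\<exists>y. (\<forall>i. y i \<in> K.Hom_k) \<and> (\<forall>i. msupp c i \<longrightarrow> mdeg c i = n \<longrightarrow> z i = K.dif y i)"
    by (intro exI[of _ "\<lambda>i. restr (y i)"]) (simp add: incl.pull_Hom_k y)
qed

text \<open>For \<open>n = 0\<close> the cocycles are homomorphisms.\<close>

lemma lifts_0: "lifts 0 \<longleftrightarrow> (\<forall>f\<in>K.Hom_A. \<exists>g\<in>A.Hom_A. restr g = f)"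
proof
  assume l: "lifts 0"
  show "\<forall>f\<in>K.Hom_A. \<exists>g\<in>A.Hom_A. restr g = f"
  proof
    fix f assume f: "f \<in> K.Hom_A"
    have fH: "\<And>i. (\<lambda>_::nat \<Rightarrow> nat. f) i \<in> K.Hom_k" using f by (simp add: K.Hom_A_def)
    have "\<forall>i. msupp c i \<longrightarrow> mdeg c i = Suc 0 \<longrightarrow> K.dif (\<lambda>_. f) i = 0"
      using K.cocycle_0[OF fH] f by simp
    then have "\<exists>s. (\<forall>i. s i \<in> A.Hom_k) \<and> (\<forall>i. msupp c i \<longrightarrow> mdeg c i = Suc 0 \<longrightarrow> A.dif s i = 0) \<and>
       (\<forall>i. msupp c i \<longrightarrow> mdeg c i = 0 \<longrightarrow> restr (s i) = f)"
      using l[unfolded lifts_def, THEN spec, of "\<lambda>_. f"] fH by blast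
    then obtain s where s: "\<And>i. s i \<in> A.Hom_k" "\<forall>i. msupp c i \<longrightarrow> mdeg c i = Suc 0 \<longrightarrow> A.dif s i = 0"
      "\<And>i. msupp c i \<Longrightarrow> mdeg c i = 0 \<Longrightarrow> restr (s i) = f" by blast
    have "s (\<lambda>_. 0) \<in> A.Hom_A" using A.cocycle_0[OF s(1)] s(2) by simp
    moreover have "restr (s (\<lambda>_. 0)) = f" by (rule s(3)) (simp_all add: msupp_def mdeg_def)
    ultimately show "\<exists>g\<in>A.Hom_A. restr g = f" by blast
  qed
next
  assume h: "\<forall>f\<in>K.Hom_A. \<exists>g\<in>A.Hom_A. restr g = f"
  show "lifts 0" unfolding lifts_def
  proof (intro allI impI)
    fix z assume z: "\<forall>i. z i \<in> K.Hom_k" "\<forall>i. msupp c i \<longrightarrow> mdeg c i = Suc 0 \<longrightarrow> K.dif z i = 0"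
    then have "z (\<lambda>_. 0) \<in> K.Hom_A" using K.cocycle_0[of z] by simp
    then obtain g where g: "g \<in> A.Hom_A" "restr g = z (\<lambda>_. 0)" using h by blast
    have gH: "\<And>i. (\<lambda>_::nat \<Rightarrow> nat. g) i \<in> A.Hom_k" using g by (simp add: A.Hom_A_def)
    have "i = (\<lambda>_. 0)" if "msupp c i" "mdeg c i = 0" for i
      using that by (intro HOL.ext) (auto simp: msupp_def mdeg_def)
    then show "\<exists>s. (\<forall>i. s i \<in> A.Hom_k) \<and> (\<forall>i. msupp c i \<longrightarrow> mdeg c i = Suc 0 \<longrightarrow> A.dif s i = 0) \<and>
       (\<forall>i. msupp c i \<longrightarrow> mdeg c i = 0 \<longrightarrow> restr (s i) = z i)"
      using A.cocycle_0[OF gH] g gH by (intro exI[of _ "\<lambda>_. g"]) auto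
  qed
qed

end

section \<open>The structure of the quantum complete intersection\<close>

definition fa_single :: "'i list \<Rightarrow> 'k::field \<Rightarrow> 'i list \<Rightarrow> 'k" where
  "fa_single w r = (\<lambda>v. if v = w then r else 0)"

text \<open>Multiplication from the left by a multiple of the word \<open>w\<close> only looks at words with prefix \<open>w\<close>.\<close>

lemma fa_mult_prefix:
  assumes "\<And>v. v \<noteq> w \<Longrightarrow> f v = 0"
  shows "(f \<otimes>\<^bsub>free_algebra Y\<^esub> g) v = (if take (length w) v = w then f w * g (drop (length w) v) else 0)"
proof -
  have "(\<Sum>(x, y)\<in>{(x, y). x @ y = v}. f x * g y) =
      (\<Sum>(x, y)\<in>(if take (length w) v = w then {(w, drop (length w) v)} else {}). f x * g y)"
  proof (rule sum.mono_neutral_right[OF finite_splits])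
    show "(if take (length w) v = w then {(w, drop (length w) v)} else {}) \<subseteq> {(x, y). x @ y = v}"
      by (simp split: if_splits) (metis append_take_drop_id)
    show "\<forall>p\<in>{(x, y). x @ y = v} - (if take (length w) v = w then {(w, drop (length w) v)} else {}).
        (case p of (x, y) \<Rightarrow> f x * g y) = 0"
    proof
      fix p assume p: "p \<in> {(x, y). x @ y = v} - (if take (length w) v = w then {(w, drop (length w) v)} else {})"
      then obtain x y where xy: "p = (x, y)" "x @ y = v" by auto
      have "x \<noteq> w"
      proof
        assume "x = w"
        then have "take (length w) v = w" "drop (length w) v = y" using xy(2) by auto
        then show False using p xy \<open>x = w\<close> by simp
      qed
      then show "(case p of (x, y) \<Rightarrow> f x * g y) = 0" using assms by (simp add: xy)
    qed
  qed
  then show ?thesis by (simp add: free_algebra_def)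
qed

lemma fa_const_mult: "fa_const r \<otimes>\<^bsub>free_algebra Y\<^esub> g = (\<lambda>v. r * g v)"
  by (intro ext, subst fa_mult_prefix[of "[]"]) (auto simp: fa_const_def)

lemma fa_var_mult: "fa_var l \<otimes>\<^bsub>free_algebra Y\<^esub> g = (\<lambda>v. case v of [] \<Rightarrow> 0 | x # v \<Rightarrow> if x = l then g v else 0)"
  by (intro ext, subst fa_mult_prefix[of "[l]"]) (auto simp: fa_var_def split: list.splits)

lemma fa_mult_const: "g \<otimes>\<^bsub>free_algebra Y\<^esub> fa_const r = (\<lambda>v. g v * r)"
proof
  fix v
  have "(\<Sum>(x, y)\<in>{(x, y). x @ y = v}. g x * fa_const r y) = (\<Sum>(x, y)\<in>{(v, drop (length v) v)}. g x * fa_const r y)"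
    by (rule sum.mono_neutral_right) (auto simp: finite_splits fa_const_def split: if_splits)
  then show "(g \<otimes>\<^bsub>free_algebra Y\<^esub> fa_const r) v = g v * r" by (simp add: free_algebra_def fa_const_def)
qed

lemma fa_induct [consumes 1, case_names zero word add]:
  assumes f: "f \<in> carrier (free_algebra Y)" and z: "P (\<lambda>_. 0)"
    and w: "\<And>w r. w \<in> lists Y \<Longrightarrow> P (fa_single w r)"
    and a: "\<And>f g. f \<in> carrier (free_algebra Y) \<Longrightarrow> g \<in> carrier (free_algebra Y) \<Longrightarrow> P f \<Longrightarrow> P g \<Longrightarrow> P (\<lambda>w. f w + g w)"
  shows "P f"
proof -
  have "P f" if "finite S" "{w. f w \<noteq> 0} \<subseteq> S" "S \<subseteq> lists Y" for S f
    using that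
  proof (induction S arbitrary: f rule: finite_induct)
    case empty
    then have "f = (\<lambda>_. 0)" by auto
    then show ?case using z by simp
  next
    case (insert w S)
    let ?g = "f(w := 0)"
    have g: "P ?g" using insert by (intro insert.IH) auto
    have "finite {v. ?g v \<noteq> 0}" "finite {v. fa_single w (f w) v \<noteq> 0}"
      using insert by (auto intro: finite_subset[of _ "insert w S"] simp: fa_single_def split: if_splits)
    then have "?g \<in> carrier (free_algebra Y)" "fa_single w (f w) \<in> carrier (free_algebra Y)"
      using insert by (auto simp: free_algebra_def fa_single_def split: if_splits)
    moreover have "P (fa_single w (f w))" using insert.prems by (intro w) auto
    ultimately have "P (\<lambda>v. fa_single w (f w) v + ?g v)" using g a by blast
    moreover have "(\<lambda>v. fa_single w (f w) v + ?g v) = f" by (auto simp: fa_single_def)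
    ultimately show ?case by simp
  qed
  note step = this
  show ?thesis using f by (intro step[of "{w. f w \<noteq> 0}"]) (auto simp: free_algebra_def)
qed

locale qci =
  fixes c a :: nat and q :: "'k::field"
  assumes a_ge_2: "2 \<le> a" and q_root: "q ^ a = 1"
begin

declare One_nat_def [simp del]

abbreviation FA :: "(nat list \<Rightarrow> 'k) ring" where "FA \<equiv> free_algebra {1..c}"
abbreviation QA :: "(nat list \<Rightarrow> 'k) set ring" where "QA \<equiv> quantum_ci c a q"

definition rel_ideal :: "(nat list \<Rightarrow> 'k) set" where "rel_ideal = Idl\<^bsub>FA\<^esub> (quantum_ci_rels c a q)"
definition cls :: "(nat list \<Rightarrow> 'k) \<Rightarrow> (nat list \<Rightarrow> 'k) set" where "cls f = rel_ideal +>\<^bsub>FA\<^esub> f"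
definition var :: "nat \<Rightarrow> (nat list \<Rightarrow> 'k) set" where "var l = cls (fa_var l)"
definition cst :: "'k \<Rightarrow> (nat list \<Rightarrow> 'k) set" where "cst r = cls (fa_const r)"

sublocale FA: ring FA by (rule free_algebra_ring)
sublocale QA: ring QA by (rule quantum_ci_ring)

lemma rels_closed: "quantum_ci_rels c a q \<subseteq> carrier FA"
  unfolding quantum_ci_rels_def Let_def
  by (safe intro!: FA.nat_pow_closed FA.minus_closed FA.m_closed fa_const_closed fa_var_closed)

lemma rel_ideal_ideal: "ideal rel_ideal FA"
  unfolding rel_ideal_def by (rule FA.genideal_ideal[OF rels_closed])

lemma cls_hom: "cls \<in> ring_hom FA QA"
  using ideal.rcos_ring_hom[OF rel_ideal_ideal] unfolding quantum_ci_def rel_ideal_def[symmetric] cls_def[abs_def] by simp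

lemma cls_surj: "carrier QA = cls ` carrier FA"
  by (auto simp: quantum_ci_def rel_ideal_def[symmetric] FactRing_def A_RCOSETS_def' cls_def)

lemma cls_eq_iff: "f \<in> carrier FA \<Longrightarrow> g \<in> carrier FA \<Longrightarrow> cls f = cls g \<longleftrightarrow> f \<ominus>\<^bsub>FA\<^esub> g \<in> rel_ideal"
  unfolding cls_def using FA.quotient_eq_iff_same_a_r_cos[OF rel_ideal_ideal] by blast

lemma cls_rel_ideal: "f \<in> rel_ideal \<Longrightarrow> cls f = \<zero>\<^bsub>QA\<^esub>"
  unfolding cls_def using FA.a_rcos_zero[OF rel_ideal_ideal] by (simp add: quantum_ci_def rel_ideal_def[symmetric] FactRing_def)

lemmas cls_closed = ring_hom_closed[OF cls_hom]
lemmas cls_mult = ring_hom_mult[OF cls_hom]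
lemmas cls_add = ring_hom_add[OF cls_hom]
lemmas cls_one = ring_hom_one[OF cls_hom]

lemma FA_simps: "\<zero>\<^bsub>FA\<^esub> = (\<lambda>_. 0)" "f \<oplus>\<^bsub>FA\<^esub> g = (\<lambda>w. f w + g w)" "\<one>\<^bsub>FA\<^esub> = fa_const 1"
  by (auto simp: free_algebra_def fa_const_def)

lemma cls_zero: "cls (\<lambda>_. 0) = \<zero>\<^bsub>QA\<^esub>"
  using ring_hom_zero[OF cls_hom FA.ring_axioms QA.ring_axioms] by (simp add: FA_simps)

lemma var_closed: "l \<in> {1..c} \<Longrightarrow> var l \<in> carrier QA"
  by (simp add: var_def cls_closed fa_var_closed)

lemma cst_closed: "cst r \<in> carrier QA"
  by (simp add: cst_def cls_closed fa_const_closed)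

lemma cst_add: "cst (r + s) = cst r \<oplus>\<^bsub>QA\<^esub> cst s"
proof -
  have "fa_const (r + s) = fa_const r \<oplus>\<^bsub>FA\<^esub> fa_const s" by (auto simp: FA_simps fa_const_def)
  then show ?thesis by (simp add: cst_def cls_add fa_const_closed)
qed

lemma cst_mult: "cst (r * s) = cst r \<otimes>\<^bsub>QA\<^esub> cst s"
proof -
  have "fa_const (r * s) = fa_const r \<otimes>\<^bsub>FA\<^esub> fa_const s"
    unfolding fa_const_mult by (auto simp: fa_const_def)
  then show ?thesis by (simp add: cst_def cls_mult fa_const_closed)
qed

lemma cst_1: "cst 1 = \<one>\<^bsub>QA\<^esub>" using cls_one by (simp add: cst_def FA_simps)

lemma cst_0: "cst 0 = \<zero>\<^bsub>QA\<^esub>"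
proof -
  have "fa_const 0 = (\<lambda>_ :: nat list. 0 :: 'k)" by (auto simp: fa_const_def)
  then show ?thesis by (simp add: cst_def cls_zero)
qed

lemma cst_central: "x \<in> carrier QA \<Longrightarrow> cst r \<otimes>\<^bsub>QA\<^esub> x = x \<otimes>\<^bsub>QA\<^esub> cst r"
proof -
  assume "x \<in> carrier QA"
  then obtain f where f: "f \<in> carrier FA" "x = cls f" using cls_surj by auto
  have "fa_const r \<otimes>\<^bsub>FA\<^esub> f = f \<otimes>\<^bsub>FA\<^esub> fa_const r"
    unfolding fa_const_mult fa_mult_const by (simp add: mult.commute)
  then show ?thesis using f by (simp add: cst_def flip: cls_mult[OF fa_const_closed f(1)] cls_mult[OF f(1) fa_const_closed])
qed

lemma var_q_commute:
  assumes "1 \<le> l" "l < m" "m \<le> c"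
  shows "var l \<otimes>\<^bsub>QA\<^esub> var m = cst q \<otimes>\<^bsub>QA\<^esub> (var m \<otimes>\<^bsub>QA\<^esub> var l)"
proof -
  have v: "fa_var l \<in> carrier FA" "fa_var m \<in> carrier FA" using assms by (auto intro: fa_var_closed)
  have "(fa_var l \<otimes>\<^bsub>FA\<^esub> fa_var m) \<ominus>\<^bsub>FA\<^esub> (fa_const q \<otimes>\<^bsub>FA\<^esub> (fa_var m \<otimes>\<^bsub>FA\<^esub> fa_var l)) \<in> quantum_ci_rels c a q"
    using assms unfolding quantum_ci_rels_def Let_def by (intro UnI2 CollectI exI[of _ l] exI[of _ m]) simp
  then have "(fa_var l \<otimes>\<^bsub>FA\<^esub> fa_var m) \<ominus>\<^bsub>FA\<^esub> (fa_const q \<otimes>\<^bsub>FA\<^esub> (fa_var m \<otimes>\<^bsub>FA\<^esub> fa_var l)) \<in> rel_ideal"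
    unfolding rel_ideal_def using FA.genideal_self[OF rels_closed] by blast
  then have "cls (fa_var l \<otimes>\<^bsub>FA\<^esub> fa_var m) = cls (fa_const q \<otimes>\<^bsub>FA\<^esub> (fa_var m \<otimes>\<^bsub>FA\<^esub> fa_var l))"
    using v by (subst cls_eq_iff) (auto intro: fa_const_closed)
  then show ?thesis using v by (simp add: var_def cst_def cls_mult fa_const_closed)
qed

lemma cls_pow: "f \<in> carrier FA \<Longrightarrow> cls (f [^]\<^bsub>FA\<^esub> (n::nat)) = cls f [^]\<^bsub>QA\<^esub> n"
  by (induction n) (simp_all add: cls_one cls_mult)

lemma var_nilpotent: "l \<in> {1..c} \<Longrightarrow> var l [^]\<^bsub>QA\<^esub> a = \<zero>\<^bsub>QA\<^esub>"
proof -
  assume l: "l \<in> {1..c}"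
  then have "fa_var l [^]\<^bsub>FA\<^esub> a \<in> quantum_ci_rels c a q" unfolding quantum_ci_rels_def Let_def by blast
  then have "fa_var l [^]\<^bsub>FA\<^esub> a \<in> rel_ideal" unfolding rel_ideal_def using FA.genideal_self[OF rels_closed] by blast
  from cls_rel_ideal[OF this] show ?thesis using cls_pow[OF fa_var_closed[OF l], of a] by (simp add: var_def)
qed

abbreviation msm :: "((nat list \<Rightarrow> 'k) set, 'm) module \<Rightarrow> 'k \<Rightarrow> 'm \<Rightarrow> 'm" where
  "msm P \<equiv> \<lambda>r x. cst r \<odot>\<^bsub>P\<^esub> x"
abbreviation mX :: "((nat list \<Rightarrow> 'k) set, 'm) module \<Rightarrow> nat \<Rightarrow> 'm \<Rightarrow> 'm" where
  "mX P \<equiv> \<lambda>l x. var l \<odot>\<^bsub>P\<^esub> x"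

lemma module_qrep:
  assumes "left_module QA P"
  shows "qrep c a q (carrier P) (add P) (zero P) (msm P) (mX P)"
proof -
  interpret P: left_module QA P by fact
  have zl: "\<zero>\<^bsub>QA\<^esub> \<odot>\<^bsub>P\<^esub> x = \<zero>\<^bsub>P\<^esub>" if "x \<in> carrier P" for x using that by (rule P.smult_zero_l)
  have pw: "(mX P l ^^ n) x = (var l [^]\<^bsub>QA\<^esub> n) \<odot>\<^bsub>P\<^esub> x" if l: "l \<in> {1..c}" and x: "x \<in> carrier P" for l x n
  proof (induction n)
    case 0
    then show ?case using x by (simp add: P.smult_one)
  next
    case (Suc n)
    have "var l [^]\<^bsub>QA\<^esub> Suc n = var l \<otimes>\<^bsub>QA\<^esub> var l [^]\<^bsub>QA\<^esub> n"
      using var_closed[OF l] by (rule QA.nat_pow_Suc2)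
    then show ?case using Suc x var_closed[OF l] by (simp add: P.smult_assoc)
  qed
  show ?thesis
  proof
    fix x assume x: "x \<in> carrier P"
    show "cst r \<odot>\<^bsub>P\<^esub> x \<in> carrier P" for r using x by (simp add: P.smult_closed cst_closed)
    show "cst 0 \<odot>\<^bsub>P\<^esub> x = \<zero>\<^bsub>P\<^esub>" "cst 1 \<odot>\<^bsub>P\<^esub> x = x" using x by (simp_all add: cst_0 cst_1 zl P.smult_one)
    show "x \<oplus>\<^bsub>P\<^esub> cst (- 1) \<odot>\<^bsub>P\<^esub> x = \<zero>\<^bsub>P\<^esub>"
    proof -
      have "x \<oplus>\<^bsub>P\<^esub> cst (- 1) \<odot>\<^bsub>P\<^esub> x = (cst 1 \<oplus>\<^bsub>QA\<^esub> cst (- 1)) \<odot>\<^bsub>P\<^esub> x"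
        using x P.smult_l_distr[OF cst_closed cst_closed x, of 1 "-1"] by (simp add: cst_1 P.smult_one)
      then show ?thesis using x by (simp flip: cst_add add: cst_0 zl)
    qed
    show "cst r \<odot>\<^bsub>P\<^esub> (cst s \<odot>\<^bsub>P\<^esub> x) = cst (r * s) \<odot>\<^bsub>P\<^esub> x" for r s
      using x by (simp add: cst_mult P.smult_assoc cst_closed)
    show "cst r \<odot>\<^bsub>P\<^esub> (x \<oplus>\<^bsub>P\<^esub> y) = cst r \<odot>\<^bsub>P\<^esub> x \<oplus>\<^bsub>P\<^esub> cst r \<odot>\<^bsub>P\<^esub> y" if "y \<in> carrier P" for r y
      using x that by (simp add: P.smult_r_distr cst_closed)
    show "x \<oplus>\<^bsub>P\<^esub> y \<in> carrier P" if "y \<in> carrier P" for y using x that by simp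
    fix l assume l: "l \<in> {1..c}"
    note v = var_closed[OF l]
    show "var l \<odot>\<^bsub>P\<^esub> x \<in> carrier P" using x v by (simp add: P.smult_closed)
    show "var l \<odot>\<^bsub>P\<^esub> (x \<oplus>\<^bsub>P\<^esub> y) = var l \<odot>\<^bsub>P\<^esub> x \<oplus>\<^bsub>P\<^esub> var l \<odot>\<^bsub>P\<^esub> y" if "y \<in> carrier P" for y
      using x that v by (simp add: P.smult_r_distr)
    show "var l \<odot>\<^bsub>P\<^esub> (cst r \<odot>\<^bsub>P\<^esub> x) = cst r \<odot>\<^bsub>P\<^esub> (var l \<odot>\<^bsub>P\<^esub> x)" for r
      using x v cst_central[OF v, of r] by (simp add: cst_closed flip: P.smult_assoc)
    show "(mX P l ^^ a) x = \<zero>\<^bsub>P\<^esub>" using x by (simp add: pw[OF l x] var_nilpotent[OF l] zl)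
  next
    fix l m x assume lm: "1 \<le> l" "l < m" "m \<le> c" and x: "x \<in> carrier P"
    have v: "var l \<in> carrier QA" "var m \<in> carrier QA" using lm by (auto intro: var_closed)
    show "var l \<odot>\<^bsub>P\<^esub> (var m \<odot>\<^bsub>P\<^esub> x) = cst q \<odot>\<^bsub>P\<^esub> (var m \<odot>\<^bsub>P\<^esub> (var l \<odot>\<^bsub>P\<^esub> x))"
      using x v by (simp add: var_q_commute[OF lm] cst_closed flip: P.smult_assoc)
  qed (rule P.M.zero_closed)
qed

text \<open>The algebra as a left module over itself.\<close>

definition Reg :: "((nat list \<Rightarrow> 'k) set, (nat list \<Rightarrow> 'k) set) module" where
  "Reg = \<lparr>carrier = carrier QA, mult = undefined, one = undefined, zero = \<zero>\<^bsub>QA\<^esub>, add = add QA, smult = mult QA\<rparr>"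

lemma Reg_simps: "carrier Reg = carrier QA" "zero Reg = zero QA" "add Reg = add QA" "x \<odot>\<^bsub>Reg\<^esub> y = x \<otimes>\<^bsub>QA\<^esub> y"
  by (simp_all add: Reg_def)

lemma Reg_module: "left_module QA Reg"
proof (intro left_module.intro left_module_axioms.intro QA.ring_axioms)
  show "abelian_group Reg"
    by (rule abelian_groupI) (auto simp: Reg_simps QA.a_ac intro: QA.l_neg QA.a_inv_closed bexI[of _ "a_inv QA _"])
qed (simp_all add: Reg_simps QA.l_distr QA.r_distr QA.m_assoc)

sublocale Reg: qrep c a q "carrier QA" "add QA" "zero QA" "\<lambda>r x. cst r \<otimes>\<^bsub>QA\<^esub> x" "\<lambda>l x. var l \<otimes>\<^bsub>QA\<^esub> x"
  using module_qrep[OF Reg_module] by (simp add: Reg_simps)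

definition mon :: "(nat \<Rightarrow> nat) \<Rightarrow> (nat list \<Rightarrow> 'k) set" where
  "mon u = xpow (\<lambda>l x. var l \<otimes>\<^bsub>QA\<^esub> x) u c \<one>\<^bsub>QA\<^esub>"

definition expo :: "(nat \<Rightarrow> nat) set" where
  "expo = {u. (\<forall>l\<in>{1..c}. u l < a) \<and> (\<forall>l. l \<notin> {1..c} \<longrightarrow> u l = 0)}"

lemma finite_expo: "finite expo"
proof -
  have "expo \<subseteq> {u. \<forall>l. (l \<in> {1..c} \<longrightarrow> u l \<in> {..<a}) \<and> (l \<notin> {1..c} \<longrightarrow> u l = 0)}"
    by (auto simp: expo_def)
  then show ?thesis by (rule finite_subset) (rule finite_set_of_finite_funs; simp)
qed

lemma mon_closed: "mon u \<in> carrier QA"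
  by (simp add: mon_def Reg.xpow_closed)

text \<open>The \<open>k\<close>-span of the monomials with all exponents below \<open>a\<close>.  It turns out to be the whole algebra; its
induction rule is then the way to prove statements that are linear in an element of the algebra.\<close>

inductive_set kspan :: "(nat list \<Rightarrow> 'k) set set" where
  mon: "u \<in> expo \<Longrightarrow> mon u \<in> kspan"
| zero: "\<zero>\<^bsub>QA\<^esub> \<in> kspan"
| add: "x \<in> kspan \<Longrightarrow> y \<in> kspan \<Longrightarrow> x \<oplus>\<^bsub>QA\<^esub> y \<in> kspan"
| smult: "x \<in> kspan \<Longrightarrow> cst r \<otimes>\<^bsub>QA\<^esub> x \<in> kspan"

lemma kspan_sub: "x \<in> kspan \<Longrightarrow> x \<in> carrier QA"
  by (induction rule: kspan.induct) (auto simp: mon_closed cst_closed)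

lemma kspan_var:
  assumes "x \<in> kspan" and l: "l \<in> {1..c}" shows "var l \<otimes>\<^bsub>QA\<^esub> x \<in> kspan"
  using assms(1)
proof (induction rule: kspan.induct)
  case (mon u)
  let ?u = "u(l := u l + Suc 0)"
  have v: "var l \<otimes>\<^bsub>QA\<^esub> mon u = cst (q ^ (\<Sum>m\<in>{l<..c}. u m)) \<otimes>\<^bsub>QA\<^esub> mon ?u"
    using Reg.Xpow_xpow[of l c "\<one>\<^bsub>QA\<^esub>" "Suc 0" u] l by (simp add: mon_def)
  show ?case
  proof (cases "u l + Suc 0 < a")
    case True
    then have "?u \<in> expo" using mon l by (auto simp: expo_def)
    then show ?thesis unfolding v by (intro kspan.intros)
  next
    case False
    then have "mon ?u = \<zero>\<^bsub>QA\<^esub>" unfolding mon_def using l by (intro Reg.xpow_large[of c _ l]) auto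
    then show ?thesis unfolding v using cst_closed kspan.zero by simp
  qed
next
  case zero
  then show ?case using var_closed[OF l] kspan.zero by simp
next
  case (add x y)
  then show ?case using var_closed[OF l] kspan_sub by (simp add: QA.r_distr kspan.add)
next
  case (smult x r)
  have "var l \<otimes>\<^bsub>QA\<^esub> (cst r \<otimes>\<^bsub>QA\<^esub> x) = cst r \<otimes>\<^bsub>QA\<^esub> (var l \<otimes>\<^bsub>QA\<^esub> x)"
    using Reg.X_sm[OF l] kspan_sub smult by blast
  then show ?case using smult by (simp add: kspan.smult)
qed

lemma kspan_word: "w \<in> lists {1..c} \<Longrightarrow> cls (fa_single w r) \<in> kspan"
proof (induction w)
  case Nil
  have "mon (\<lambda>_. 0) \<in> kspan" using a_ge_2 by (intro kspan.mon) (simp add: expo_def)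
  then have "cst r \<otimes>\<^bsub>QA\<^esub> mon (\<lambda>_. 0) \<in> kspan" by (rule kspan.smult)
  moreover have "(fa_single [] r :: nat list \<Rightarrow> 'k) = fa_const r" by (auto simp: fa_single_def fa_const_def)
  ultimately show ?case by (simp add: mon_def xpow_zero cst_def cls_closed fa_const_closed)
next
  case (Cons l w)
  have "finite {v. fa_single w r v \<noteq> 0}" by (rule finite_subset[of _ "{w}"]) (auto simp: fa_single_def)
  then have s: "fa_single w r \<in> carrier FA" using Cons by (auto simp: free_algebra_def fa_single_def split: if_splits)
  have l: "l \<in> {1..c}" using Cons by auto
  have "fa_single (l # w) r = fa_var l \<otimes>\<^bsub>FA\<^esub> fa_single w r"
    unfolding fa_var_mult by (auto simp: fa_single_def fun_eq_iff split: list.splits)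
  then have "cls (fa_single (l # w) r) = var l \<otimes>\<^bsub>QA\<^esub> cls (fa_single w r)"
    by (simp add: cls_mult[OF fa_var_closed[OF l] s] var_def)
  then show ?case using kspan_var[OF _ l] Cons by auto
qed

theorem kspan_eq: "kspan = carrier QA"
proof -
  have "cls f \<in> kspan" if "f \<in> carrier FA" for f
    using that
  proof (induction rule: fa_induct)
    case zero
    then show ?case by (simp add: cls_zero kspan.zero)
  next
    case (word w r)
    then show ?case by (rule kspan_word)
  next
    case (add f g)
    then show ?case using cls_add[of f g] kspan.add by (simp add: FA_simps)
  qed
  then show ?thesis using kspan_sub cls_surj by auto
qed


text \<open>The action of \<open>x_l\<close> on the vector space with basis the monomials with exponents below \<open>a\<close>, written
for coefficient functions \<open>G\<close>.  This representation exists independently of the algebra, and shows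
that the monomials are linearly independent in it.\<close>

definition xop :: "nat \<Rightarrow> ((nat \<Rightarrow> nat) \<Rightarrow> 'k) \<Rightarrow> (nat \<Rightarrow> nat) \<Rightarrow> 'k" where
  "xop l G u = (if 0 < u l \<and> u l < a then q ^ (\<Sum>m\<in>{l<..c}. u m) * G (u(l := u l - Suc 0)) else 0)"

definition act :: "(nat list \<Rightarrow> 'k) \<Rightarrow> ((nat \<Rightarrow> nat) \<Rightarrow> 'k) \<Rightarrow> (nat \<Rightarrow> nat) \<Rightarrow> 'k" where
  "act f G u = (\<Sum>w\<in>{w. f w \<noteq> 0}. f w * foldr xop w G u)"

lemma act_superset:
  "finite S \<Longrightarrow> {w. f w \<noteq> 0} \<subseteq> S \<Longrightarrow> act f G u = (\<Sum>w\<in>S. f w * foldr xop w G u)"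
  unfolding act_def by (rule sum.mono_neutral_left) auto

lemma foldr_xop_sum:
  "foldr xop w (\<lambda>u. \<Sum>x\<in>S. h x * H x u) u = (\<Sum>x\<in>S. h x * foldr xop w (H x) u)"
proof (induction w arbitrary: u)
  case (Cons l w)
  have "foldr xop w (\<lambda>u. \<Sum>x\<in>S. h x * H x u) = (\<lambda>u. \<Sum>x\<in>S. h x * foldr xop w (H x) u)"
    using Cons by blast
  then show ?case by (simp add: xop_def[of l] sum_distrib_left mult_ac)
qed simp

lemma FA_finite: "f \<in> carrier FA \<Longrightarrow> finite {w. f w \<noteq> 0}" by (simp add: free_algebra_def)

lemma act_mult:
  assumes f: "f \<in> carrier FA" and g: "g \<in> carrier FA"
  shows "act (f \<otimes>\<^bsub>FA\<^esub> g) G = act f (act g G)"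
proof
  fix u
  let ?F = "{w. f w \<noteq> 0}" and ?G = "{w. g w \<noteq> 0}"
  let ?S = "(\<lambda>(x, y). x @ y) ` (?F \<times> ?G)"
  let ?t = "\<lambda>(x, y). f x * g y * foldr xop (x @ y) G u"
  have fin: "finite (?F \<times> ?G)" using FA_finite f g by blast
  have m: "(f \<otimes>\<^bsub>FA\<^esub> g) w = (\<Sum>(x, y)\<in>{p \<in> ?F \<times> ?G. (case p of (x, y) \<Rightarrow> x @ y) = w}. f x * g y)" for w
  proof -
    have "(\<Sum>(x, y)\<in>{(x, y). x @ y = w}. f x * g y) = (\<Sum>(x, y)\<in>{p \<in> ?F \<times> ?G. (case p of (x, y) \<Rightarrow> x @ y) = w}. f x * g y)"
      by (rule sum.mono_neutral_right) (auto simp: finite_splits)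
    then show ?thesis by (simp add: free_algebra_def)
  qed
  have "{w. (f \<otimes>\<^bsub>FA\<^esub> g) w \<noteq> 0} \<subseteq> ?S"
  proof
    fix w assume "w \<in> {w. (f \<otimes>\<^bsub>FA\<^esub> g) w \<noteq> 0}"
    then have "{p \<in> ?F \<times> ?G. (case p of (x, y) \<Rightarrow> x @ y) = w} \<noteq> {}" unfolding m by (metis (mono_tags, lifting) mem_Collect_eq sum.empty)
    then show "w \<in> ?S" by blast
  qed
  then have "act (f \<otimes>\<^bsub>FA\<^esub> g) G u = (\<Sum>w\<in>?S. (f \<otimes>\<^bsub>FA\<^esub> g) w * foldr xop w G u)"
    using fin by (intro act_superset) auto
  also have "\<dots> = (\<Sum>w\<in>?S. \<Sum>p\<in>{p \<in> ?F \<times> ?G. (case p of (x, y) \<Rightarrow> x @ y) = w}. ?t p)"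
    unfolding m sum_distrib_right by (intro sum.cong refl) auto
  also have "\<dots> = (\<Sum>p\<in>?F \<times> ?G. ?t p)"
    using fin by (intro sum.group) auto
  also have "\<dots> = (\<Sum>x\<in>?F. \<Sum>y\<in>?G. f x * (g y * foldr xop x (foldr xop y G) u))"
    by (simp add: sum.cartesian_product mult.assoc)
  also have "\<dots> = act f (act g G) u"
    unfolding act_def foldr_xop_sum by (simp add: sum_distrib_left)
  finally show "act (f \<otimes>\<^bsub>FA\<^esub> g) G u = act f (act g G) u" .
qed

lemma act_add:
  assumes "f \<in> carrier FA" "g \<in> carrier FA"
  shows "act (\<lambda>w. f w + g w) G u = act f G u + act g G u"
proof -
  let ?S = "{w. f w \<noteq> 0} \<union> {w. g w \<noteq> 0}"
  have S: "finite ?S" using assms FA_finite by blast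
  show ?thesis
    by (subst (1 2 3) act_superset[OF S]) (auto simp: sum.distrib distrib_right)
qed

lemma act_const: "act (fa_const r) G u = r * G u"
  by (subst act_superset[of "{[]}"]) (auto simp: fa_const_def split: if_splits)

lemma act_var: "act (fa_var l) G = xop l G"
  by (intro ext, subst act_superset[of "{[l]}"]) (auto simp: fa_var_def split: if_splits)

lemma xop_zero: "xop l (\<lambda>_. 0) = (\<lambda>_. 0)" by (auto simp: xop_def)

lemma act_zero_right: "act f (\<lambda>_. 0) = (\<lambda>_. 0)"
proof -
  have "foldr xop w (\<lambda>_. 0) = (\<lambda>_. 0)" for w by (induction w) (simp_all add: xop_zero)
  then show ?thesis by (auto simp: act_def)
qed

lemma xop_q_commute:
  assumes "1 \<le> l" "l < m" "m \<le> c"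
  shows "xop l (xop m G) u = q * xop m (xop l G) u"
proof (cases "0 < u l \<and> u l < a \<and> 0 < u m \<and> u m < a")
  case True
  have "m \<in> {l<..c}" using assms by auto
  then have s: "(\<Sum>n\<in>{l<..c}. v n) = v m + (\<Sum>n\<in>{l<..c}-{m}. v n)" for v :: "nat \<Rightarrow> nat"
    by (simp add: sum.remove)
  have "(\<Sum>n\<in>{l<..c}-{m}. (u(m := u m - Suc 0)) n) = (\<Sum>n\<in>{l<..c}-{m}. u n)" by (intro sum.cong) auto
  then have 1: "(\<Sum>n\<in>{l<..c}. u n) = Suc (\<Sum>n\<in>{l<..c}. (u(m := u m - Suc 0)) n)"
    using True by (simp add: s)
  have 2: "(\<Sum>n\<in>{m<..c}. (u(l := u l - Suc 0)) n) = (\<Sum>n\<in>{m<..c}. u n)" using assms by (intro sum.cong) auto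
  show ?thesis using True assms unfolding xop_def 1 by (simp add: 2 fun_upd_twist)
next
  case False
  then show ?thesis using assms by (auto simp: xop_def)
qed

lemma xop_pow_small: "u l < n \<Longrightarrow> (xop l ^^ n) G u = 0"
  by (induction n arbitrary: u) (auto simp: xop_def)

lemma xop_nilpotent: "(xop l ^^ a) G = (\<lambda>_. 0)"
proof
  fix u
  show "(xop l ^^ a) G u = 0"
  proof (cases "u l < a")
    case True
    then show ?thesis by (rule xop_pow_small)
  next
    case False
    have "(xop l ^^ Suc n) G u = 0" for n using False by (simp add: xop_def[of l])
    from this[of "a - 1"] show ?thesis using a_ge_2 by (simp del: funpow.simps add: Suc_diff_1)
  qed
qed

definition act_kernel :: "(nat list \<Rightarrow> 'k) set" where
  "act_kernel = {f \<in> carrier FA. \<forall>G. act f G = (\<lambda>_. 0)}"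

lemma act_kernel_ideal: "ideal act_kernel FA"
proof (rule idealI)
  have l: "x \<otimes>\<^bsub>FA\<^esub> f \<in> act_kernel" if "f \<in> act_kernel" "x \<in> carrier FA" for x f
    using that by (simp add: act_kernel_def act_mult act_zero_right)
  show "subgroup act_kernel (add_monoid FA)"
  proof (rule FA.add.subgroupI)
    show "act_kernel \<subseteq> carrier FA" by (auto simp: act_kernel_def)
    have "(\<lambda>_. 0) \<in> act_kernel" using FA.zero_closed by (auto simp: act_kernel_def FA_simps act_def fun_eq_iff)
    then show "act_kernel \<noteq> {}" by blast
    fix f assume f: "f \<in> act_kernel"
    have "\<ominus>\<^bsub>FA\<^esub> f = (\<ominus>\<^bsub>FA\<^esub> \<one>\<^bsub>FA\<^esub>) \<otimes>\<^bsub>FA\<^esub> f" using f by (simp add: FA.l_minus act_kernel_def)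
    then show "\<ominus>\<^bsub>FA\<^esub> f \<in> act_kernel" using l[OF f] by simp
    fix g assume g: "g \<in> act_kernel"
    have "f \<oplus>\<^bsub>FA\<^esub> g \<in> carrier FA" using f g by (simp add: act_kernel_def)
    then show "f \<oplus>\<^bsub>FA\<^esub> g \<in> act_kernel" using f g by (auto simp: act_kernel_def FA_simps act_add fun_eq_iff)
  qed
  show "f \<otimes>\<^bsub>FA\<^esub> x \<in> act_kernel" if "f \<in> act_kernel" "x \<in> carrier FA" for x f
    using that by (simp add: act_kernel_def act_mult)
  show "x \<otimes>\<^bsub>FA\<^esub> f \<in> act_kernel" if "f \<in> act_kernel" "x \<in> carrier FA" for x f using l that by blast
qed (rule FA.ring_axioms)

text \<open>The relations act as zero, so the action descends from the free algebra to the quotient.\<close>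

lemma rel_ideal_sub_act_kernel: "rel_ideal \<subseteq> act_kernel"
  unfolding rel_ideal_def
proof (rule FA.genideal_minimal[OF act_kernel_ideal], rule subsetI)
  fix f assume "f \<in> quantum_ci_rels c a q"
  then consider l where "l \<in> {1..c}" "f = fa_var l [^]\<^bsub>FA\<^esub> a"
    | l m where "l \<in> {1..c}" "m \<in> {1..c}" "l < m"
      "f = (fa_var l \<otimes>\<^bsub>FA\<^esub> fa_var m) \<ominus>\<^bsub>FA\<^esub> (fa_const q \<otimes>\<^bsub>FA\<^esub> (fa_var m \<otimes>\<^bsub>FA\<^esub> fa_var l))"
    unfolding quantum_ci_rels_def Let_def by blast
  then show "f \<in> act_kernel"
  proof cases
    case 1
    have v: "fa_var l \<in> carrier FA" using 1(1) by (rule fa_var_closed)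
    have "act (fa_var l [^]\<^bsub>FA\<^esub> n) G = (xop l ^^ n) G" for n :: nat and G
    proof (induction n arbitrary: G)
      case 0
      then show ?case by (auto simp: FA_simps act_const)
    next
      case (Suc n)
      then show ?case using v by (simp add: act_mult act_var funpow_swap1)
    qed
    then show ?thesis using v by (simp add: act_kernel_def 1 xop_nilpotent)
  next
    case 2
    have v: "fa_var l \<in> carrier FA" "fa_var m \<in> carrier FA" using 2(1,2) by (simp_all add: fa_var_closed)
    have n: "\<ominus>\<^bsub>FA\<^esub> f = fa_const (- 1) \<otimes>\<^bsub>FA\<^esub> f" if "f \<in> carrier FA" for f
    proof (rule FA.minus_equality)
      show "fa_const (- 1) \<otimes>\<^bsub>FA\<^esub> f \<oplus>\<^bsub>FA\<^esub> f = \<zero>\<^bsub>FA\<^esub>"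
        unfolding fa_const_mult by (simp add: FA_simps)
    qed (use that in \<open>simp_all add: fa_const_closed\<close>)
    let ?h = "fa_const q \<otimes>\<^bsub>FA\<^esub> (fa_var m \<otimes>\<^bsub>FA\<^esub> fa_var l)"
    have h: "?h \<in> carrier FA" "fa_var l \<otimes>\<^bsub>FA\<^esub> fa_var m \<in> carrier FA"
      "fa_const (- 1) \<otimes>\<^bsub>FA\<^esub> ?h \<in> carrier FA" using v by (simp_all add: fa_const_closed)
    have f: "f = (\<lambda>w. (fa_var l \<otimes>\<^bsub>FA\<^esub> fa_var m) w + (fa_const (- 1) \<otimes>\<^bsub>FA\<^esub> ?h) w)"
      unfolding 2(4) a_minus_def n[OF h(1)] FA_simps ..
    have "act f G u = 0" for G u
      unfolding f act_add[OF h(2,3)]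
      using 2(1-3) v by (simp add: act_mult act_var act_const fa_const_closed xop_q_commute)
    then show ?thesis using FA.a_closed[OF h(2,3)] by (auto simp: act_kernel_def f FA_simps)
  qed
qed

definition delta :: "(nat \<Rightarrow> nat) \<Rightarrow> (nat \<Rightarrow> nat) \<Rightarrow> 'k" where
  "delta v = (\<lambda>u. if u = v then 1 else 0)"

text \<open>The coefficients of an element in the monomial basis: its action on the basis vector of the monomial 1.\<close>

definition co :: "(nat list \<Rightarrow> 'k) set \<Rightarrow> (nat \<Rightarrow> nat) \<Rightarrow> 'k" where
  "co x = act (SOME f. f \<in> carrier FA \<and> cls f = x) (delta (\<lambda>_. 0))"

lemma co_cls:
  assumes f: "f \<in> carrier FA" shows "co (cls f) = act f (delta (\<lambda>_. 0))"
proof -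
  define g where "g = (SOME g. g \<in> carrier FA \<and> cls g = cls f)"
  have g: "g \<in> carrier FA" "cls g = cls f" using someI[of "\<lambda>g. g \<in> carrier FA \<and> cls g = cls f" f] f by (auto simp: g_def)
  have d: "g \<ominus>\<^bsub>FA\<^esub> f \<in> act_kernel" using cls_eq_iff[OF g(1) f] g(2) rel_ideal_sub_act_kernel by blast
  have "g = (g \<ominus>\<^bsub>FA\<^esub> f) \<oplus>\<^bsub>FA\<^esub> f" using f g(1) by (simp add: a_minus_def FA.a_assoc FA.l_neg)
  then have "act g (delta (\<lambda>_. 0)) u = act (g \<ominus>\<^bsub>FA\<^esub> f) (delta (\<lambda>_. 0)) u + act f (delta (\<lambda>_. 0)) u" for u
    using act_add[of "g \<ominus>\<^bsub>FA\<^esub> f" f "delta (\<lambda>_. 0)" u] d f by (simp add: act_kernel_def FA_simps)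
  then have "act g (delta (\<lambda>_. 0)) = act f (delta (\<lambda>_. 0))" using d by (auto simp: act_kernel_def)
  then show ?thesis by (simp add: co_def g_def)
qed

lemma co_add: "x \<in> carrier QA \<Longrightarrow> y \<in> carrier QA \<Longrightarrow> co (x \<oplus>\<^bsub>QA\<^esub> y) u = co x u + co y u"
proof -
  assume "x \<in> carrier QA" "y \<in> carrier QA"
  then obtain f g where fg: "f \<in> carrier FA" "g \<in> carrier FA" "x = cls f" "y = cls g" using cls_surj by auto
  then show ?thesis using FA.a_closed[OF fg(1,2)] by (simp add: co_cls act_add FA_simps flip: cls_add)
qed

lemma co_smult: "x \<in> carrier QA \<Longrightarrow> co (cst r \<otimes>\<^bsub>QA\<^esub> x) u = r * co x u"
proof -
  assume "x \<in> carrier QA"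
  then obtain f where f: "f \<in> carrier FA" "x = cls f" using cls_surj by auto
  have "cst r \<otimes>\<^bsub>QA\<^esub> x = cls (fa_const r \<otimes>\<^bsub>FA\<^esub> f)" using f by (simp add: cst_def cls_mult fa_const_closed)
  then show ?thesis using f by (simp add: co_cls act_mult act_const fa_const_closed)
qed

lemma co_var: "l \<in> {1..c} \<Longrightarrow> x \<in> carrier QA \<Longrightarrow> co (var l \<otimes>\<^bsub>QA\<^esub> x) = xop l (co x)"
proof -
  assume l: "l \<in> {1..c}" and "x \<in> carrier QA"
  then obtain f where f: "f \<in> carrier FA" "x = cls f" using cls_surj by auto
  have "var l \<otimes>\<^bsub>QA\<^esub> x = cls (fa_var l \<otimes>\<^bsub>FA\<^esub> f)" using f by (simp add: var_def cls_mult fa_var_closed[OF l])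
  then show ?thesis using f by (simp add: co_cls act_mult act_var fa_var_closed[OF l])
qed

lemma co_zero: "co \<zero>\<^bsub>QA\<^esub> u = 0"
  using co_smult[OF QA.zero_closed, of 0 u] by (simp add: cst_closed)

lemma co_one: "co \<one>\<^bsub>QA\<^esub> = delta (\<lambda>_. 0)"
  using co_cls[OF fa_const_closed, of 1] cst_1 by (auto simp: cst_def act_const)

lemma xop_pow_delta:
  assumes "t < a" "v l = 0" "\<And>m. l < m \<Longrightarrow> v m = 0"
  shows "(xop l ^^ t) (delta v) = delta (v(l := t))"
  using assms(1)
proof (induction t)
  case 0
  then show ?case using assms(2) by (simp add: fun_upd_idem)
next
  case (Suc t)
  have "xop l (delta (v(l := t))) u = delta (v(l := Suc t)) u" for u
  proof (cases "0 < u l \<and> u l < a \<and> u(l := u l - Suc 0) = v(l := t)")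
    case True
    then have e: "u(l := u l - Suc 0) = v(l := t)" "0 < u l" by auto
    have "u m = (v(l := Suc t)) m" for m
      using fun_cong[OF e(1), of m] fun_cong[OF e(1), of l] e(2) by (cases "m = l") auto
    then have u: "u = v(l := Suc t)" ..
    have "(\<Sum>m\<in>{l<..c}. u m) = 0" using assms(3) by (simp add: u)
    then show ?thesis using True by (simp add: xop_def delta_def u)
  next
    case False
    have "u \<noteq> v(l := Suc t)"
    proof
      assume u: "u = v(l := Suc t)"
      then have "u(l := u l - Suc 0) = v(l := t)" "0 < u l" "u l < a" using Suc.prems by simp_all
      then show False using False by blast
    qed
    then show ?thesis using False by (auto simp: xop_def delta_def)
  qed
  then have "xop l (delta (v(l := t))) = delta (v(l := Suc t))" by blast
  then show ?case using Suc.IH[OF Suc_lessD[OF Suc.prems]] by (simp only: funpow.simps o_apply)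
qed

lemma co_mon: "u \<in> expo \<Longrightarrow> co (mon u) = delta u"
proof -
  assume u: "u \<in> expo"
  have "co (xpow (\<lambda>l x. var l \<otimes>\<^bsub>QA\<^esub> x) u n \<one>\<^bsub>QA\<^esub>) = delta (\<lambda>l. if l \<le> n then u l else 0)" if "n \<le> c" for n
    using that
  proof (induction n)
    case 0
    have "(\<lambda>l. if l \<le> 0 then u l else 0) = (\<lambda>_. 0)" using u by (auto simp: expo_def)
    then show ?case by (simp add: co_one)
  next
    case (Suc n)
    let ?X = "\<lambda>l x. var l \<otimes>\<^bsub>QA\<^esub> x"
    have S: "Suc n \<in> {1..c}" using Suc.prems by simp
    have p: "co ((?X (Suc n) ^^ t) x) = (xop (Suc n) ^^ t) (co x)" if "x \<in> carrier QA" for t x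
      using that by (induction t) (simp_all add: co_var[OF S] Reg.Xpow_closed[OF S])
    have "co (xpow ?X u (Suc n) \<one>\<^bsub>QA\<^esub>) = (xop (Suc n) ^^ u (Suc n)) (delta (\<lambda>l. if l \<le> n then u l else 0))"
      using Suc p[OF Reg.xpow_closed[of n "\<one>\<^bsub>QA\<^esub>" u]] by simp
    also have "\<dots> = delta ((\<lambda>l. if l \<le> n then u l else 0)(Suc n := u (Suc n)))"
      using u S by (intro xop_pow_delta) (auto simp: expo_def)
    also have "(\<lambda>l. if l \<le> n then u l else 0)(Suc n := u (Suc n)) = (\<lambda>l. if l \<le> Suc n then u l else 0)"
      by (auto simp: le_Suc_eq)
    finally show ?case .
  qed
  from this[of c] have "co (mon u) = delta (\<lambda>l. if l \<le> c then u l else 0)" by (simp add: mon_def)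
  moreover have "(\<lambda>l. if l \<le> c then u l else 0) = u" using u by (auto simp: expo_def)
  ultimately show ?thesis by simp
qed

text \<open>Both sides are linear and agree on monomials.\<close>

lemma co_expand:
  assumes x: "x \<in> carrier QA"
  shows "x = (\<Oplus>\<^bsub>QA\<^esub>u\<in>expo. cst (co x u) \<otimes>\<^bsub>QA\<^esub> mon u)"
proof -
  have c: "(\<lambda>u. cst (h u) \<otimes>\<^bsub>QA\<^esub> mon u) \<in> expo \<rightarrow> carrier QA" for h by (auto simp: cst_closed mon_closed)
  have "x \<in> kspan" using x kspan_eq by simp
  then show ?thesis
  proof (induction rule: kspan.induct)
    case (mon v)
    have "(\<Oplus>\<^bsub>QA\<^esub>u\<in>expo. cst (co (mon v) u) \<otimes>\<^bsub>QA\<^esub> mon u) = (\<Oplus>\<^bsub>QA\<^esub>u\<in>expo. if v = u then mon u else \<zero>\<^bsub>QA\<^esub>)"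
      using mon by (intro QA.finsum_cong') (auto simp: co_mon delta_def cst_1 cst_0 mon_closed)
    also have "\<dots> = mon v" using mon finite_expo by (intro QA.finsum_singleton) (auto simp: mon_closed)
    finally show ?case ..
  next
    case zero
    have "(\<Oplus>\<^bsub>QA\<^esub>u\<in>expo. cst (co \<zero>\<^bsub>QA\<^esub> u) \<otimes>\<^bsub>QA\<^esub> mon u) = (\<Oplus>\<^bsub>QA\<^esub>u\<in>expo. \<zero>\<^bsub>QA\<^esub>)"
      by (intro QA.finsum_cong') (auto simp: co_zero cst_0 mon_closed)
    then show ?case by simp
  next
    case (add x y)
    have "x \<oplus>\<^bsub>QA\<^esub> y = (\<Oplus>\<^bsub>QA\<^esub>u\<in>expo. cst (co x u) \<otimes>\<^bsub>QA\<^esub> mon u \<oplus>\<^bsub>QA\<^esub> cst (co y u) \<otimes>\<^bsub>QA\<^esub> mon u)"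
      by (subst QA.finsum_addf[OF c c]) (use add in simp)
    also have "\<dots> = (\<Oplus>\<^bsub>QA\<^esub>u\<in>expo. cst (co (x \<oplus>\<^bsub>QA\<^esub> y) u) \<otimes>\<^bsub>QA\<^esub> mon u)"
      using add kspan_sub by (intro QA.finsum_cong') (auto simp: co_add cst_add QA.l_distr cst_closed mon_closed)
    finally show ?case .
  next
    case (smult x r)
    have "cst r \<otimes>\<^bsub>QA\<^esub> x = (\<Oplus>\<^bsub>QA\<^esub>u\<in>expo. cst r \<otimes>\<^bsub>QA\<^esub> (cst (co x u) \<otimes>\<^bsub>QA\<^esub> mon u))"
      by (subst QA.finsum_rdistr[OF finite_expo cst_closed c, symmetric]) (use smult in simp)
    also have "\<dots> = (\<Oplus>\<^bsub>QA\<^esub>u\<in>expo. cst (co (cst r \<otimes>\<^bsub>QA\<^esub> x) u) \<otimes>\<^bsub>QA\<^esub> mon u)"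
      using smult kspan_sub by (intro QA.finsum_cong') (auto simp: co_smult cst_mult QA.m_assoc cst_closed mon_closed)
    finally show ?case .
  qed
qed

lemma co_inj: "x \<in> carrier QA \<Longrightarrow> y \<in> carrier QA \<Longrightarrow> (\<And>u. u \<in> expo \<Longrightarrow> co x u = co y u) \<Longrightarrow> x = y"
proof -
  assume xy: "x \<in> carrier QA" "y \<in> carrier QA" "\<And>u. u \<in> expo \<Longrightarrow> co x u = co y u"
  have "(\<Oplus>\<^bsub>QA\<^esub>u\<in>expo. cst (co x u) \<otimes>\<^bsub>QA\<^esub> mon u) = (\<Oplus>\<^bsub>QA\<^esub>u\<in>expo. cst (co y u) \<otimes>\<^bsub>QA\<^esub> mon u)"
    by (intro QA.finsum_cong') (auto simp: xy(3) cst_closed mon_closed)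
  then show "x = y" using co_expand[OF xy(1)] co_expand[OF xy(2)] by simp
qed

end

section \<open>Free modules\<close>

locale qci_target = qci c a q + quantum_operators sc c a q L W
  for sc :: "'k::field \<Rightarrow> 'w::ab_group_add \<Rightarrow> 'w" (infixr "\<cdot>" 75)
    and c a :: nat and q :: 'k and L :: "nat \<Rightarrow> 'w \<Rightarrow> 'w" and W :: "'w set"
begin

lemma cochains_module:
  "left_module QA P \<Longrightarrow> cochains sc c a q L W (carrier P) (add P) (zero P) (msm P) (mX P)"
  by (intro cochains.intro module_qrep quantum_operators_axioms)

text \<open>Exactness of the complex \<open>C(P)\<close>, stated for a module \<open>P\<close> so that it can be compared between
modules with carriers of different types.\<close>

definition exact_mod :: "((nat list \<Rightarrow> 'k) set, 'm) module \<Rightarrow> nat \<Rightarrow> bool" where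
  "exact_mod P n = periodic_complex.vanish c (cochains.Hom_k sc W (carrier P) (add P) (msm P))
     (cochains.dif sc c a q L (carrier P) (mX P)) c n"

definition Hom_A_mod :: "((nat list \<Rightarrow> 'k) set, 'm) module \<Rightarrow> ('m \<Rightarrow> 'w) set" where
  "Hom_A_mod P = cochains.Hom_A sc c L W (carrier P) (add P) (msm P) (mX P)"

end

locale free_qmodule = qci_target sc c a q L W
  for sc :: "'k::field \<Rightarrow> 'w::ab_group_add \<Rightarrow> 'w" (infixr "\<cdot>" 75)
    and c a :: nat and q :: 'k and L :: "nat \<Rightarrow> 'w \<Rightarrow> 'w" and W :: "'w set" +
  fixes B :: "'b set"
begin

abbreviation Fr :: "((nat list \<Rightarrow> 'k) set, 'b \<Rightarrow> (nat list \<Rightarrow> 'k) set) module" where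
  "Fr \<equiv> free_module QA B"

lemma Fr_module: "left_module QA Fr" by (rule free_module_left_module[OF QA.ring_axioms])

sublocale Fr: cochains sc c a q L W "carrier Fr" "add Fr" "zero Fr" "msm Fr" "mX Fr"
  by (rule cochains_module[OF Fr_module])

lemma Fr_simps: "x \<oplus>\<^bsub>Fr\<^esub> y = (\<lambda>b. x b \<oplus>\<^bsub>QA\<^esub> y b)" "r \<odot>\<^bsub>Fr\<^esub> x = (\<lambda>b. r \<otimes>\<^bsub>QA\<^esub> x b)" "\<zero>\<^bsub>Fr\<^esub> = (\<lambda>_. \<zero>\<^bsub>QA\<^esub>)"
  by (simp_all add: free_module_def)

lemma Fr_coord: "y \<in> carrier Fr \<Longrightarrow> y b \<in> carrier QA"
  by (cases "b \<in> B") (auto simp: free_module_def)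

lemma Fr_outside: "y \<in> carrier Fr \<Longrightarrow> b \<notin> B \<Longrightarrow> y b = \<zero>\<^bsub>QA\<^esub>"
  by (simp add: free_module_def)

lemma Fr_finite: "y \<in> carrier Fr \<Longrightarrow> finite {b. y b \<noteq> \<zero>\<^bsub>QA\<^esub>}"
  by (simp add: free_module_def)

definition single :: "'b \<Rightarrow> (nat list \<Rightarrow> 'k) set \<Rightarrow> 'b \<Rightarrow> (nat list \<Rightarrow> 'k) set" where
  "single b x = (\<lambda>b'. if b' = b then x else \<zero>\<^bsub>QA\<^esub>)"

lemma single_closed: "b \<in> B \<Longrightarrow> x \<in> carrier QA \<Longrightarrow> single b x \<in> carrier Fr"
proof -
  have "{b'. single b x b' \<noteq> \<zero>\<^bsub>QA\<^esub>} \<subseteq> {b}" by (auto simp: single_def)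
  then have "finite {b'. single b x b' \<noteq> \<zero>\<^bsub>QA\<^esub>}" by (rule finite_subset) simp
  then show "b \<in> B \<Longrightarrow> x \<in> carrier QA \<Longrightarrow> single b x \<in> carrier Fr" by (simp add: free_module_def) (simp add: single_def)
qed

lemma single_mult: "r \<in> carrier QA \<Longrightarrow> r \<odot>\<^bsub>Fr\<^esub> single b x = single b (r \<otimes>\<^bsub>QA\<^esub> x)"
  by (rule ext) (simp add: Fr_simps single_def)

lemma single_add: "single b (x \<oplus>\<^bsub>QA\<^esub> y) = single b x \<oplus>\<^bsub>Fr\<^esub> single b y"
  by (rule ext) (simp add: Fr_simps single_def)

lemma xpow_single_unit: "n \<le> c \<Longrightarrow> xpow (mX Fr) u n (single b x) = single b (xpow (\<lambda>l x. var l \<otimes>\<^bsub>QA\<^esub> x) u n x)"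
proof (induction n)
  case (Suc n)
  have "(mX Fr (Suc n) ^^ t) (single b y) = single b (((\<lambda>x. var (Suc n) \<otimes>\<^bsub>QA\<^esub> x) ^^ t) y)" for t y
    using Suc.prems by (induction t) (simp_all add: single_mult var_closed)
  then show ?case using Suc by simp
qed simp

text \<open>The elements \<open>x^u e_b\<close>, with \<open>e_b\<close> the free generators and exponents below \<open>a\<close>, span a free module over
\<open>k\<close>.\<close>

lemma Hom_k_eq_0:
  assumes f: "f \<in> Fr.Hom_k" and z: "\<And>b u. b \<in> B \<Longrightarrow> u \<in> expo \<Longrightarrow> f (single b (mon u)) = 0"
  shows "f = 0"
proof -
  have 1: "f (single b x) = 0" if b: "b \<in> B" and x: "x \<in> carrier QA" for b x
  proof -
    have "x \<in> kspan" using x kspan_eq by simp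
    then show ?thesis
    proof (induction rule: kspan.induct)
      case (mon u)
      then show ?case using z b by simp
    next
      case zero
      have "single b \<zero>\<^bsub>QA\<^esub> = \<zero>\<^bsub>Fr\<^esub>" by (auto simp: single_def Fr_simps)
      then show ?case using Fr.Hom_k_ze[OF f] by simp
    next
      case (add x y)
      then show ?case using Fr.Hom_kD(3)[OF f single_closed[OF b] single_closed[OF b]] kspan_sub by (simp add: single_add)
    next
      case (smult x r)
      then show ?case using Fr.Hom_kD(4)[OF f single_closed[OF b kspan_sub], of x r] by (simp add: single_mult cst_closed)
    qed
  qed
  have 2: "f y = 0" if "finite S" "y \<in> carrier Fr" "{b. y b \<noteq> \<zero>\<^bsub>QA\<^esub>} \<subseteq> S" "S \<subseteq> B" for S y
    using that
  proof (induction S arbitrary: y rule: finite_induct)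
    case empty
    then have "y = \<zero>\<^bsub>Fr\<^esub>" by (auto simp: Fr_simps)
    then show ?case using Fr.Hom_k_ze[OF f] by simp
  next
    case (insert b S)
    let ?y = "y(b := \<zero>\<^bsub>QA\<^esub>)"
    have "{b'. ?y b' \<noteq> \<zero>\<^bsub>QA\<^esub>} \<subseteq> {b. y b \<noteq> \<zero>\<^bsub>QA\<^esub>}" by auto
    then have "finite {b'. ?y b' \<noteq> \<zero>\<^bsub>QA\<^esub>}" using Fr_finite[OF insert.prems(1)] by (rule finite_subset)
    then have y: "?y \<in> carrier Fr" using insert.prems(1) by (simp add: free_module_def)
    have b: "b \<in> B" "y b \<in> carrier QA" using insert.prems Fr_coord by auto
    have "y = ?y \<oplus>\<^bsub>Fr\<^esub> single b (y b)"
      using Fr_coord[OF insert.prems(1)] by (auto simp: Fr_simps single_def fun_eq_iff)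
    then have "f y = f ?y + f (single b (y b))"
      using Fr.Hom_kD(3)[OF f y single_closed[OF b]] by simp
    also have "f ?y = 0" using insert.prems by (intro insert.IH[OF y]) auto
    finally show ?case using 1[OF b] by simp
  qed
  show ?thesis
  proof
    fix y
    show "f y = 0 y"
    proof (cases "y \<in> carrier Fr")
      case True
      have "{b. y b \<noteq> \<zero>\<^bsub>QA\<^esub>} \<subseteq> B" using Fr_outside[OF True] by auto
      then show ?thesis using 2[OF Fr_finite[OF True] True order.refl] by simp
    qed (use Fr.Hom_kD(2)[OF f] in simp)
  qed
qed

text \<open>The linear map with prescribed values \<open>h b u\<close> on the basis elements \<open>x^u e_b\<close>.\<close>

definition extend :: "('b \<Rightarrow> (nat \<Rightarrow> nat) \<Rightarrow> 'w) \<Rightarrow> ('b \<Rightarrow> (nat list \<Rightarrow> 'k) set) \<Rightarrow> 'w" where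
  "extend h y = (if y \<in> carrier Fr then \<Sum>b\<in>{b. y b \<noteq> \<zero>\<^bsub>QA\<^esub>}. \<Sum>u\<in>expo. co (y b) u \<cdot> h b u else 0)"

lemma extend_superset:
  "y \<in> carrier Fr \<Longrightarrow> finite S \<Longrightarrow> {b. y b \<noteq> \<zero>\<^bsub>QA\<^esub>} \<subseteq> S \<Longrightarrow> extend h y = (\<Sum>b\<in>S. \<Sum>u\<in>expo. co (y b) u \<cdot> h b u)"
  unfolding extend_def by (simp, rule sum.mono_neutral_left) (auto simp: co_zero)

lemma extend_Hom_k:
  assumes h: "\<And>b u. h b u \<in> W" shows "extend h \<in> Fr.Hom_k"
  unfolding Fr.Hom_k_def
proof (intro CollectI conjI ballI allI impI)
  fix y assume y: "y \<in> carrier Fr"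
  show "extend h y \<in> W" using y h
    by (auto simp: extend_def intro!: subspace_sum[OF W_subspace] subspace_scale[OF W_subspace])
  show "extend h (cst r \<odot>\<^bsub>Fr\<^esub> y) = r \<cdot> extend h y" for r
  proof -
    have ry: "cst r \<odot>\<^bsub>Fr\<^esub> y \<in> carrier Fr" by (rule Fr.sm_closed[OF y])
    have "{b. (cst r \<odot>\<^bsub>Fr\<^esub> y) b \<noteq> \<zero>\<^bsub>QA\<^esub>} \<subseteq> {b. y b \<noteq> \<zero>\<^bsub>QA\<^esub>}" using cst_closed by (auto simp: Fr_simps)
    from extend_superset[OF ry Fr_finite[OF y] this] show ?thesis
      using y Fr_coord[OF y] by (simp add: extend_def Fr_simps co_smult scale_sum_right)
  qed
  fix x assume x: "x \<in> carrier Fr"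
  let ?S = "{b. y b \<noteq> \<zero>\<^bsub>QA\<^esub>} \<union> {b. x b \<noteq> \<zero>\<^bsub>QA\<^esub>}"
  have S: "finite ?S" using Fr_finite x y by simp
  have xy: "y \<oplus>\<^bsub>Fr\<^esub> x \<in> carrier Fr" by (rule Fr.pl_closed[OF y x])
  have "{b. (y \<oplus>\<^bsub>Fr\<^esub> x) b \<noteq> \<zero>\<^bsub>QA\<^esub>} \<subseteq> ?S" by (auto simp: Fr_simps)
  from extend_superset[OF xy S this] show "extend h (y \<oplus>\<^bsub>Fr\<^esub> x) = extend h y + extend h x"
    using extend_superset[OF y S, of h] extend_superset[OF x S, of h] Fr_coord[OF y] Fr_coord[OF x]
    by (simp add: Fr_simps co_add scale_left_distrib sum.distrib)
qed (simp add: extend_def)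

lemma extend_single:
  assumes b: "b \<in> B" and u: "u \<in> expo" shows "extend h (single b (mon u)) = h b u"
proof -
  have "{b'. single b (mon u) b' \<noteq> \<zero>\<^bsub>QA\<^esub>} \<subseteq> {b}" by (auto simp: single_def)
  then have "extend h (single b (mon u)) = (\<Sum>v\<in>expo. co (mon u) v \<cdot> h b v)"
    using extend_superset[OF single_closed[OF b mon_closed], of "{b}"] by (simp add: single_def)
  also have "\<dots> = (\<Sum>v\<in>expo. if v = u then h b v else 0)"
    using u by (intro sum.cong) (auto simp: co_mon delta_def)
  finally show ?thesis using u finite_expo by simp
qed

lemma q_nonzero: "q \<noteq> 0"
  using q_root a_ge_2 by (metis power_0_left zero_neq_one not_numeral_le_zero)

text \<open>A linear map on a free module is the same as an arbitrary choice of its coordinates \<open>g i u\<close> at the free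
generators.  So the complex is a product of the coordinate complexes, which are
contractible in positive degrees.\<close>

theorem free_exact:
  assumes n: "0 < n" shows "Fr.exact_at n"
  unfolding Fr.vanish_def Fr.box_c
proof (intro allI impI)
  fix z assume z: "\<forall>i. z i \<in> Fr.Hom_k" "\<forall>i. msupp c i \<longrightarrow> mdeg c i = Suc n \<longrightarrow> Fr.dif z i = 0"
  have zH: "\<And>i. z i \<in> Fr.Hom_k" using z by blast
  have m: "single b \<one>\<^bsub>QA\<^esub> \<in> carrier Fr" if "b \<in> B" for b using that by (simp add: single_closed)
  have "\<exists>y. bounded y \<and> valued y \<and> (\<forall>i u. msupp c i \<longrightarrow> msupp c u \<longrightarrow> mdeg c i = n \<longrightarrow>
      Fr.coord z (single b \<one>\<^bsub>QA\<^esub>) i u = cdiff y i u)" if b: "b \<in> B" for b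
  proof (rule acyclic[OF Fr.bounded_coord[OF zH m[OF b]] Fr.valued_coord[OF zH] n])
    fix i u assume "msupp c i" "mdeg c i = Suc n"
    then have "Fr.coord (Fr.dif z) (single b \<one>\<^bsub>QA\<^esub>) i u = 0" using z(2) by (simp add: Fr.coord_def)
    then show "cdiff (Fr.coord z (single b \<one>\<^bsub>QA\<^esub>)) i u = 0" using Fr.coord_dif[OF zH m[OF b]] by simp
  qed
  then have "\<forall>b\<in>B. \<exists>y. bounded y \<and> valued y \<and> (\<forall>i u. msupp c i \<longrightarrow> msupp c u \<longrightarrow> mdeg c i = n \<longrightarrow>
      Fr.coord z (single b \<one>\<^bsub>QA\<^esub>) i u = cdiff y i u)" by blast
  from bchoice[OF this] obtain Y where Y: "\<And>b. b \<in> B \<Longrightarrow> bounded (Y b)" "\<And>b. b \<in> B \<Longrightarrow> valued (Y b)"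
    "\<And>b i u. b \<in> B \<Longrightarrow> msupp c i \<Longrightarrow> msupp c u \<Longrightarrow> mdeg c i = n \<Longrightarrow> Fr.coord z (single b \<one>\<^bsub>QA\<^esub>) i u = cdiff (Y b) i u"
    by blast
  \<comment> \<open>The linear maps with coordinates \<open>Y b\<close> at the generators; the gauge factor has to be undone.\<close>
  define y where "y i = extend (\<lambda>b u. if b \<in> B then inverse (q ^ gauge i u) \<cdot> Y b i u else 0)" for i
  have yH: "y i \<in> Fr.Hom_k" for i unfolding y_def
    using Y(2) by (intro extend_Hom_k) (auto simp: valued_def intro!: subspace_scale[OF W_subspace] subspace_0[OF W_subspace])
  have cy: "Fr.coord y (single b \<one>\<^bsub>QA\<^esub>) i u = Y b i u" if b: "b \<in> B" and u: "msupp c u" for b i u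
  proof (cases "u \<in> expo")
    case True
    then show ?thesis using b q_nonzero
      by (simp add: Fr.coord_def xpow_single_unit y_def extend_single flip: mon_def)
  next
    case False
    then have "\<exists>l\<in>{1..c}. a \<le> u l" using u by (auto simp: expo_def msupp_def not_less)
    then show ?thesis using Y(1)[OF b] Fr.bounded_coord[OF yH m[OF b]] unfolding bounded_def by simp
  qed
  have "z i = Fr.dif y i" if i: "msupp c i" "mdeg c i = n" for i
  proof -
    have "z i - Fr.dif y i = 0"
    proof (rule Hom_k_eq_0)
      show "z i - Fr.dif y i \<in> Fr.Hom_k" by (intro Fr.Hom_k_diff zH Fr.dif_Hom_k yH)
      fix b u assume b: "b \<in> B" and "u \<in> expo"
      then have u: "msupp c u" by (simp add: expo_def msupp_def)
      have "Fr.coord (Fr.dif y) (single b \<one>\<^bsub>QA\<^esub>) i u = cdiff (Fr.coord y (single b \<one>\<^bsub>QA\<^esub>)) i u"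
        by (rule Fr.coord_dif[OF yH m[OF b]])
      also have "\<dots> = cdiff (Y b) i u" by (rule cdiff_cong) (simp add: cy b u msupp_upd)
      also have "\<dots> = Fr.coord z (single b \<one>\<^bsub>QA\<^esub>) i u" by (rule Y(3)[symmetric, OF b i(1) u i(2)])
      finally show "(z i - Fr.dif y i) (single b (mon u)) = 0"
        using q_nonzero by (simp add: Fr.coord_def xpow_single_unit flip: mon_def)
    qed
    then show ?thesis by simp
  qed
  with yH show "\<exists>y. (\<forall>i. y i \<in> Fr.Hom_k) \<and> (\<forall>i. msupp c i \<longrightarrow> mdeg c i = n \<longrightarrow> z i = Fr.dif y i)" by blast
qed

text \<open>The coordinates in the basis \<open>x^u e_b\<close> embed the module into a vector space that is a type, where
complements of subspaces are available.\<close>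

definition enc :: "('b \<Rightarrow> (nat list \<Rightarrow> 'k) set) \<Rightarrow> 'b \<times> (nat \<Rightarrow> nat) \<Rightarrow> 'k" where
  "enc y = (\<lambda>(b, u). co (y b) u)"

lemma enc_inj: "inj_on enc (carrier Fr)"
proof (rule inj_onI)
  fix x y assume xy: "x \<in> carrier Fr" "y \<in> carrier Fr" "enc x = enc y"
  show "x = y"
  proof
    fix b
    have "co (x b) u = co (y b) u" for u using fun_cong[OF xy(3), of "(b, u)"] by (simp add: enc_def)
    then show "x b = y b" by (intro co_inj Fr_coord xy)
  qed
qed

theorem projection_exists:
  assumes K: "K \<subseteq> carrier Fr" "\<zero>\<^bsub>Fr\<^esub> \<in> K" "\<And>x y. x \<in> K \<Longrightarrow> y \<in> K \<Longrightarrow> x \<oplus>\<^bsub>Fr\<^esub> y \<in> K"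
    "\<And>r x. x \<in> K \<Longrightarrow> cst r \<odot>\<^bsub>Fr\<^esub> x \<in> K"
  shows "\<exists>\<pi>. (\<forall>x\<in>carrier Fr. \<pi> x \<in> K) \<and> (\<forall>x\<in>K. \<pi> x = x) \<and>
    (\<forall>x\<in>carrier Fr. \<forall>y\<in>carrier Fr. \<pi> (x \<oplus>\<^bsub>Fr\<^esub> y) = \<pi> x \<oplus>\<^bsub>Fr\<^esub> \<pi> y) \<and>
    (\<forall>r. \<forall>x\<in>carrier Fr. \<pi> (cst r \<odot>\<^bsub>Fr\<^esub> x) = cst r \<odot>\<^bsub>Fr\<^esub> \<pi> x)"
proof -
  define s where "s r f = (\<lambda>p. r * f p)" for r :: 'k and f :: "'b \<times> (nat \<Rightarrow> nat) \<Rightarrow> 'k"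
  interpret E: vector_space s
    by unfold_locales (auto simp: s_def algebra_simps)
  interpret EE: vector_space_pair s s by unfold_locales
  have ea: "enc (x \<oplus>\<^bsub>Fr\<^esub> y) = enc x + enc y" if "x \<in> carrier Fr" "y \<in> carrier Fr" for x y
    using that Fr_coord by (auto simp: enc_def Fr_simps co_add)
  have es: "enc (cst r \<odot>\<^bsub>Fr\<^esub> x) = s r (enc x)" if "x \<in> carrier Fr" for x r
    using that Fr_coord by (auto simp: enc_def Fr_simps co_smult s_def)
  have e0: "enc \<zero>\<^bsub>Fr\<^esub> = 0" by (auto simp: enc_def Fr_simps co_zero)
  have "E.subspace (enc ` K)"
  proof (rule E.subspaceI)
    show "0 \<in> enc ` K" using e0 K(2) by (metis imageI)
    show "x + y \<in> enc ` K" if h: "x \<in> enc ` K" "y \<in> enc ` K" for x y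
    proof -
      obtain x' y' where xy: "x' \<in> K" "y' \<in> K" "x = enc x'" "y = enc y'" using h by blast
      then have "x + y = enc (x' \<oplus>\<^bsub>Fr\<^esub> y')" using ea[OF subsetD[OF K(1) xy(1)] subsetD[OF K(1) xy(2)]] by simp
      then show ?thesis using K(3)[OF xy(1,2)] by blast
    qed
    show "s r x \<in> enc ` K" if h: "x \<in> enc ` K" for r x
    proof -
      obtain x' where x: "x' \<in> K" "x = enc x'" using h by blast
      then have "s r x = enc (cst r \<odot>\<^bsub>Fr\<^esub> x')" using es[OF subsetD[OF K(1) x(1)]] by simp
      then show ?thesis using K(4)[OF x(1)] by blast
    qed
  qed
  moreover have "Vector_Spaces.linear s s (\<lambda>x. x)" by unfold_locales auto
  ultimately obtain g where g: "range g \<subseteq> enc ` K" "Vector_Spaces.linear s s g" "\<And>v. v \<in> enc ` K \<Longrightarrow> g v = v"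
    using EE.linear_exists_left_inverse_on[of "\<lambda>x. x" "enc ` K"] by auto
  interpret g: Vector_Spaces.linear s s g by (rule g(2))
  define \<pi> where "\<pi> x = inv_into K enc (g (enc x))" for x
  have inj: "inj_on enc K" using enc_inj K(1) by (rule inj_on_subset)
  have p: "\<pi> x \<in> K" "enc (\<pi> x) = g (enc x)" for x
  proof -
    have "g (enc x) \<in> enc ` K" using g(1) by blast
    then show "\<pi> x \<in> K" "enc (\<pi> x) = g (enc x)" unfolding \<pi>_def by (rule inv_into_into, rule f_inv_into_f)
  qed
  have eq: "\<pi> x = y" if "y \<in> K" "g (enc x) = enc y" for x y
    using that p[of x] inj by (auto dest: inj_onD)
  show ?thesis
  proof (intro exI[of _ \<pi>] conjI ballI allI)
    show "\<pi> x \<in> K" for x by (rule p)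
    show "\<pi> x = x" if "x \<in> K" for x using that g(3) by (intro eq) auto
    fix x assume x: "x \<in> carrier Fr"
    show "\<pi> (cst r \<odot>\<^bsub>Fr\<^esub> x) = cst r \<odot>\<^bsub>Fr\<^esub> \<pi> x" for r
      using K p[of x] x by (intro eq) (auto simp: es g.scale subset_iff)
    show "\<pi> (x \<oplus>\<^bsub>Fr\<^esub> y) = \<pi> x \<oplus>\<^bsub>Fr\<^esub> \<pi> y" if y: "y \<in> carrier Fr" for y
      using K p[of x] p[of y] x y by (intro eq) (auto simp: ea g.add subset_iff)
  qed
qed

end

section \<open>The complex computes Ext\<close>

abbreviation submod :: "('r, 'm) module \<Rightarrow> 'm set \<Rightarrow> ('r, 'm) module" where
  "submod P K \<equiv> P\<lparr>carrier := K\<rparr>"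

lemma submod_left_module:
  assumes P: "left_module R P" and K: "K \<subseteq> carrier P" "\<zero>\<^bsub>P\<^esub> \<in> K"
    "\<And>x y. x \<in> K \<Longrightarrow> y \<in> K \<Longrightarrow> x \<oplus>\<^bsub>P\<^esub> y \<in> K" "\<And>r x. r \<in> carrier R \<Longrightarrow> x \<in> K \<Longrightarrow> r \<odot>\<^bsub>P\<^esub> x \<in> K"
  shows "left_module R (submod P K)"
proof -
  interpret P: left_module R P by fact
  have KP: "x \<in> carrier P" if "x \<in> K" for x using that K(1) by blast
  show ?thesis
  proof (intro left_module.intro left_module_axioms.intro P.R.ring_axioms)
    show "abelian_group (submod P K)"
    proof (rule abelian_groupI)
      fix x assume x: "x \<in> carrier (submod P K)"
      let ?m = "\<ominus>\<^bsub>R\<^esub> \<one>\<^bsub>R\<^esub>"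
      have "?m \<odot>\<^bsub>P\<^esub> x \<oplus>\<^bsub>P\<^esub> x = (?m \<oplus>\<^bsub>R\<^esub> \<one>\<^bsub>R\<^esub>) \<odot>\<^bsub>P\<^esub> x"
        using x KP[of x] by (simp add: P.smult_l_distr P.smult_one)
      also have "\<dots> = \<zero>\<^bsub>P\<^esub>" using x KP[of x] by (simp add: P.R.l_neg P.smult_zero_l)
      finally show "\<exists>y\<in>carrier (submod P K). y \<oplus>\<^bsub>submod P K\<^esub> x = \<zero>\<^bsub>submod P K\<^esub>"
        using x K(4)[of ?m x] by auto
    qed (use K KP in \<open>auto simp: P.M.a_ac\<close>)
  qed (use K KP in \<open>auto simp: P.smult_l_distr P.smult_r_distr P.smult_assoc P.smult_one\<close>)
qed

lemma kernel_closed: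
  assumes P: "left_module R P" and Q: "left_module R Q" and p: "p \<in> mod_hom R P Q" and K: "K = a_kernel P Q p"
  shows "K \<subseteq> carrier P" "\<zero>\<^bsub>P\<^esub> \<in> K" "\<And>x y. x \<in> K \<Longrightarrow> y \<in> K \<Longrightarrow> x \<oplus>\<^bsub>P\<^esub> y \<in> K"
    "\<And>r x. r \<in> carrier R \<Longrightarrow> x \<in> K \<Longrightarrow> r \<odot>\<^bsub>P\<^esub> x \<in> K"
proof -
  interpret P: left_module R P by fact
  interpret Q: left_module R Q by fact
  show "K \<subseteq> carrier P" "\<zero>\<^bsub>P\<^esub> \<in> K" using mod_hom_zero[OF P Q p] by (auto simp: K a_kernel_def')
  show "x \<oplus>\<^bsub>P\<^esub> y \<in> K" if "x \<in> K" "y \<in> K" for x y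
    using that p by (auto simp: K a_kernel_def' mod_hom_def)
  show "r \<odot>\<^bsub>P\<^esub> x \<in> K" if "r \<in> carrier R" "x \<in> K" for r x
    using that p by (auto simp: K a_kernel_def' mod_hom_def P.smult_closed Q.smult_zero_r)
qed

lemma kernel_left_module:
  assumes "left_module R P" "left_module R Q" "p \<in> mod_hom R P Q" "K = a_kernel P Q p"
  shows "left_module R (submod P K)"
  by (rule submod_left_module[OF assms(1)]) (fact kernel_closed[OF assms])+

context qci_target begin

lemma exact_free: "0 < n \<Longrightarrow> exact_mod (free_module QA B) n"
proof -
  assume n: "0 < n"
  interpret F: free_qmodule sc c a q L W B by unfold_locales
  show ?thesis using F.free_exact[OF n] unfolding exact_mod_def .
qed

text \<open>Dimension shifting along \<open>0 \<rightarrow> K \<rightarrow> F \<rightarrow> Q \<rightarrow> 0\<close> with \<open>F\<close> free, for which \<open>C(F)\<close> is acyclic in positive degrees.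
The third part says that homomorphisms on \<open>F\<close> vanishing on \<open>K\<close> factor through \<open>Q\<close>.\<close>

lemma presentation:
  fixes B :: "'b set" and Q :: "((nat list \<Rightarrow> 'k) set, 'm) module" and p
  defines "F \<equiv> free_module QA B"
  assumes Q: "left_module QA Q" and p: "p \<in> mod_hom QA F Q" "p ` carrier F = carrier Q"
    and K: "K = a_kernel F Q p"
  shows "0 < n \<Longrightarrow> exact_mod Q (Suc n) \<longleftrightarrow> exact_mod (submod F K) n"
    and "exact_mod Q (Suc 0) \<longleftrightarrow> (\<forall>f\<in>Hom_A_mod (submod F K). \<exists>g\<in>Hom_A_mod F. \<forall>x\<in>K. g x = f x)"
    and "w \<in> Hom_A_mod F \<Longrightarrow> (\<And>x. x \<in> K \<Longrightarrow> w x = 0) \<Longrightarrow> \<exists>v\<in>Hom_A_mod Q. \<forall>x\<in>carrier F. w x = v (p x)"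
proof -
  interpret F: free_qmodule sc c a q L W B by unfold_locales
  have F: "left_module QA F" unfolding F_def by (rule F.Fr_module)
  note Kc = kernel_closed[OF F Q p(1) K]
  have "\<exists>\<pi>. (\<forall>x\<in>carrier F. \<pi> x \<in> K) \<and> (\<forall>x\<in>K. \<pi> x = x) \<and>
    (\<forall>x\<in>carrier F. \<forall>y\<in>carrier F. \<pi> (x \<oplus>\<^bsub>F\<^esub> y) = \<pi> x \<oplus>\<^bsub>F\<^esub> \<pi> y) \<and>
    (\<forall>r. \<forall>x\<in>carrier F. \<pi> (cst r \<odot>\<^bsub>F\<^esub> x) = cst r \<odot>\<^bsub>F\<^esub> \<pi> x)"
    using F.projection_exists[of K] Kc cst_closed unfolding F_def by blast
  then obtain \<pi> where \<pi>: "\<And>x. x \<in> carrier F \<Longrightarrow> \<pi> x \<in> K" "\<And>x. x \<in> K \<Longrightarrow> \<pi> x = x"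
    "\<And>x y. x \<in> carrier F \<Longrightarrow> y \<in> carrier F \<Longrightarrow> \<pi> (x \<oplus>\<^bsub>F\<^esub> y) = \<pi> x \<oplus>\<^bsub>F\<^esub> \<pi> y"
    "\<And>r x. x \<in> carrier F \<Longrightarrow> \<pi> (cst r \<odot>\<^bsub>F\<^esub> x) = cst r \<odot>\<^bsub>F\<^esub> \<pi> x" by blast
  have "cochain_map_axioms c (carrier F) (add F) (msm F) (mX F) (carrier Q) (add Q) (msm Q) (mX Q) p"
    unfolding cochain_map_axioms_def using p(1) cst_closed var_closed unfolding mod_hom_def by auto
  then have "cochain_map sc c a q L W (carrier F) (add F) (zero F) (msm F) (mX F)
      (carrier Q) (add Q) (zero Q) (msm Q) (mX Q) p"
    by (intro cochain_map.intro cochains_module F Q)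
  moreover have "ses_axioms (carrier F) (add F) (msm F) (carrier Q) (zero Q) p K \<pi>"
    unfolding ses_axioms_def using p(2) \<pi> by (simp add: K a_kernel_def')
  ultimately interpret S: ses sc c a q L W "carrier F" "add F" "zero F" "msm F" "mX F"
      "carrier Q" "add Q" "zero Q" "msm Q" "mX Q" p K \<pi> by (rule ses.intro)
  have FX: "exact_mod F n \<longleftrightarrow> S.A.exact_at n" and QX: "exact_mod Q n \<longleftrightarrow> S.B.exact_at n"
    and KX: "exact_mod (submod F K) n \<longleftrightarrow> S.K.exact_at n"
    and R: "Hom_A_mod F = S.A.Hom_A" "Hom_A_mod Q = S.B.Hom_A" "Hom_A_mod (submod F K) = S.K.Hom_A" for n
    unfolding exact_mod_def Hom_A_mod_def by simp_all
  have ex: "S.A.exact_at n" if "0 < n" for n using exact_free[OF that, of B] FX unfolding F_def by blast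
  show "exact_mod Q (Suc n) \<longleftrightarrow> exact_mod (submod F K) n" if "0 < n"
    unfolding QX KX using ex that S.exact_quotient_imp_lifts S.lifts_imp_exact_quotient
      S.exact_sub_imp_lifts S.lifts_imp_exact_sub by blast
  have r: "S.restr g = f \<longleftrightarrow> (\<forall>x\<in>K. g x = f x)" if "f \<in> S.K.Hom_A" for f g
  proof -
    have f0: "x \<notin> K \<Longrightarrow> f x = 0" for x using that S.K.Hom_kD(2) by (auto simp: S.K.Hom_A_def)
    show ?thesis
    proof
      assume "S.restr g = f"
      then show "\<forall>x\<in>K. g x = f x" by (auto simp: S.incl.pull_def)
    next
      assume "\<forall>x\<in>K. g x = f x"
      then show "S.restr g = f" by (intro HOL.ext) (simp add: S.incl.pull_def f0)
    qed
  qed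
  show "exact_mod Q (Suc 0) \<longleftrightarrow> (\<forall>f\<in>Hom_A_mod (submod F K). \<exists>g\<in>Hom_A_mod F. \<forall>x\<in>K. g x = f x)"
  proof -
    have "S.B.exact_at (Suc 0) \<longleftrightarrow> S.lifts 0"
      using ex[of "Suc 0"] S.exact_quotient_imp_lifts S.lifts_imp_exact_quotient by blast
    then show ?thesis unfolding QX R S.lifts_0 using r by (simp cong: ball_cong bex_cong)
  qed
  show "\<exists>v\<in>Hom_A_mod Q. \<forall>x\<in>carrier F. w x = v (p x)" if w: "w \<in> Hom_A_mod F" "\<And>x. x \<in> K \<Longrightarrow> w x = 0"
  proof -
    obtain v where v: "v \<in> S.B.Hom_k" "w = S.pull v"
      using S.factor[of w] w unfolding R S.A.Hom_A_def by blast
    have vp: "w x = v (p x)" if "x \<in> carrier F" for x using that v(2) by (simp add: S.pull_def)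
    have "v (var l \<odot>\<^bsub>Q\<^esub> y) = L l (v y)" if l: "l \<in> {1..c}" and y: "y \<in> carrier Q" for l y
    proof -
      obtain x where x: "x \<in> carrier F" "y = p x" using p(2) y by auto
      have "v (var l \<odot>\<^bsub>Q\<^esub> y) = w (var l \<odot>\<^bsub>F\<^esub> x)"
        using vp[OF S.A.X_closed[OF l x(1)]] S.p_X[OF l x(1)] x(2) by simp
      also have "\<dots> = L l (w x)" using w(1) l x(1) unfolding R S.A.Hom_A_def by blast
      finally show ?thesis using vp[OF x(1)] x(2) by simp
    qed
    then have "v \<in> Hom_A_mod Q" unfolding R S.B.Hom_A_def using v(1) by blast
    then show ?thesis using vp by blast
  qed
qed

end

text \<open>The quotient group of cocycles by coboundaries, unfolded to a statement about homomorphisms.\<close>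

lemma trivial_cohomology_iff:
  fixes R :: "'r ring" and M :: "('r, 'm) module" and N :: "('r, 'n) module"
  assumes M: "left_module R M" and N: "left_module R N" and res: "free_resolution R M B d e"
  shows "trivial_group (cohomology R B d N (Suc n)) \<longleftrightarrow>
    (\<forall>\<phi>\<in>mod_hom R (free_module R (B (Suc n))) N.
      (\<forall>x\<in>carrier (free_module R (B (Suc (Suc n)))). \<phi> (d (Suc n) x) = \<zero>\<^bsub>N\<^esub>) \<longrightarrow>
      (\<exists>\<psi>\<in>mod_hom R (free_module R (B n)) N. \<forall>x\<in>carrier (free_module R (B (Suc n))). \<phi> x = \<psi> (d n x)))"
proof -
  interpret M: left_module R M by fact
  let ?F = "\<lambda>n. free_module R (B n)"
  let ?H = "hom_group R (?F (Suc n)) N"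
  let ?Z = "cocycles R B d N (Suc n)" and ?D = "coboundaries R B d N (Suc n)"
  let ?G = "cohomology R B d N (Suc n)"
  have F: "left_module R (?F n)" for n by (rule free_module_left_module[OF M.R.ring_axioms])
  interpret H: comm_group ?H by (rule hom_group_comm_group[OF F N])
  have d: "d n \<in> mod_hom R (?F (Suc n)) (?F n)" for n using res by (simp add: free_resolution_def Let_def)
  have dx: "d n x \<in> carrier (?F n)" if "x \<in> carrier (?F (Suc n))" for n x
    using d[of n] that unfolding mod_hom_def by blast
  have G: "Group.group ?G" by (rule comm_group.axioms(2)[OF cohomology_comm_group[OF M N res]])
  have Zc: "\<phi> \<in> ?Z \<longleftrightarrow> \<phi> \<in> mod_hom R (?F (Suc n)) N \<and> (\<forall>x\<in>carrier (?F (Suc (Suc n))). \<phi> (d (Suc n) x) = \<zero>\<^bsub>N\<^esub>)" for \<phi>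
    by (auto simp: cocycles_def kernel_def codiff_def compose_def hom_group_def restrict_def fun_eq_iff)
  have ext: "\<phi> x = undefined" if "\<phi> \<in> mod_hom R (?F (Suc n)) N" "x \<notin> carrier (?F (Suc n))" for \<phi> x
    using that by (auto simp: mod_hom_def PiE_def extensional_def)
  have Dc: "\<phi> \<in> ?D \<longleftrightarrow> (\<exists>\<psi>\<in>mod_hom R (?F n) N. \<forall>x\<in>carrier (?F (Suc n)). \<phi> x = \<psi> (d n x))"
    if "\<phi> \<in> mod_hom R (?F (Suc n)) N" for \<phi>
  proof -
    have "\<phi> = codiff R B d n \<psi> \<longleftrightarrow> (\<forall>x\<in>carrier (?F (Suc n)). \<phi> x = \<psi> (d n x))" for \<psi>
      using ext[OF that] by (auto simp: codiff_def compose_def restrict_def fun_eq_iff)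
    then show ?thesis by (auto simp: hom_group_def image_iff)
  qed
  have D_sub: "subgroup ?D ?H"
  proof -
    interpret F: left_module R "?F (Suc n)" by (rule F)
    have "codiff R B d n \<psi> \<in> mod_hom R (?F (Suc n)) N" if \<psi>: "\<psi> \<in> mod_hom R (?F n) N" for \<psi>
    proof -
      have "\<psi> (d n (x \<oplus>\<^bsub>?F (Suc n)\<^esub> y)) = \<psi> (d n x) \<oplus>\<^bsub>N\<^esub> \<psi> (d n y)"
        "r \<in> carrier R \<Longrightarrow> \<psi> (d n (r \<odot>\<^bsub>?F (Suc n)\<^esub> x)) = r \<odot>\<^bsub>N\<^esub> \<psi> (d n x)"
        "\<psi> (d n x) \<in> carrier N"
        if "x \<in> carrier (?F (Suc n))" "y \<in> carrier (?F (Suc n))" for x y r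
        using that \<psi> d[of n] dx unfolding mod_hom_def by auto
      then show ?thesis
        by (auto simp: mod_hom_def[of R "?F (Suc n)"] codiff_def compose_def F.smult_closed)
    qed
    then have "codiff R B d n \<in> Group.hom (hom_group R (?F n) N) ?H"
      using dx by (intro homI) (auto simp: hom_group_def codiff_def compose_def intro!: restrict_ext)
    then have "group_hom (hom_group R (?F n) N) ?H (codiff R B d n)"
      using comm_group.axioms(2)[OF hom_group_comm_group[OF F N]] H.is_group
      by (simp add: group_hom_def group_hom_axioms_def)
    then show ?thesis using group_hom.img_is_subgroup by fastforce
  qed
  have ZH: "?Z \<subseteq> carrier ?H" by (auto simp: Zc hom_group_def)
  have car: "carrier ?G = (\<lambda>z. ?D #>\<^bsub>?H\<^esub> z) ` ?Z"
    by (auto simp: cohomology_def FactGroup_def RCOSETS_def r_coset_def)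
  have one: "\<one>\<^bsub>?G\<^esub> = ?D" by (simp add: cohomology_def FactGroup_def)
  have "trivial_group ?G \<longleftrightarrow> ?Z \<subseteq> ?D"
  proof
    assume t: "trivial_group ?G"
    show "?Z \<subseteq> ?D"
    proof
      fix z assume z: "z \<in> ?Z"
      then have "?D #>\<^bsub>?H\<^esub> z \<in> carrier ?G" unfolding car by (rule imageI)
      moreover have "carrier ?G = {?D}" using t unfolding trivial_group_def one by blast
      ultimately have "?D #>\<^bsub>?H\<^esub> z = ?D" by blast
      then show "z \<in> ?D" using H.coset_join1[OF _ _ D_sub] ZH z subgroup.subset[OF D_sub] by blast
    qed
  next
    assume "?Z \<subseteq> ?D"
    then have "carrier ?G \<subseteq> {\<one>\<^bsub>?G\<^esub>}" unfolding car one
      using H.coset_join2[OF _ D_sub] ZH by blast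
    then show "trivial_group ?G" by (simp add: group.trivial_group_subset[OF G])
  qed
  moreover have "?Z \<subseteq> ?D \<longleftrightarrow> (\<forall>\<phi>\<in>mod_hom R (?F (Suc n)) N. \<phi> \<in> ?Z \<longrightarrow> \<phi> \<in> ?D)" using Zc by blast
  ultimately show ?thesis using Zc Dc by (simp cong: ball_cong)
qed

text \<open>The module \<open>N\<close> together with linear coordinates \<open>\<nu>\<close> identifying it with \<open>W\<close>.\<close>

locale qci_ext = qci_target sc c a q L W
  for sc :: "'k::field \<Rightarrow> 'w::ab_group_add \<Rightarrow> 'w" (infixr "\<cdot>" 75)
    and c a :: nat and q :: 'k and L :: "nat \<Rightarrow> 'w \<Rightarrow> 'w" and W :: "'w set" +
  fixes N :: "((nat list \<Rightarrow> 'k) set, 'n) module" and \<nu> :: "'n \<Rightarrow> 'w"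
  assumes N: "left_module QA N" and \<nu>_bij: "bij_betw \<nu> (carrier N) W"
    and \<nu>_add: "\<lbrakk>x \<in> carrier N; y \<in> carrier N\<rbrakk> \<Longrightarrow> \<nu> (x \<oplus>\<^bsub>N\<^esub> y) = \<nu> x + \<nu> y"
    and \<nu>_cst: "x \<in> carrier N \<Longrightarrow> \<nu> (cst r \<odot>\<^bsub>N\<^esub> x) = r \<cdot> \<nu> x"
    and \<nu>_var: "\<lbrakk>l \<in> {1..c}; x \<in> carrier N\<rbrakk> \<Longrightarrow> \<nu> (var l \<odot>\<^bsub>N\<^esub> x) = L l (\<nu> x)"
begin

interpretation N: left_module QA N by (rule N)

lemma \<nu>_closed: "x \<in> carrier N \<Longrightarrow> \<nu> x \<in> W" using \<nu>_bij bij_betwE by blast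

lemma \<nu>_inj: "x \<in> carrier N \<Longrightarrow> y \<in> carrier N \<Longrightarrow> \<nu> x = \<nu> y \<Longrightarrow> x = y"
  using \<nu>_bij by (auto simp: bij_betw_def dest: inj_onD)

definition \<mu> :: "'w \<Rightarrow> 'n" where "\<mu> = inv_into (carrier N) \<nu>"

lemma \<mu>: "x \<in> W \<Longrightarrow> \<mu> x \<in> carrier N" "x \<in> W \<Longrightarrow> \<nu> (\<mu> x) = x"
  using \<nu>_bij unfolding \<mu>_def bij_betw_def by (metis inv_into_into, metis f_inv_into_f)

lemma Hom_A_modD:
  assumes P: "left_module QA P" and f: "f \<in> Hom_A_mod P"
  shows "f x \<in> W" "x \<in> carrier P \<Longrightarrow> y \<in> carrier P \<Longrightarrow> f (x \<oplus>\<^bsub>P\<^esub> y) = f x + f y"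
    "x \<in> carrier P \<Longrightarrow> f (cst r \<odot>\<^bsub>P\<^esub> x) = r \<cdot> f x"
    "l \<in> {1..c} \<Longrightarrow> x \<in> carrier P \<Longrightarrow> f (var l \<odot>\<^bsub>P\<^esub> x) = L l (f x)"
    "f \<zero>\<^bsub>P\<^esub> = 0"
proof -
  interpret C: cochains sc c a q L W "carrier P" "add P" "zero P" "msm P" "mX P" by (rule cochains_module[OF P])
  have f: "f \<in> C.Hom_k" "\<And>l x. l \<in> {1..c} \<Longrightarrow> x \<in> carrier P \<Longrightarrow> f (var l \<odot>\<^bsub>P\<^esub> x) = L l (f x)"
    using f unfolding Hom_A_mod_def C.Hom_A_def by auto
  show "f x \<in> W" "x \<in> carrier P \<Longrightarrow> y \<in> carrier P \<Longrightarrow> f (x \<oplus>\<^bsub>P\<^esub> y) = f x + f y"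
    "x \<in> carrier P \<Longrightarrow> f (cst r \<odot>\<^bsub>P\<^esub> x) = r \<cdot> f x"
    "l \<in> {1..c} \<Longrightarrow> x \<in> carrier P \<Longrightarrow> f (var l \<odot>\<^bsub>P\<^esub> x) = L l (f x)"
    "f \<zero>\<^bsub>P\<^esub> = 0"
    using C.Hom_kD[OF f(1)] C.Hom_k_ze[OF f(1)] f(2) by blast+
qed

lemma xpow_smult:
  assumes P: "left_module QA P" and x: "x \<in> carrier P" and r: "r \<in> carrier QA" and n: "n \<le> c"
  shows "xpow (\<lambda>l x. var l \<otimes>\<^bsub>QA\<^esub> x) u n r \<odot>\<^bsub>P\<^esub> x = xpow (mX P) u n (r \<odot>\<^bsub>P\<^esub> x)"
  using n
proof (induction n)
  case (Suc n)
  interpret P: left_module QA P by fact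
  have S: "Suc n \<in> {1..c}" using Suc.prems by simp
  have "((\<lambda>x. var (Suc n) \<otimes>\<^bsub>QA\<^esub> x) ^^ t) y \<odot>\<^bsub>P\<^esub> x = (mX P (Suc n) ^^ t) (y \<odot>\<^bsub>P\<^esub> x)" if "y \<in> carrier QA" for t y
    using that x by (induction t) (simp_all add: P.smult_assoc var_closed[OF S] Reg.Xpow_closed[OF S])
  then show ?case using Suc r by (simp add: Reg.xpow_closed)
qed simp

text \<open>Commuting with the scalars and the variables is enough for linearity over the whole algebra, since these
generate it.  The inverse \<open>\<mu>\<close> of the coordinates brings values back to \<open>N\<close>.\<close>

lemma Hom_A_linear:
  assumes P: "left_module QA P" and f: "f \<in> Hom_A_mod P" and x: "x \<in> carrier P" and r: "r \<in> carrier QA"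
  shows "f (r \<odot>\<^bsub>P\<^esub> x) = \<nu> (r \<odot>\<^bsub>N\<^esub> \<mu> (f x))"
proof -
  interpret P: left_module QA P by fact
  note fD = Hom_A_modD[OF P f]
  have m: "\<mu> (f x) \<in> carrier N" "\<nu> (\<mu> (f x)) = f x" using \<mu> fD(1) by auto
  interpret PC: qrep c a q "carrier P" "add P" "zero P" "msm P" "mX P" by (rule module_qrep[OF P])
  interpret NC: qrep c a q "carrier N" "add N" "zero N" "msm N" "mX N" by (rule module_qrep[OF N])
  have "r \<in> kspan" using r kspan_eq by simp
  then show ?thesis
  proof (induction rule: kspan.induct)
    case (mon u)
    have "f (xpow (mX P) u n x) = \<nu> (xpow (mX N) u n (\<mu> (f x)))" if "n \<le> c" for n
      using that
    proof (induction n)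
      case (Suc n)
      have S: "Suc n \<in> {1..c}" using Suc.prems by simp
      have a: "f ((mX P (Suc n) ^^ t) y) = (L (Suc n) ^^ t) (f y)" if "y \<in> carrier P" for t y
        using that by (induction t) (simp_all add: fD(4)[OF S] PC.Xpow_closed[OF S])
      have b: "\<nu> ((mX N (Suc n) ^^ t) y) = (L (Suc n) ^^ t) (\<nu> y)" if "y \<in> carrier N" for t y
        using that by (induction t) (simp_all add: \<nu>_var[OF S] NC.Xpow_closed[OF S])
      show ?case using Suc x m by (simp add: a b PC.xpow_closed NC.xpow_closed)
    qed (simp add: m)
    then show ?case
      using xpow_smult[OF P x QA.one_closed order.refl, of u] xpow_smult[OF N m(1) QA.one_closed order.refl, of u] x m
      by (simp add: mon_def P.smult_one N.smult_one)
  next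
    case zero
    have "\<nu> \<zero>\<^bsub>N\<^esub> = 0" using \<nu>_cst[OF N.M.zero_closed, of 0] by (simp add: cst_0 N.smult_zero_l)
    then show ?case using x m fD(5) by (simp add: P.smult_zero_l N.smult_zero_l)
  next
    case (add r s)
    then have "r \<in> carrier QA" "s \<in> carrier QA" using kspan_sub by auto
    then show ?case using add x m by (simp add: P.smult_l_distr N.smult_l_distr fD(2) \<nu>_add P.smult_closed N.smult_closed)
  next
    case (smult r t)
    then have "r \<in> carrier QA" using kspan_sub by auto
    then show ?case using smult x m
      by (simp add: P.smult_assoc N.smult_assoc cst_closed fD(3) \<nu>_cst P.smult_closed N.smult_closed)
  qed
qed

lemma mod_hom_to_Hom_A:
  assumes P: "left_module QA P" and f: "f \<in> mod_hom QA P N"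
  shows "(\<lambda>x. if x \<in> carrier P then \<nu> (f x) else 0) \<in> Hom_A_mod P"
proof -
  interpret P: left_module QA P by fact
  interpret C: cochains sc c a q L W "carrier P" "add P" "zero P" "msm P" "mX P" by (rule cochains_module[OF P])
  have f: "\<And>x. x \<in> carrier P \<Longrightarrow> f x \<in> carrier N" "\<And>x y. x \<in> carrier P \<Longrightarrow> y \<in> carrier P \<Longrightarrow> f (x \<oplus>\<^bsub>P\<^esub> y) = f x \<oplus>\<^bsub>N\<^esub> f y"
    "\<And>r x. r \<in> carrier QA \<Longrightarrow> x \<in> carrier P \<Longrightarrow> f (r \<odot>\<^bsub>P\<^esub> x) = r \<odot>\<^bsub>N\<^esub> f x"
    using f unfolding mod_hom_def by auto
  show ?thesis unfolding Hom_A_mod_def C.Hom_A_def C.Hom_k_def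
    by (auto simp: f \<nu>_closed \<nu>_add \<nu>_cst \<nu>_var cst_closed var_closed P.smult_closed)
qed

lemma Hom_A_to_mod_hom:
  assumes P: "left_module QA P" and f: "f \<in> Hom_A_mod P"
  shows "(\<lambda>x\<in>carrier P. \<mu> (f x)) \<in> mod_hom QA P N"
proof -
  interpret P: left_module QA P by fact
  note fD = Hom_A_modD[OF P f]
  note m = \<mu>(1)[OF fD(1)] \<mu>(2)[OF fD(1)]
  have "\<mu> (f (x \<oplus>\<^bsub>P\<^esub> y)) = \<mu> (f x) \<oplus>\<^bsub>N\<^esub> \<mu> (f y)" if "x \<in> carrier P" "y \<in> carrier P" for x y
    by (rule \<nu>_inj) (simp_all add: m \<nu>_add fD(2) \<mu> subspace_add[OF W_subspace fD(1) fD(1)] that)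
  moreover have "\<mu> (f (r \<odot>\<^bsub>P\<^esub> x)) = r \<odot>\<^bsub>N\<^esub> \<mu> (f x)" if "r \<in> carrier QA" "x \<in> carrier P" for r x
    by (rule \<nu>_inj) (simp_all add: m N.smult_closed that Hom_A_linear[OF P f] \<mu> \<nu>_closed)
  ultimately show ?thesis using m by (auto simp: mod_hom_def P.smult_closed)
qed


text \<open>Let \<open>S k\<close> be the image of the \<open>k\<close>-th differential of the chosen resolution, contained in the free
module \<open>F k\<close>.  Dimension shifting through the sequences \<open>0 \<rightarrow> S 0 \<rightarrow> F 0 \<rightarrow> M \<rightarrow> 0\<close> and
\<open>0 \<rightarrow> S (k+1) \<rightarrow> F (k+1) \<rightarrow> S k \<rightarrow> 0\<close> reduces exactness in degree \<open>n + 1\<close> to the statement \<open>E n\<close> that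
homomorphisms \<open>S n \<rightarrow> N\<close> extend to \<open>F n\<close>.  A cocycle \<open>F (n+1) \<rightarrow> N\<close> is the same as such a homomorphism, and
it is a coboundary iff the homomorphism extends.\<close>

theorem trivial_Ext_iff:
  assumes M: "left_module QA M"
  shows "trivial_group (Ext QA M N (Suc n)) \<longleftrightarrow> exact_mod M (Suc n)"
proof -
  obtain B :: "nat \<Rightarrow> (_, _) gen set" and d e where res: "free_resolution QA M B d e"
    and Ext: "\<And>n. Ext QA M N n = cohomology QA B d N n"
    using Ext_resolution[OF M] by metis
  define F where "F n = free_module QA (B n)" for n
  define S where "S k = submod (F k) (d k ` carrier (F (Suc k)))" for k
  have F: "left_module QA (F k)" for k unfolding F_def by (rule free_module_left_module[OF QA.ring_axioms])
  have e: "e \<in> mod_hom QA (F 0) M" "e ` carrier (F 0) = carrier M"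
    and d: "d k \<in> mod_hom QA (F (Suc k)) (F k)"
    and im: "d 0 ` carrier (F (Suc 0)) = a_kernel (F 0) M e"
      "d (Suc k) ` carrier (F (Suc (Suc k))) = a_kernel (F (Suc k)) (F k) (d k)" for k
    using res unfolding free_resolution_def Let_def F_def by blast+
  have im_closed: "d k ` carrier (F (Suc k)) \<subseteq> carrier (F k)" "left_module QA (S k)" for k
  proof -
    have "d k ` carrier (F (Suc k)) \<subseteq> carrier (F k) \<and> left_module QA (S k)"
    proof (cases k)
      case 0
      show ?thesis unfolding S_def 0
        by (intro conjI kernel_closed(1)[OF F M e(1) im(1)] kernel_left_module[OF F M e(1) im(1)])
    next
      case (Suc k')
      show ?thesis unfolding S_def Suc
        by (intro conjI kernel_closed(1)[OF F F d im(2)] kernel_left_module[OF F F d im(2)])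
    qed
    then show "d k ` carrier (F (Suc k)) \<subseteq> carrier (F k)" "left_module QA (S k)" by blast+
  qed
  have cS: "carrier (S k) = d k ` carrier (F (Suc k))" for k by (simp add: S_def)
  have dS: "d k \<in> mod_hom QA (F (Suc k)) (S k)" for k
    using d[of k] by (auto simp: mod_hom_def S_def)
  have kS: "d (Suc k) ` carrier (F (Suc (Suc k))) = a_kernel (F (Suc k)) (S k) (d k)" for k
    unfolding im(2) by (simp add: a_kernel_def' S_def)
  define E where "E k \<longleftrightarrow> (\<forall>f\<in>Hom_A_mod (S k). \<exists>g\<in>Hom_A_mod (F k). \<forall>x\<in>carrier (S k). g x = f x)" for k
  note base = presentation[OF M e(1)[unfolded F_def] e(2)[unfolded F_def] im(1)[unfolded F_def], folded F_def]
  note step = presentation[OF im_closed(2) dS[unfolded F_def] cS[symmetric, unfolded F_def] kS[unfolded F_def], folded F_def]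
  have S_eq: "exact_mod (S k) (Suc n) \<longleftrightarrow> E (k + Suc n)" for k n
  proof (induction n arbitrary: k)
    case 0
    have "exact_mod (S k) (Suc 0) \<longleftrightarrow> E (Suc k)"
      using step(2)[of k] unfolding E_def S_def[of "Suc k"] by simp
    then show ?case by simp
  next
    case (Suc n)
    have "exact_mod (S k) (Suc (Suc n)) \<longleftrightarrow> exact_mod (S (Suc k)) (Suc n)"
      using step(1)[of "Suc n" k] unfolding S_def[of "Suc k"] by simp
    then show ?case using Suc[of "Suc k"] by simp
  qed
  have "exact_mod M (Suc n) \<longleftrightarrow> E n"
  proof (cases n)
    case 0
    show ?thesis using base(2) unfolding E_def S_def[of 0] 0 by simp
  next
    case (Suc m)
    show ?thesis using base(1)[of "Suc m"] S_eq[of 0 m] unfolding S_def[of 0] Suc by simp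
  qed
  moreover have "trivial_group (cohomology QA B d N (Suc n)) \<longleftrightarrow> E n"
    unfolding trivial_cohomology_iff[OF M N res] F_def[symmetric]
  proof
    assume triv: "\<forall>\<phi>\<in>mod_hom QA (F (Suc n)) N.
      (\<forall>x\<in>carrier (F (Suc (Suc n))). \<phi> (d (Suc n) x) = \<zero>\<^bsub>N\<^esub>) \<longrightarrow>
      (\<exists>\<psi>\<in>mod_hom QA (F n) N. \<forall>x\<in>carrier (F (Suc n)). \<phi> x = \<psi> (d n x))"
    show "E n" unfolding E_def
    proof
      fix f assume f: "f \<in> Hom_A_mod (S n)"
      define h where "h = (\<lambda>y\<in>carrier (S n). \<mu> (f y))"
      have h: "h \<in> mod_hom QA (S n) N" unfolding h_def by (rule Hom_A_to_mod_hom[OF im_closed(2) f])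
      define \<phi> where "\<phi> = (\<lambda>x\<in>carrier (F (Suc n)). h (d n x))"
      have dn: "d n x \<in> carrier (S n)" if "x \<in> carrier (F (Suc n))" for x using that cS by blast
      interpret Fn: left_module QA "F (Suc n)" by (rule F)
      have "\<phi> \<in> mod_hom QA (F (Suc n)) N"
        using h dS[of n] dn unfolding mod_hom_def by (auto simp: \<phi>_def Fn.smult_closed)
      moreover have "\<phi> (d (Suc n) x) = \<zero>\<^bsub>N\<^esub>" if x: "x \<in> carrier (F (Suc (Suc n)))" for x
      proof -
        have "d (Suc n) x \<in> a_kernel (F (Suc n)) (S n) (d n)" using x kS by blast
        then have "d (Suc n) x \<in> carrier (F (Suc n))" "d n (d (Suc n) x) = \<zero>\<^bsub>S n\<^esub>" by (auto simp: a_kernel_def')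
        then show ?thesis using mod_hom_zero[OF im_closed(2) N h] by (simp add: \<phi>_def)
      qed
      ultimately obtain \<psi> where \<psi>: "\<psi> \<in> mod_hom QA (F n) N" "\<And>x. x \<in> carrier (F (Suc n)) \<Longrightarrow> \<phi> x = \<psi> (d n x)"
        using triv by blast
      let ?g = "\<lambda>x. if x \<in> carrier (F n) then \<nu> (\<psi> x) else 0"
      have gf: "?g x = f x" if x: "x \<in> carrier (S n)" for x
      proof -
        obtain y where y: "y \<in> carrier (F (Suc n))" "x = d n y" using x cS by auto
        have "x \<in> carrier (F n)" using x cS im_closed(1) by blast
        moreover have "\<psi> x = \<mu> (f x)" using \<psi>(2)[OF y(1)] y x by (simp add: \<phi>_def h_def)
        ultimately show ?thesis using \<mu>(2)[OF Hom_A_modD(1)[OF im_closed(2) f]] by simp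
      qed
      show "\<exists>g\<in>Hom_A_mod (F n). \<forall>x\<in>carrier (S n). g x = f x"
        by (rule bexI[OF _ mod_hom_to_Hom_A[OF F \<psi>(1)]]) (intro ballI gf)
    qed
  next
    assume E: "E n"
    show "\<forall>\<phi>\<in>mod_hom QA (F (Suc n)) N.
      (\<forall>x\<in>carrier (F (Suc (Suc n))). \<phi> (d (Suc n) x) = \<zero>\<^bsub>N\<^esub>) \<longrightarrow>
      (\<exists>\<psi>\<in>mod_hom QA (F n) N. \<forall>x\<in>carrier (F (Suc n)). \<phi> x = \<psi> (d n x))"
    proof (intro ballI impI)
      fix \<phi> assume \<phi>: "\<phi> \<in> mod_hom QA (F (Suc n)) N"
        "\<forall>x\<in>carrier (F (Suc (Suc n))). \<phi> (d (Suc n) x) = \<zero>\<^bsub>N\<^esub>"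
      let ?w = "\<lambda>x. if x \<in> carrier (F (Suc n)) then \<nu> (\<phi> x) else 0"
      have w: "?w \<in> Hom_A_mod (F (Suc n))" by (rule mod_hom_to_Hom_A[OF F \<phi>(1)])
      have \<nu>0: "\<nu> \<zero>\<^bsub>N\<^esub> = 0" using \<nu>_cst[OF N.M.zero_closed, of 0] by (simp add: cst_0 N.smult_zero_l)
      have w0: "?w x = 0" if "x \<in> d (Suc n) ` carrier (F (Suc (Suc n)))" for x using that \<phi>(2) \<nu>0 by auto
      have "\<exists>v\<in>Hom_A_mod (S n). \<forall>x\<in>carrier (F (Suc n)). ?w x = v (d n x)"
        by (rule step(3)[OF w]) (rule w0)
      then obtain v where v: "v \<in> Hom_A_mod (S n)" "\<forall>x\<in>carrier (F (Suc n)). ?w x = v (d n x)" ..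
      obtain g where g: "g \<in> Hom_A_mod (F n)" "\<forall>x\<in>carrier (S n). g x = v x"
        using bspec[OF E[unfolded E_def] v(1)] ..
      have \<phi>g: "\<phi> x = (\<lambda>y\<in>carrier (F n). \<mu> (g y)) (d n x)" if x: "x \<in> carrier (F (Suc n))" for x
      proof -
        have dx: "d n x \<in> carrier (S n)" "d n x \<in> carrier (F n)" using x cS im_closed(1) by blast+
        have "\<phi> x \<in> carrier N" using \<phi>(1) x by (auto simp: mod_hom_def)
        moreover have "\<nu> (\<phi> x) = g (d n x)" using bspec[OF v(2) x] bspec[OF g(2) dx(1)] x by simp
        ultimately have "\<phi> x = \<mu> (g (d n x))"
          using \<mu>[OF Hom_A_modD(1)[OF F g(1)]] by (intro \<nu>_inj) simp_all
        then show ?thesis using dx by simp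
      qed
      show "\<exists>\<psi>\<in>mod_hom QA (F n) N. \<forall>x\<in>carrier (F (Suc n)). \<phi> x = \<psi> (d n x)"
        by (rule bexI[OF _ Hom_A_to_mod_hom[OF F g(1)]]) (intro ballI \<phi>g)
    qed
  qed
  ultimately show ?thesis by (simp add: Ext)
qed

end

section \<open>Linear coordinates and the trichotomy\<close>

context qci begin

definition k_closed :: "((nat list \<Rightarrow> 'k) set, 'm) module \<Rightarrow> 'm set \<Rightarrow> bool" where
  "k_closed P S \<longleftrightarrow> \<zero>\<^bsub>P\<^esub> \<in> S \<and> (\<forall>x\<in>S. \<forall>y\<in>S. x \<oplus>\<^bsub>P\<^esub> y \<in> S) \<and> (\<forall>r. \<forall>x\<in>S. cst r \<odot>\<^bsub>P\<^esub> x \<in> S)"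

text \<open>Spanning is expressed by minimality among \<open>k\<close>-subspaces, which avoids linear combinations.\<close>

definition k_spans :: "((nat list \<Rightarrow> 'k) set, 'm) module \<Rightarrow> 'm set \<Rightarrow> bool" where
  "k_spans P T \<longleftrightarrow> T \<subseteq> carrier P \<and> (\<forall>S. k_closed P S \<longrightarrow> T \<subseteq> S \<longrightarrow> carrier P \<subseteq> S)"

lemma finite_k_span:
  assumes P: "left_module QA P" and fg: "finitely_generated QA P"
  shows "\<exists>T. finite T \<and> k_spans P T"
proof -
  interpret P: left_module QA P by fact
  obtain G where G: "finite G" "G \<subseteq> carrier P"
    and gen: "\<And>x. x \<in> carrier P \<Longrightarrow> \<exists>r\<in>G \<rightarrow> carrier QA. x = (\<Oplus>\<^bsub>P\<^esub>s\<in>G. r s \<odot>\<^bsub>P\<^esub> s)"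
    using fg unfolding finitely_generated_def by blast
  let ?T = "(\<lambda>(u, s). mon u \<odot>\<^bsub>P\<^esub> s) ` (expo \<times> G)"
  have "k_spans P ?T" unfolding k_spans_def
  proof (intro conjI allI impI)
    show "?T \<subseteq> carrier P" using G by (auto intro!: P.smult_closed mon_closed)
    fix S assume S: "k_closed P S" "?T \<subseteq> S"
    have rs: "r \<odot>\<^bsub>P\<^esub> s \<in> S" if r: "r \<in> carrier QA" and s: "s \<in> G" for r s
    proof -
      have sP: "s \<in> carrier P" using s G by blast
      have "r \<in> kspan" using r kspan_eq by simp
      then show ?thesis
      proof (induction rule: kspan.induct)
        case (mon u)
        then show ?case using S(2) s by auto
      next
        case zero
        then show ?case using S(1) sP by (simp add: k_closed_def P.smult_zero_l)
      next
        case (add x y)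
        then show ?case using S(1) sP kspan_sub by (simp add: k_closed_def P.smult_l_distr)
      next
        case (smult x t)
        then show ?case using S(1) sP kspan_sub by (simp add: k_closed_def P.smult_assoc cst_closed)
      qed
    qed
    show "carrier P \<subseteq> S"
    proof
      fix x assume "x \<in> carrier P"
      then obtain r where r: "r \<in> G \<rightarrow> carrier QA" "x = (\<Oplus>\<^bsub>P\<^esub>s\<in>G. r s \<odot>\<^bsub>P\<^esub> s)" using gen by blast
      have "(\<Oplus>\<^bsub>P\<^esub>s\<in>H. r s \<odot>\<^bsub>P\<^esub> s) \<in> S" if "finite H" "H \<subseteq> G" for H
        using that
      proof (induction H rule: finite_induct)
        case empty
        then show ?case using S(1) by (simp add: k_closed_def)
      next
        case (insert s H)
        have "r t \<odot>\<^bsub>P\<^esub> t \<in> carrier P" if "t \<in> G" for t using that r(1) G by (auto intro!: P.smult_closed)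
        then have "(\<Oplus>\<^bsub>P\<^esub>s\<in>insert s H. r s \<odot>\<^bsub>P\<^esub> s) = r s \<odot>\<^bsub>P\<^esub> s \<oplus>\<^bsub>P\<^esub> (\<Oplus>\<^bsub>P\<^esub>s\<in>H. r s \<odot>\<^bsub>P\<^esub> s)"
          using insert by (intro P.M.finsum_insert) auto
        moreover have "r s \<odot>\<^bsub>P\<^esub> s \<in> S" using insert.prems r(1) by (intro rs) auto
        ultimately show ?case using insert S(1) by (simp add: k_closed_def)
      qed
      then show "x \<in> S" using G(1) r(2) by simp
    qed
  qed
  moreover have "finite ?T" using G finite_expo by simp
  ultimately show ?thesis by blast
qed

text \<open>A linear map from sequences of scalars to the module that depends on the first \<open>m\<close> terms only, that is, a
linear map from \<open>k^m\<close>.\<close>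

definition param :: "((nat list \<Rightarrow> 'k) set, 'm) module \<Rightarrow> nat \<Rightarrow> ((nat \<Rightarrow> 'k) \<Rightarrow> 'm) \<Rightarrow> bool" where
  "param P m \<delta> \<longleftrightarrow> (\<forall>w. \<delta> w \<in> carrier P) \<and> (\<forall>v w. \<delta> (\<lambda>n. v n + w n) = \<delta> v \<oplus>\<^bsub>P\<^esub> \<delta> w) \<and>
     (\<forall>r w. \<delta> (\<lambda>n. r * w n) = cst r \<odot>\<^bsub>P\<^esub> \<delta> w) \<and> (\<forall>v w. (\<forall>n<m. v n = w n) \<longrightarrow> \<delta> v = \<delta> w)"

lemma paramD:
  assumes "param P m \<delta>"
  shows "\<delta> w \<in> carrier P" "\<delta> (\<lambda>n. v n + w n) = \<delta> v \<oplus>\<^bsub>P\<^esub> \<delta> w" "\<delta> (\<lambda>n. r * w n) = cst r \<odot>\<^bsub>P\<^esub> \<delta> w"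
    "(\<And>n. n < m \<Longrightarrow> v n = w n) \<Longrightarrow> \<delta> v = \<delta> w"
  using assms unfolding param_def by blast+

lemma param_exists:
  assumes P: "left_module QA P" and T: "finite T" "T \<subseteq> carrier P"
  shows "\<exists>m \<delta>. param P m \<delta> \<and> T \<subseteq> range \<delta>"
  using T
proof (induction T rule: finite_induct)
  case empty
  interpret P: left_module QA P by fact
  have "param P 0 (\<lambda>_. \<zero>\<^bsub>P\<^esub>)" by (simp add: param_def P.smult_zero_r cst_closed)
  then show ?case by blast
next
  case (insert t T)
  interpret P: left_module QA P by fact
  obtain m \<delta> where \<delta>: "param P m \<delta>" "T \<subseteq> range \<delta>" using insert by auto
  have t: "t \<in> carrier P" using insert by simp
  define \<epsilon> where "\<epsilon> w = \<delta> w \<oplus>\<^bsub>P\<^esub> cst (w m) \<odot>\<^bsub>P\<^esub> t" for w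
  have c: "cst r \<odot>\<^bsub>P\<^esub> t \<in> carrier P" for r using t by (simp add: P.smult_closed cst_closed)
  have "param P (Suc m) \<epsilon>" unfolding param_def
  proof (intro conjI allI impI)
    fix v w r
    show "\<epsilon> w \<in> carrier P" by (simp add: \<epsilon>_def c paramD(1)[OF \<delta>(1)])
    show "\<epsilon> (\<lambda>n. v n + w n) = \<epsilon> v \<oplus>\<^bsub>P\<^esub> \<epsilon> w"
      using t c paramD(1)[OF \<delta>(1)]
      by (simp add: \<epsilon>_def paramD(2)[OF \<delta>(1)] cst_add P.smult_l_distr cst_closed P.M.a_ac)
    show "\<epsilon> (\<lambda>n. r * w n) = cst r \<odot>\<^bsub>P\<^esub> \<epsilon> w"
      using t c paramD(1)[OF \<delta>(1)]
      by (simp add: \<epsilon>_def paramD(3)[OF \<delta>(1)] cst_mult P.smult_assoc P.smult_r_distr cst_closed)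
    assume "\<forall>n<Suc m. v n = w n"
    then show "\<epsilon> v = \<epsilon> w" using paramD(4)[OF \<delta>(1), of v w] by (simp add: \<epsilon>_def)
  qed
  moreover have "insert t T \<subseteq> range \<epsilon>"
  proof
    fix x assume "x \<in> insert t T"
    then consider "x = t" | "x \<in> T" by blast
    then show "x \<in> range \<epsilon>"
    proof cases
      case 1
      let ?w = "\<lambda>n. if n = m then 1 else 0 :: 'k"
      have "\<delta> ?w = \<delta> (\<lambda>n. 0 * ?w n)" by (rule paramD(4)[OF \<delta>(1)]) simp
      also have "\<dots> = \<zero>\<^bsub>P\<^esub>" unfolding paramD(3)[OF \<delta>(1)] cst_0 by (rule P.smult_zero_l[OF paramD(1)[OF \<delta>(1)]])
      finally have "\<epsilon> ?w = t" using t by (simp add: \<epsilon>_def cst_1 P.smult_one)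
      then show ?thesis using 1 by (metis rangeI)
    next
      case 2
      then obtain w where w: "x = \<delta> w" using \<delta>(2) by auto
      let ?w = "w(m := 0)"
      have "\<delta> ?w = \<delta> w" by (rule paramD(4)[OF \<delta>(1)]) simp
      then have "\<epsilon> ?w = x" using t paramD(1)[OF \<delta>(1)] by (simp add: \<epsilon>_def cst_0 P.smult_zero_l w)
      then show ?thesis by (metis rangeI)
    qed
  qed
  ultimately show ?case by blast
qed

lemma param_onto:
  assumes P: "left_module QA P" and fg: "finitely_generated QA P"
  shows "\<exists>m \<delta>. param P m \<delta> \<and> range \<delta> = carrier P"
proof -
  interpret P: left_module QA P by fact
  obtain T where T: "finite T" "k_spans P T" using finite_k_span[OF P fg] by blast
  obtain m \<delta> where \<delta>: "param P m \<delta>" "T \<subseteq> range \<delta>"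
    using param_exists[OF P T(1)] T(2) unfolding k_spans_def by blast
  have "\<delta> (\<lambda>n. 0 * (0 :: 'k)) = \<zero>\<^bsub>P\<^esub>"
    using paramD(3)[OF \<delta>(1), of 0 "\<lambda>_. 0"] paramD(1)[OF \<delta>(1)] by (simp add: cst_0 P.smult_zero_l)
  then have "k_closed P (range \<delta>)" unfolding k_closed_def
    using paramD(2,3)[OF \<delta>(1)] by (auto simp: image_iff) metis+
  then have "carrier P \<subseteq> range \<delta>" using T(2) \<delta>(2) unfolding k_spans_def by blast
  then show ?thesis using \<delta>(1) paramD(1)[OF \<delta>(1)] by blast
qed

text \<open>Take a surjection from \<open>k^m\<close> with \<open>m\<close> minimal.  If it had a kernel vector with nonzero entry \<open>j\<close>,
then the vectors with entry \<open>j\<close> equal to zero would already cover the module, giving a surjection from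
\<open>k^(m-1)\<close>.\<close>

lemma basis_exists:
  assumes P: "left_module QA P" and fg: "finitely_generated QA P"
  shows "\<exists>m \<delta>. param P m \<delta> \<and> range \<delta> = carrier P \<and> (\<forall>v. (\<forall>n\<ge>m. v n = 0) \<longrightarrow> \<delta> v = \<zero>\<^bsub>P\<^esub> \<longrightarrow> (\<forall>n. v n = 0))"
proof -
  interpret P: left_module QA P by fact
  define m where "m = (LEAST m. \<exists>\<delta>. param P m \<delta> \<and> range \<delta> = carrier P)"
  have "\<exists>\<delta>. param P m \<delta> \<and> range \<delta> = carrier P" unfolding m_def
    using param_onto[OF P fg] by (rule LeastI_ex)
  then obtain \<delta> where \<delta>: "param P m \<delta>" "range \<delta> = carrier P" by blast
  have "v j = 0" if v: "\<forall>n\<ge>m. v n = 0" "\<delta> v = \<zero>\<^bsub>P\<^esub>" for v j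
  proof (rule ccontr)
    assume vj: "v j \<noteq> 0"
    then have j: "j < m" using v(1) by (metis not_le)
    \<comment> \<open>Insert a zero at position \<open>j\<close>.\<close>
    define ins where "ins w = (\<lambda>n. if n < j then w n else if n = j then 0 else w (n - 1))" for w :: "nat \<Rightarrow> 'k"
    have "param P (m - 1) (\<delta> \<circ> ins)" unfolding param_def o_apply
    proof (intro conjI allI impI)
      fix x w r
      show "\<delta> (ins w) \<in> carrier P" by (rule paramD(1)[OF \<delta>(1)])
      have "ins (\<lambda>n. x n + w n) = (\<lambda>n. ins x n + ins w n)" by (auto simp: ins_def)
      then show "\<delta> (ins (\<lambda>n. x n + w n)) = \<delta> (ins x) \<oplus>\<^bsub>P\<^esub> \<delta> (ins w)" by (simp add: paramD(2)[OF \<delta>(1)])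
      have "ins (\<lambda>n. r * w n) = (\<lambda>n. r * ins w n)" by (auto simp: ins_def)
      then show "\<delta> (ins (\<lambda>n. r * w n)) = cst r \<odot>\<^bsub>P\<^esub> \<delta> (ins w)" by (simp add: paramD(3)[OF \<delta>(1)])
      assume "\<forall>n<m - 1. x n = w n"
      then show "\<delta> (ins x) = \<delta> (ins w)" using j by (intro paramD(4)[OF \<delta>(1)]) (auto simp: ins_def)
    qed
    moreover have "range (\<delta> \<circ> ins) = carrier P"
    proof
      show "range (\<delta> \<circ> ins) \<subseteq> carrier P" using paramD(1)[OF \<delta>(1)] by auto
      show "carrier P \<subseteq> range (\<delta> \<circ> ins)"
      proof
        fix y assume "y \<in> carrier P"
        then obtain u where u: "y = \<delta> u" using \<delta>(2) by (metis imageE)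
        \<comment> \<open>Subtract a multiple of the kernel vector to make entry \<open>j\<close> zero.\<close>
        define r where "r = - (u j / v j)"
        define u' where "u' = (\<lambda>n. u n + r * v n)"
        have "\<delta> u' = \<delta> u \<oplus>\<^bsub>P\<^esub> cst r \<odot>\<^bsub>P\<^esub> \<zero>\<^bsub>P\<^esub>"
          unfolding u'_def using paramD(2)[OF \<delta>(1), of u "\<lambda>n. r * v n"] paramD(3)[OF \<delta>(1), of r v] v(2) by simp
        then have "\<delta> u' = y" using paramD(1)[OF \<delta>(1)] by (simp add: P.smult_zero_r cst_closed u)
        moreover have "u' j = 0" using vj by (simp add: u'_def r_def)
        then have "ins (\<lambda>n. if n < j then u' n else u' (Suc n)) = u'"
          by (auto simp: ins_def fun_eq_iff)
        ultimately show "y \<in> range (\<delta> \<circ> ins)" by (metis comp_apply rangeI)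
      qed
    qed
    ultimately have "m \<le> m - 1" unfolding m_def by (intro Least_le) blast
    then show False using j by simp
  qed
  with \<delta> show ?thesis by blast
qed

definition vsc :: "'k \<Rightarrow> (nat \<Rightarrow> 'k) \<Rightarrow> nat \<Rightarrow> 'k" where "vsc r w = (\<lambda>n. r * w n)"

text \<open>The operators \<open>L l\<close> act on a sequence by first mapping it to the module; this discards the terms
from \<open>m\<close> on, so the relations hold for all sequences.\<close>

theorem coordinates_exist:
  fixes N :: "((nat list \<Rightarrow> 'k) set, 'n) module"
  assumes N: "left_module QA N" and fg: "finitely_generated QA N"
  shows "\<exists>L m \<nu>. qci_ext vsc c a q L {w. \<forall>n\<ge>m. w n = 0} N \<nu>"
proof -
  interpret N: left_module QA N by fact
  interpret NC: qrep c a q "carrier N" "add N" "zero N" "msm N" "mX N" by (rule module_qrep[OF N])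
  obtain m \<delta> where \<delta>: "param N m \<delta>" "range \<delta> = carrier N"
    and inj: "\<And>v. (\<forall>n\<ge>m. v n = 0) \<Longrightarrow> \<delta> v = \<zero>\<^bsub>N\<^esub> \<Longrightarrow> \<forall>n. v n = 0"
    using basis_exists[OF N fg] by blast
  let ?W = "{w :: nat \<Rightarrow> 'k. \<forall>n\<ge>m. w n = 0}"
  note \<delta>D = paramD[OF \<delta>(1)]
  have \<delta>_plus: "\<delta> (v + w) = \<delta> v \<oplus>\<^bsub>N\<^esub> \<delta> w" for v w using \<delta>D(2)[of v w] by (simp add: plus_fun_def)
  have \<delta>_vsc: "\<delta> (vsc r w) = cst r \<odot>\<^bsub>N\<^esub> \<delta> w" for r w by (simp add: vsc_def \<delta>D(3))
  have bij: "bij_betw \<delta> ?W (carrier N)"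
  proof (rule bij_betwI')
    fix v w assume vw: "v \<in> ?W" "w \<in> ?W"
    show "\<delta> v = \<delta> w \<longleftrightarrow> v = w"
    proof
      assume e: "\<delta> v = \<delta> w"
      let ?u = "v + vsc (- 1) w"
      have "\<delta> ?u = \<zero>\<^bsub>N\<^esub>" using NC.pl_minus[OF \<delta>D(1)] by (simp add: \<delta>_plus \<delta>_vsc e)
      moreover have "\<forall>n\<ge>m. ?u n = 0" using vw by (auto simp: vsc_def)
      ultimately have "\<forall>n. ?u n = 0" by (intro inj)
      then show "v = w" by (auto simp: vsc_def)
    qed simp
  next
    fix y assume "y \<in> carrier N"
    then obtain u where u: "y = \<delta> u" using \<delta>(2) by (metis imageE)
    have "\<delta> (\<lambda>n. if n < m then u n else 0) = \<delta> u" by (rule \<delta>D(4)) simp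
    then show "\<exists>w\<in>?W. y = \<delta> w" using u by (intro bexI[of _ "\<lambda>n. if n < m then u n else 0"]) auto
  qed (rule \<delta>D(1))
  define \<nu> where "\<nu> = inv_into ?W \<delta>"
  have \<nu>: "bij_betw \<nu> (carrier N) ?W" unfolding \<nu>_def by (rule bij_betw_inv_into[OF bij])
  have \<delta>\<nu>: "\<delta> (\<nu> y) = y" "\<nu> y \<in> ?W" if "y \<in> carrier N" for y
    using that bij bij_betw_inv_into_right[OF bij] bij_betwE[OF \<nu>] unfolding \<nu>_def by blast+
  have \<nu>_eq: "\<nu> y = w" if "w \<in> ?W" "\<delta> w = y" for y w
    using bij_betw_inv_into_left[OF bij that(1)] that(2) by (simp add: \<nu>_def)
  have \<nu>_add: "\<nu> (x \<oplus>\<^bsub>N\<^esub> y) = \<nu> x + \<nu> y" if "x \<in> carrier N" "y \<in> carrier N" for x y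
    using \<delta>\<nu>[OF that(1)] \<delta>\<nu>[OF that(2)] by (intro \<nu>_eq) (auto simp: \<delta>_plus)
  have \<nu>_cst: "\<nu> (cst r \<odot>\<^bsub>N\<^esub> x) = vsc r (\<nu> x)" if "x \<in> carrier N" for r x
    using \<delta>\<nu>[OF that] by (intro \<nu>_eq) (auto simp: \<delta>_vsc, auto simp: vsc_def)
  have \<nu>_zero: "\<nu> \<zero>\<^bsub>N\<^esub> = 0" using \<nu>_cst[OF N.M.zero_closed, of 0] by (simp add: cst_0 N.smult_zero_l) (simp add: vsc_def zero_fun_def)
  define L where "L l w = (if l \<in> {1..c} then \<nu> (var l \<odot>\<^bsub>N\<^esub> \<delta> w) else 0)" for l w
  have xc: "var l \<odot>\<^bsub>N\<^esub> \<delta> w \<in> carrier N" if "l \<in> {1..c}" for l w by (rule NC.X_closed[OF that \<delta>D(1)])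
  interpret V: vector_space vsc
    by unfold_locales (auto simp: vsc_def algebra_simps)
  have "quantum_operators vsc c a q L ?W"
  proof
    show "2 \<le> a" "q ^ a = 1" by (rule a_ge_2, rule q_root)
    show "L l (x + y) = L l x + L l y" for l x y
      using NC.X_pl[OF _ \<delta>D(1) \<delta>D(1)] by (simp add: L_def \<delta>_plus \<nu>_add xc)
    show "L l (vsc r x) = vsc r (L l x)" for l r x
      using NC.X_sm[OF _ \<delta>D(1)] by (cases "l \<in> {1..c}") (auto simp: L_def \<delta>_vsc \<nu>_cst xc)
    show "L l (L n x) = vsc q (L n (L l x))" if "1 \<le> l" "l < n" "n \<le> c" for l n x
      using that NC.X_q_commute[OF that \<delta>D(1), of x] by (simp add: L_def \<delta>\<nu> xc \<nu>_cst NC.X_closed)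
    show "(L l ^^ a) x = 0" if l: "l \<in> {1..c}" for l x
    proof -
      have "(L l ^^ Suc n) x = \<nu> ((mX N l ^^ Suc n) (\<delta> x))" for n
      proof (induction n)
        case 0
        then show ?case using l by (simp add: L_def)
      next
        case (Suc n)
        have "(L l ^^ Suc (Suc n)) x = L l (\<nu> ((mX N l ^^ Suc n) (\<delta> x)))" using Suc by simp
        also have "\<dots> = \<nu> ((mX N l ^^ Suc (Suc n)) (\<delta> x))"
          using l \<delta>\<nu>(1)[OF NC.Xpow_closed[OF l \<delta>D(1), of "Suc n" x]] by (simp add: L_def)
        finally show ?case .
      qed
      from this[of "a - 1"] have "(L l ^^ a) x = \<nu> ((mX N l ^^ a) (\<delta> x))" using a_ge_2 by (simp del: funpow.simps add: Suc_diff_1)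
      then show ?thesis using NC.X_nilpotent[OF l \<delta>D(1)] by (simp add: \<nu>_zero)
    qed
    show "V.subspace ?W" by (rule V.subspaceI) (auto simp: vsc_def)
    show "L l x \<in> ?W" for l x using \<delta>\<nu>(2)[OF xc] by (auto simp: L_def)
  qed
  then have "qci_ext vsc c a q L ?W N \<nu>"
    using N \<nu> \<nu>_add \<nu>_cst qci_axioms
    by (intro qci_ext.intro qci_target.intro qci_ext_axioms.intro) (auto simp: L_def \<delta>\<nu>)
  then show ?thesis by blast
qed

end

theorem theorem3p4:
  fixes c a :: nat and q :: "'k::field"
    and M :: "((nat list \<Rightarrow> 'k) set, 'm) module"
    and N :: "((nat list \<Rightarrow> 'k) set, 'n) module"
  assumes "c \<ge> 1" and "a \<ge> 2" and "q ^ a = 1"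
    and "left_module (quantum_ci c a q) M" and "finitely_generated (quantum_ci c a q) M"
    and "left_module (quantum_ci c a q) N" and "finitely_generated (quantum_ci c a q) N"
  shows "(\<forall>n>0. trivial_group (Ext (quantum_ci c a q) M N n)) \<or>
    (\<exists>m0::nat.
      (\<forall>n\<ge>m0. even n \<longrightarrow> \<not> trivial_group (Ext (quantum_ci c a q) M N n)) \<or>
      (\<forall>n\<ge>m0. odd n \<longrightarrow> \<not> trivial_group (Ext (quantum_ci c a q) M N n)))"
proof -
  interpret qci c a q using assms(2,3) by unfold_locales
  obtain L m \<nu> where "qci_ext vsc c a q L {w. \<forall>n\<ge>m. w n = 0} N \<nu>"
    using coordinates_exist[OF assms(6,7)] by blast
  then interpret E: qci_ext vsc c a q L "{w. \<forall>n\<ge>m. w n = 0}" N \<nu> .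
  interpret C: cochains vsc c a q L "{w. \<forall>n\<ge>m. w n = 0}" "carrier M" "add M" "zero M" "msm M" "mX M"
    by (rule E.cochains_module[OF assms(4)])
  obtain T where T: "finite T" "k_spans M T" using finite_k_span[OF assms(4,5)] by blast
  have "f = 0" if f: "f \<in> C.Hom_k" and z: "\<And>x. x \<in> T \<Longrightarrow> f x = 0" for f
  proof
    fix x
    have "k_closed M {x \<in> carrier M. f x = 0}" unfolding k_closed_def
      using C.Hom_kD[OF f] C.Hom_k_ze[OF f] C.ze_closed C.pl_closed C.sm_closed by (simp add: E.scale_zero_right)
    moreover have "T \<subseteq> {x \<in> carrier M. f x = 0}" using T(2) z unfolding k_spans_def by blast
    ultimately have "carrier M \<subseteq> {x \<in> carrier M. f x = 0}" using T(2) unfolding k_spans_def by blast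
    then show "f x = 0 x" using C.Hom_kD(2)[OF f, of x] by (cases "x \<in> carrier M") auto
  qed
  note T_determines = this
  have "\<exists>m0. \<forall>n\<ge>m0. C.exact_at (n + 2) \<longrightarrow> C.exact_at n"
  proof (rule C.exact_at_minus_2[of T "\<lambda>n w. w n" m])
    show "finite T" "T \<subseteq> carrier M" using T by (auto simp: k_spans_def)
    show "f = 0" if "f \<in> C.Hom_k" "\<And>x. x \<in> T \<Longrightarrow> f x = 0" for f using that by (rule T_determines)
    show "w = 0" if "w \<in> {w. \<forall>n\<ge>m. w n = 0}" "\<And>n. n < m \<Longrightarrow> w n = 0" for w
    proof
      fix n show "w n = 0 n" using that by (cases "n < m") auto
    qed
  qed (simp_all add: vsc_def)
  from C.exact_at_trichotomy[OF this]
  have "(\<forall>n>0. E.exact_mod M n) \<or>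
    (\<exists>m0. (\<forall>n\<ge>m0. even n \<longrightarrow> \<not> E.exact_mod M n) \<or> (\<forall>n\<ge>m0. odd n \<longrightarrow> \<not> E.exact_mod M n))"
    unfolding E.exact_mod_def .
  moreover have eq: "trivial_group (Ext QA M N n) \<longleftrightarrow> E.exact_mod M n" if "0 < n" for n
    using E.trivial_Ext_iff[OF assms(4), of "n - 1"] that by simp
  ultimately show ?thesis
  proof (elim disjE exE)
    assume "\<forall>n>0. E.exact_mod M n"
    then show ?thesis using eq by simp
  next
    fix m0 assume h: "\<forall>n\<ge>m0. even n \<longrightarrow> \<not> E.exact_mod M n"
    \<comment> \<open>Degree 0 is skipped, where \<open>Ext\<close> is \<open>Hom\<close> and not described by exactness.\<close>
    have "\<forall>n\<ge>Suc m0. even n \<longrightarrow> \<not> trivial_group (Ext QA M N n)" using h eq by simp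
    then show ?thesis by blast
  next
    fix m0 assume h: "\<forall>n\<ge>m0. odd n \<longrightarrow> \<not> E.exact_mod M n"
    have "\<forall>n\<ge>Suc m0. odd n \<longrightarrow> \<not> trivial_group (Ext QA M N n)" using h eq by simp
    then show ?thesis by blast
  qed
qed

end
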